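(* There exist $C>0$ and a continuous nondecreasing function $\varphi:\mathbb R^+\to\mathbb R^+$ such that for every $T>0$, if $p>8+d$ and $\sigma>1+d/2$, then for every smooth vector field $G(t,s,x,v)\in\mathbb R^d$ and all $H\in \mathrm L^2(0,T;\mathrm L^2(\mathbb T^d))$, $$\big\|\mathrm K^{\mathrm{free}}_G[H]-\mathrm K^{\mathrm{fric}}_G[H]\big\|_{\mathrm L^2(0,T;\mathrm H^1(\mathbb T^d))}\le C\,\varphi(T)\sup_{0\le s,t\le T}\|G(t,s)\|_{\mathcal H^p_\sigma}\,\|H\|_{\mathrm L^2(0,T;\mathrm L^2(\mathbb T^d))}.$$
   Context: Here $d\ge1$, $\mathbb T^d=\mathbb R^d/(2\pi\mathbb Z)^d$ with normalized Lebesgue measure, $\mathrm H^1(\mathbb T^d)$ is the standard $\mathrm L^2$-based Sobolev space, and for $p\in\mathbb N$, $\sigma\ge0$, $$\|\mathrm f\|_{\mathcal H^p_\sigma}=\Big(\sum_{|\alpha|+|\beta|\le p}\int_{\mathbb T^d}\int_{\mathbb R^d}(1+|v|^2)^{\sigma}|\partial_x^\alpha\partial_v^\beta \mathrm f(x,v)|^2\,dx\,dv\Big)^{1/2}.$$ For a smooth vector field $G(t,s,x,v)\in\mathbb R^d$ and a function $H(t,x)$, the averaging operators are $$\mathrm K^{\mathrm{free}}_G[H](t,x)=\int_0^t\int_{\mathbb R^d}[\nabla_xH](s,x-(t-s)v)\cdot G(t,s,x,v)\,dv\,ds,$$ $$\mathrm K^{\mathrm{fric}}_G[H](t,x)=\int_0^t\int_{\mathbb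 R^d}[\nabla_xH](s,x+(1-e^{t-s})v)\cdot G(t,s,x,v)\,dv\,ds.$$ *)

theory Defs
  imports "HOL-Analysis.Analysis"
begin

(* Functions on the torus T^d = R^d / (2 pi Z)^d, d = CARD('n), are functions on R^d which are
   2 pi-periodic in each coordinate; they are integrated over the fundamental cube
   [0, 2 pi]^d with Lebesgue measure normalized to total mass 1. *)

definition torus :: "(real ^ 'n) measure" where
  "torus = uniform_measure lborel (cbox 0 (\<chi> i. 2 * pi))"

definition periodic :: "(real ^ 'n \<Rightarrow> 'b) \<Rightarrow> bool" where
  "periodic f \<longleftrightarrow> (\<forall>x i. f (x + axis i (2 * pi)) = f x)"

primrec Ck_on ::
  "nat \<Rightarrow> ('a::euclidean_space \<Rightarrow> 'b::real_normed_vector) \<Rightarrow> 'a set \<Rightarrow> bool" where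
  "Ck_on 0 f U \<longleftrightarrow> continuous_on U f"
| "Ck_on (Suc k) f U \<longleftrightarrow> (\<forall>x\<in>U. f differentiable (at x)) \<and>
     (\<forall>e\<in>Basis. Ck_on k (\<lambda>x. frechet_derivative f (at x) e) U)"

(* As usual, smooth on a set which need not be open means: smooth on a neighbourhood of it. *)
definition smooth_on ::
  "('a::euclidean_space \<Rightarrow> 'b::real_normed_vector) \<Rightarrow> 'a set \<Rightarrow> bool" where
  "smooth_on f A \<longleftrightarrow> (\<exists>U. open U \<and> A \<subseteq> U \<and> (\<forall>k. Ck_on k f U))"

definition esqrt :: "ennreal \<Rightarrow> ennreal" where
  "esqrt x = (if x = \<infinity> then \<infinity> else ennreal (sqrt (enn2real x)))"

definition dx ::
  "'n \<Rightarrow> (real ^ 'n \<Rightarrow> 'v \<Rightarrow> 'b::real_normed_vector) \<Rightarrow> real ^ 'n \<Rightarrow> 'v \<Rightarrow> 'b" where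
  "dx i f = (\<lambda>x v. frechet_derivative (\<lambda>y. f y v) (at x) (axis i 1))"

definition dv ::
  "'n \<Rightarrow> ('x \<Rightarrow> real ^ 'n \<Rightarrow> 'b::real_normed_vector) \<Rightarrow> 'x \<Rightarrow> real ^ 'n \<Rightarrow> 'b" where
  "dv i f = (\<lambda>x v. frechet_derivative (\<lambda>w. f x w) (at v) (axis i 1))"

(* The multi-index power D^alpha of a family of partial derivatives: D i is applied alpha i times
   for each i.  On smooth functions the D i commute, so the choice of the order is irrelevant. *)
definition multi :: "('n \<Rightarrow> 'f \<Rightarrow> 'f) \<Rightarrow> ('n \<Rightarrow> nat) \<Rightarrow> 'f \<Rightarrow> 'f" where
  "multi D \<alpha> = foldr D (SOME is. \<forall>i. count_list is i = \<alpha> i)"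

definition weighted_Sobolev_norm ::
  "nat \<Rightarrow> real \<Rightarrow> (real ^ 'n \<Rightarrow> real ^ 'n \<Rightarrow> 'b::real_normed_vector) \<Rightarrow> ennreal" where
  "weighted_Sobolev_norm p \<sigma> f =
     esqrt (\<Sum>(\<alpha>, \<beta>) \<in> {(\<alpha> :: 'n \<Rightarrow> nat, \<beta> :: 'n \<Rightarrow> nat). sum \<alpha> UNIV + sum \<beta> UNIV \<le> p}.
       \<integral>\<^sup>+x. \<integral>\<^sup>+v. ennreal ((1 + (norm v)\<^sup>2) powr \<sigma> *
         (norm (multi dx \<alpha> (multi dv \<beta> f) x v))\<^sup>2) \<partial>lborel \<partial>torus)"

definition L2_L2_norm :: "real \<Rightarrow> (real \<Rightarrow> real ^ 'n \<Rightarrow> real) \<Rightarrow> ennreal" where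
  "L2_L2_norm T H = esqrt (\<integral>\<^sup>+t\<in>{0<..<T}. (\<integral>\<^sup>+x. ennreal ((H t x)\<^sup>2) \<partial>torus) \<partial>lborel)"

(* Elements of L^2(0,T; L^2(T^d)), through their Borel measurable periodic representatives. *)
definition in_L2_L2 :: "real \<Rightarrow> (real \<Rightarrow> real ^ 'n \<Rightarrow> real) \<Rightarrow> bool" where
  "in_L2_L2 T H \<longleftrightarrow>
     set_borel_measurable borel ({0<..<T} \<times> UNIV) (\<lambda>(t, x). H t x) \<and>
     (\<forall>t\<in>{0<..<T}. periodic (H t)) \<and>
     L2_L2_norm T H < \<infinity>"

(* For H merely in L^2 the gradient of H is a distribution.  Scalar distributions on the torus are
   functionals on (smooth periodic) functions psi, vector distributions are functionals on (smooth
   periodic) vector fields Phi; a function f (vector field F) is identified with the functional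
   psi |-> integral f psi (Phi |-> integral F . Phi).
   The values of the functionals on other arguments are irrelevant. *)

type_synonym 'n distr = "(real ^ 'n \<Rightarrow> real) \<Rightarrow> real"
type_synonym 'n vdistr = "(real ^ 'n \<Rightarrow> real ^ 'n) \<Rightarrow> real"

definition divergence :: "(real ^ 'n \<Rightarrow> real ^ 'n) \<Rightarrow> real ^ 'n \<Rightarrow> real" where
  "divergence \<Phi> x = (\<Sum>i\<in>UNIV. frechet_derivative \<Phi> (at x) (axis i 1) $ i)"

definition grad :: "(real ^ 'n \<Rightarrow> real) \<Rightarrow> 'n vdistr" where
  "grad h = (\<lambda>\<Phi>. - (LINT y|torus. h y * divergence \<Phi> y))"

(* The distribution x |-> u (x + a). *)
definition shift :: "real ^ 'n \<Rightarrow> 'n vdistr \<Rightarrow> 'n vdistr" where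
  "shift a u = (\<lambda>\<Phi>. u (\<lambda>y. \<Phi> (y - a)))"

(* K[H](t, .) as a distribution in x; testing  u . G  against psi is testing u against psi G. *)

definition K_free ::
  "(real \<Rightarrow> real \<Rightarrow> real ^ 'n \<Rightarrow> real ^ 'n \<Rightarrow> real ^ 'n) \<Rightarrow> (real \<Rightarrow> real ^ 'n \<Rightarrow> real) \<Rightarrow>
   real \<Rightarrow> 'n distr" where
  "K_free G H t = (\<lambda>\<psi>. LINT s:{0<..<t}|lborel. LINT v|lborel.
     shift (- ((t - s) *\<^sub>R v)) (grad (H s)) (\<lambda>x. \<psi> x *\<^sub>R G t s x v))"

definition K_fric ::
  "(real \<Rightarrow> real \<Rightarrow> real ^ 'n \<Rightarrow> real ^ 'n \<Rightarrow> real ^ 'n) \<Rightarrow> (real \<Rightarrow> real ^ 'n \<Rightarrow> real) \<Rightarrow>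
   real \<Rightarrow> 'n distr" where
  "K_fric G H t = (\<lambda>\<psi>. LINT s:{0<..<t}|lborel. LINT v|lborel.
     shift ((1 - exp (t - s)) *\<^sub>R v) (grad (H s)) (\<lambda>x. \<psi> x *\<^sub>R G t s x v))"

(* The k-th Fourier coefficient u(exp(- i k . x)) of a real distribution u. *)
definition fourier_coeff :: "'n::finite distr \<Rightarrow> int ^ 'n \<Rightarrow> complex" where
  "fourier_coeff u k =
     Complex (u (\<lambda>x. cos (\<Sum>i\<in>UNIV. of_int (k $ i) * x $ i)))
             (- u (\<lambda>x. sin (\<Sum>i\<in>UNIV. of_int (k $ i) * x $ i)))"

(* A distribution u belongs to H^1(T^d) iff this is finite. *)
definition H1_norm :: "'n::finite distr \<Rightarrow> ennreal" where
  "H1_norm u = esqrt (\<Sum>\<^sub>\<infinity>k\<in>UNIV.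
     ennreal ((1 + (\<Sum>i\<in>UNIV. (of_int (k $ i))\<^sup>2)) * (cmod (fourier_coeff u k))\<^sup>2))"

definition L2_H1_norm :: "real \<Rightarrow> (real \<Rightarrow> 'n::finite distr) \<Rightarrow> ennreal" where
  "L2_H1_norm T u = esqrt (\<integral>\<^sup>+t\<in>{0<..<T}. (H1_norm (u t))\<^sup>2 \<partial>lborel)"

end

theory Submission
  imports Defs
begin

text \<open>
  Expand \<open>H\<close> and \<open>G\<close> in Fourier series in \<open>x\<close>.  The \<open>k\<close>-th coefficient of
  \<open>K_free G H t - K_fric G H t\<close> is the integral over \<open>s\<close> of a sum over \<open>l\<close> of the \<open>l\<close>-th coefficient
  of \<open>H s\<close> times the inner product of \<open>l\<close> with the difference of the Fourier transform in \<open>v\<close> of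
  the \<open>(k - l)\<close>-th coefficient of \<open>G t s\<close>, taken at the two frequencies \<open>\<tau> l\<close> and
  \<open>(exp \<tau> - 1) l\<close> with \<open>\<tau> = t - s\<close>.  These frequencies differ by at most \<open>\<tau>\<^sup>2 exp \<tau> |l|\<close>.
  Four integrations by parts in \<open>v\<close> and \<open>d + 2\<close> in \<open>x\<close> therefore bound this kernel, multiplied by
  the \<open>H\<^sup>1\<close> weight of \<open>k\<close>, by a constant times
  \<open>(1 + |k - l|)\<close> to the power \<open>- (d + 1)\<close> times \<open>|l| / (1 + \<tau> |l|)\<^sup>2\<close>.  The first factor is summable, the
  second has \<open>\<tau>\<close>-integral at most 1 uniformly in \<open>l\<close>, so that the Schur test, applied
  once in frequency and once in time, together with Bessel's inequality for \<open>H s\<close> gives the claim.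
\<close>

section \<open>Lebesgue measure on the torus\<close>

text \<open>The cancellation is worth one derivative. For either average alone, the gradient and the
  H^1 weight contribute a factor |l| each, and |l|^2 / (1 + \<tau> |l|)^4 has time integral of order
  |l|, unbounded in l. The gap between the two frequencies adds a factor \<tau>^2 |l|, so the total
  is |l| (\<tau> |l|)^2 / (1 + \<tau> |l|)^4; two of the four integrations by parts in v absorb
  (\<tau> |l|)^2, the other two leave the integrable time kernel. Differentiating the oscillation in
  its frequency costs one power of |v|. Derivatives of G are therefore needed in L^1 with weight 1 +
  |v|, and Cauchy-Schwarz obtains this from the norm because \<sigma> - 1 > d/2. Of the d + 2 powers
  gained in x, one is spent on moving the H^1 weight from k to l; the remaining d + 1 are summable
  over the lattice. H is only square integrable, so its gradient is never a function. It is moved at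
  once onto the character times G, and Fourier analysis is applied to the pairing of H with the
  smooth divergence of exp(-i k.x) G. The factor exp \<tau> in the gap is the only growth in time,
  whence \<phi> = exp.\<close>

type_synonym 'n phase = "(real ^ 'n) \<times> (real ^ 'n)"

definition char_phase :: "int ^ 'n \<Rightarrow> real ^ 'n \<Rightarrow> real" where
  "char_phase k x = (\<Sum>i\<in>UNIV. of_int (k $ i) * x $ i)"

text \<open>Half-open, so that its lattice translates partition the whole space exactly; it differs
  from the closed cube of \<open>torus\<close> by a null set only.\<close>

definition half_cube :: "(real ^ 'n) set" where
  "half_cube = {x. \<forall>i. 0 \<le> x $ i \<and> x $ i < 2 * pi}"

definition lattice :: "int ^ 'n \<Rightarrow> real ^ 'n" where
  "lattice k = (\<chi> i. 2 * pi * of_int (k $ i))"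

definition cell :: "real ^ 'n \<Rightarrow> int ^ 'n" where
  "cell x = (\<chi> i. \<lfloor>x $ i / (2 * pi)\<rfloor>)"

definition wrap :: "real ^ 'n \<Rightarrow> real ^ 'n" where
  "wrap x = x - lattice (cell x)"

lemma space_torus [simp]: "space torus = UNIV"
  and sets_torus [simp, measurable_cong]: "sets torus = sets borel"
  by (simp_all add: torus_def)

lemma measurable_half_cube [measurable]: "half_cube \<in> sets borel"
  unfolding half_cube_def by measurable

text \<open>Coordinatewise these are the inequalities that characterise the floor, so each point
  lies in exactly one translate of the cube.\<close>

lemma mem_half_cube_iff: "x - lattice k \<in> half_cube \<longleftrightarrow> k = cell x"
proof -
  have "0 \<le> x $ i - 2 * pi * of_int (k $ i) \<and> x $ i - 2 * pi * of_int (k $ i) < 2 * pi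
      \<longleftrightarrow> k $ i = \<lfloor>x $ i / (2 * pi)\<rfloor>" for i
  proof -
    have "k $ i = \<lfloor>x $ i / (2 * pi)\<rfloor> \<longleftrightarrow>
        of_int (k $ i) \<le> x $ i / (2 * pi) \<and> x $ i / (2 * pi) < of_int (k $ i) + 1"
      by (metis floor_eq_iff)
    also have "\<dots> \<longleftrightarrow> 0 \<le> x $ i - 2 * pi * of_int (k $ i) \<and> x $ i - 2 * pi * of_int (k $ i) < 2 * pi"
      using pi_gt_zero by (simp add: field_simps)
    finally show ?thesis by simp
  qed
  then show ?thesis
    by (simp add: half_cube_def lattice_def cell_def vec_eq_iff)
qed

text \<open>The two cubes can differ only on the d hyperplanes where some coordinate equals 2
  pi.\<close>

lemma AE_half_cube: "AE x in lborel. x \<in> cbox 0 (\<chi> i. 2 * pi) \<longleftrightarrow> (x::real^'n) \<in> half_cube"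
proof -
  have "AE x in lborel. x \<notin> {x::real^'n. x $ i = 2 * pi}" for i
  proof -
    have "negligible {x::real^'n. x \<bullet> axis i 1 = 2 * pi}"
      by (rule negligible_standard_hyperplane) (simp add: axis_in_Basis_iff)
    then have "{x::real^'n. x $ i = 2 * pi} \<in> null_sets lebesgue"
      by (simp add: negligible_iff_null_sets inner_axis)
    moreover have "{x::real^'n. x $ i = 2 * pi} \<in> sets lborel" by simp
    ultimately have "{x::real^'n. x $ i = 2 * pi} \<in> null_sets lborel"
      by (simp add: null_sets_completion_iff)
    then show ?thesis by (rule AE_not_in)
  qed
  then have "AE x in lborel. \<forall>i::'n. x \<notin> {x::real^'n. x $ i = 2 * pi}"
    by (subst AE_all_countable) auto
  then show ?thesis
    by eventually_elim (auto simp: half_cube_def mem_box_cart less_le)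
qed

lemma emeasure_lborel_cube: "emeasure lborel (cbox 0 (\<chi> i. 2 * pi) :: (real^'n) set) = ennreal ((2 * pi) ^ CARD('n))"
proof -
  have "prod ((\<bullet>) (\<chi> i. 2 * pi)) (Basis :: (real^'n) set) = (2 * pi) ^ CARD('n)"
  proof -
    have "prod ((\<bullet>) (\<chi> i. 2 * pi)) (Basis :: (real^'n) set) = (\<Prod>b\<in>(Basis :: (real^'n) set). 2 * pi)"
      by (intro prod.cong refl) (auto simp: Basis_vec_def inner_axis)
    then show ?thesis by simp
  qed
  moreover have "\<forall>b\<in>(Basis :: (real^'n) set). 0 \<bullet> b \<le> (\<chi> i. 2 * pi) \<bullet> b"
    by (auto simp: Basis_vec_def inner_axis)
  ultimately show ?thesis
    by (subst emeasure_lborel_cbox_eq) (auto)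
qed

lemma nn_integral_torus:
  fixes f :: "real ^ 'n \<Rightarrow> ennreal"
  assumes [measurable]: "f \<in> borel_measurable borel"
  shows "(\<integral>\<^sup>+x. f x \<partial>torus) = (\<integral>\<^sup>+x. f x * indicator half_cube x \<partial>lborel) / ennreal ((2 * pi) ^ CARD('n))"
proof -
  have "(\<integral>\<^sup>+x. f x \<partial>torus) = (\<integral>\<^sup>+x. f x * indicator (cbox 0 (\<chi> i. 2 * pi)) x \<partial>lborel) / ennreal ((2 * pi) ^ CARD('n))"
    unfolding torus_def by (subst nn_integral_uniform_measure) (auto simp: emeasure_lborel_cube)
  also have "(\<integral>\<^sup>+x. f x * indicator (cbox 0 (\<chi> i. 2 * pi)) x \<partial>lborel) = (\<integral>\<^sup>+x. f x * indicator half_cube x \<partial>lborel)"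
    by (rule nn_integral_cong_AE, use AE_half_cube in eventually_elim) (auto simp: indicator_def)
  finally show ?thesis .
qed

lemma emeasure_torus_UNIV [simp]: "emeasure torus (UNIV :: (real ^ 'n) set) = 1"
  using emeasure_uniform_measure_1[of lborel "cbox 0 (\<chi> i. 2 * pi) :: (real^'n) set"]
  unfolding torus_def by (simp add: emeasure_lborel_cube)

interpretation torus: finite_measure "torus :: (real ^ 'n) measure"
  by standard simp

lemma nn_integral_lborel_translate:
  fixes f :: "'a::euclidean_space \<Rightarrow> ennreal"
  assumes [measurable]: "f \<in> borel_measurable borel"
  shows "(\<integral>\<^sup>+x. f (x + a) \<partial>lborel) = (\<integral>\<^sup>+x. f x \<partial>lborel)"
proof -
  have "(\<integral>\<^sup>+x. f x \<partial>lborel) = (\<integral>\<^sup>+x. f x \<partial>distr lborel borel ((+) a))"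
    by (simp add: lborel_distr_plus)
  also have "\<dots> = (\<integral>\<^sup>+x. f (a + x) \<partial>lborel)"
    by (subst nn_integral_distr) auto
  finally show ?thesis by (simp add: add.commute)
qed

text \<open>Insert 1 as the sum over k of the indicators of the translated cubes, exchange sum and
  integral, and translate each piece back. Besides translation invariance on the torus, this later
  compares lattice sums with integrals.\<close>

lemma nn_integral_lborel_tiling:
  fixes f :: "real ^ 'n \<Rightarrow> ennreal"
  assumes [measurable]: "f \<in> borel_measurable borel"
  shows "(\<integral>\<^sup>+x. f x \<partial>lborel) = (\<integral>\<^sup>+k. (\<integral>\<^sup>+x. f (x + lattice k) * indicator half_cube x \<partial>lborel) \<partial>count_space UNIV)"
proof -
  have *: "(\<integral>\<^sup>+k. indicator half_cube (x - lattice k) \<partial>count_space UNIV) = (1::ennreal)" for x :: "real^'n"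
  proof -
    have "(\<integral>\<^sup>+k. indicator half_cube (x - lattice k) \<partial>count_space UNIV)
        = (\<integral>\<^sup>+k. indicator {cell x} k \<partial>count_space (UNIV :: (int^'n) set))"
      by (intro nn_integral_cong) (auto simp: indicator_def mem_half_cube_iff)
    then show ?thesis by simp
  qed
  have "(\<integral>\<^sup>+x. f x \<partial>lborel) = (\<integral>\<^sup>+x. (\<integral>\<^sup>+k. f x * indicator half_cube (x - lattice k) \<partial>count_space UNIV) \<partial>lborel)"
    by (subst nn_integral_cmult) (auto simp: *)
  also have "\<dots> = (\<integral>\<^sup>+k. (\<integral>\<^sup>+x. f x * indicator half_cube (x - lattice k) \<partial>lborel) \<partial>count_space UNIV)"
    by (rule nn_integral_count_space_nn_integral) auto
  also have "\<dots> = (\<integral>\<^sup>+k. (\<integral>\<^sup>+x. f (x + lattice k) * indicator half_cube x \<partial>lborel) \<partial>count_space UNIV)"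
  proof (rule nn_integral_cong)
    fix k :: "int^'n"
    show "(\<integral>\<^sup>+x. f x * indicator half_cube (x - lattice k) \<partial>lborel) = (\<integral>\<^sup>+x. f (x + lattice k) * indicator half_cube x \<partial>lborel)"
      using nn_integral_lborel_translate[of "\<lambda>x. f x * indicator half_cube (x - lattice k)" "lattice k"] by simp
  qed
  finally show ?thesis .
qed

lemma periodic_nat_multiple: "periodic f \<Longrightarrow> f (x + axis i (2 * pi * real n)) = f x"
proof (induction n arbitrary: x)
  case (Suc n)
  have "x + axis i (2 * pi * real (Suc n)) = (x + axis i (2 * pi * real n)) + axis i (2 * pi)"
    by (simp add: vec_eq_iff axis_def algebra_simps)
  with Suc show ?case by (metis periodic_def)
qed (simp add: axis_def flip: zero_vec_def)

lemma periodic_int_multiple: assumes "periodic f" shows "f (x + axis i (2 * pi * of_int n)) = f x"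
proof (cases "n \<ge> 0")
  case True
  then show ?thesis using periodic_nat_multiple[OF assms, of x i "nat n"] by simp
next
  case False
  have "(x + axis i (2 * pi * of_int n)) + axis i (2 * pi * real (nat (- n))) = x"
    using False by (simp add: vec_eq_iff axis_def algebra_simps)
  then show ?thesis using periodic_nat_multiple[OF assms, of "x + axis i (2 * pi * of_int n)" i "nat (- n)"] by metis
qed

lemma periodic_lattice: assumes "periodic f" shows "f (x + lattice k) = f x"
proof -
  have "finite S \<Longrightarrow> f (x + (\<Sum>i\<in>S. axis i (2 * pi * of_int (k $ i)))) = f x" for S
  proof (induction S rule: finite_induct)
    case (insert i S)
    have "x + (\<Sum>i\<in>insert i S. axis i (2 * pi * of_int (k $ i)))
        = (x + (\<Sum>i\<in>S. axis i (2 * pi * of_int (k $ i)))) + axis i (2 * pi * of_int (k $ i))"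
      using insert by (simp add: algebra_simps)
    then show ?case using insert.IH by (simp only: periodic_int_multiple[OF assms])
  qed simp
  moreover have "lattice k = (\<Sum>i\<in>UNIV. axis i (2 * pi * of_int (k $ i)))"
    by (simp add: vec_eq_iff lattice_def axis_def)
  ultimately show ?thesis by simp
qed

lemma periodic_wrap: "periodic f \<Longrightarrow> f (wrap x) = f x"
  using periodic_lattice[of f "wrap x" "cell x"] by (simp add: wrap_def)

lemma borel_measurable_vec_lambda:
  assumes "\<And>i. (\<lambda>x. f x i) \<in> borel_measurable M"
  shows "(\<lambda>x. (\<chi> i. f x i) :: real ^ 'n) \<in> borel_measurable M"
  by (subst borel_measurable_euclidean_space) (auto simp: Basis_vec_def inner_axis assms)

lemma measurable_wrap [measurable]: "wrap \<in> borel \<rightarrow>\<^sub>M borel"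
  unfolding wrap_def cell_def lattice_def
  by (intro borel_measurable_diff borel_measurable_vec_lambda) auto

lemma wrap_periodic: "wrap (x + axis i (2 * pi)) = wrap x"
proof -
  have "(x $ j + 2 * pi) / (2 * pi) = x $ j / (2 * pi) + 1" for j
    by (simp add: add_divide_distrib)
  then show ?thesis
    by (simp add: wrap_def cell_def lattice_def vec_eq_iff axis_def algebra_simps)
qed

text \<open>Translation moves the cube; the moved cube is cut along the lattice and folded back by
  periodicity, and its pieces cover the original cube exactly once.\<close>

lemma nn_integral_torus_translate:
  fixes f :: "real ^ 'n \<Rightarrow> ennreal"
  assumes [measurable]: "f \<in> borel_measurable borel" and per: "periodic f"
  shows "(\<integral>\<^sup>+x. f (x + a) \<partial>torus) = (\<integral>\<^sup>+x. f x \<partial>torus)"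
proof -
  have "(\<integral>\<^sup>+x. f (x + a) * indicator half_cube x \<partial>lborel) = (\<integral>\<^sup>+x. f x * indicator half_cube (x - a) \<partial>lborel)"
    using nn_integral_lborel_translate[of "\<lambda>x. f x * indicator half_cube (x - a)" a] by simp
  also have "\<dots> = (\<integral>\<^sup>+k. (\<integral>\<^sup>+x. f (x + lattice k) * indicator half_cube (x + lattice k - a) * indicator half_cube x \<partial>lborel) \<partial>count_space UNIV)"
    by (subst nn_integral_lborel_tiling) (simp_all add: algebra_simps)
  also have "\<dots> = (\<integral>\<^sup>+k. (\<integral>\<^sup>+x. f x * indicator half_cube x * indicator half_cube (x - a + lattice k) \<partial>lborel) \<partial>count_space UNIV)"
    by (simp add: periodic_lattice[OF per] mult_ac algebra_simps)
  also have "\<dots> = (\<integral>\<^sup>+x. (\<integral>\<^sup>+k. f x * indicator half_cube x * indicator half_cube (x - a + lattice k) \<partial>count_space UNIV) \<partial>lborel)"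
    by (rule nn_integral_count_space_nn_integral[symmetric]) auto
  also have "\<dots> = (\<integral>\<^sup>+x. f x * indicator half_cube x \<partial>lborel)"
  proof (rule nn_integral_cong)
    fix x :: "real^'n"
    have "lattice (- k) = - lattice k" for k :: "int^'n"
      by (simp add: lattice_def vec_eq_iff)
    then have "x - a + lattice k \<in> half_cube \<longleftrightarrow> k = - cell (x - a)" for k :: "int^'n"
      using mem_half_cube_iff[of "x - a" "- k"] by (simp add: \<open>lattice (- k) = - lattice k\<close>) (metis minus_minus)
    then have "(\<integral>\<^sup>+k. indicator half_cube (x - a + lattice k) \<partial>count_space UNIV)
        = (\<integral>\<^sup>+k. indicator {- cell (x - a)} k \<partial>count_space (UNIV :: (int^'n) set))"
      by (intro nn_integral_cong) (auto simp: indicator_def)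
    then show "(\<integral>\<^sup>+k. f x * indicator half_cube x * indicator half_cube (x - a + lattice k) \<partial>count_space UNIV) = f x * indicator half_cube x"
      by (subst nn_integral_cmult) auto
  qed
  finally show ?thesis by (simp add: nn_integral_torus)
qed

text \<open>Translation invariance as an equality of measures. A periodic f equals f composed with
  \<open>wrap\<close>, so Bochner integrals of vector-valued functions can be translated through
  this push-forward with no integrability assumption.\<close>

lemma distr_torus_wrap: "distr torus borel (\<lambda>x. wrap (x + a :: real ^ 'n)) = distr torus borel wrap"
proof (rule measure_eqI)
  fix A assume "A \<in> sets (distr torus borel (\<lambda>x. wrap (x + a :: real^'n)))"
  then have [measurable]: "A \<in> sets borel" by simp
  have "periodic (\<lambda>x. indicator A (wrap x) :: ennreal)"
    by (simp add: periodic_def wrap_periodic)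
  then have "(\<integral>\<^sup>+x. indicator A (wrap (x + a)) \<partial>torus) = (\<integral>\<^sup>+x. indicator A (wrap x) \<partial>torus)"
    by (intro nn_integral_torus_translate) auto
  then have "(\<integral>\<^sup>+x. indicator A x \<partial>distr torus borel (\<lambda>x. wrap (x + a))) = (\<integral>\<^sup>+x. indicator A x \<partial>distr torus borel wrap)"
    by (simp add: nn_integral_distr del: nn_integral_indicator)
  then show "emeasure (distr torus borel (\<lambda>x. wrap (x + a))) A = emeasure (distr torus borel wrap) A"
    by simp
qed simp

section \<open>Fourier series on the torus\<close>

lemma integral_torus_translate:
  fixes f :: "real ^ 'n \<Rightarrow> 'b::{banach, second_countable_topology}"
  assumes [measurable]: "f \<in> borel_measurable borel" and per: "periodic f"
  shows "(LINT x|torus. f (x + a)) = (LINT x|torus. f x)"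
proof -
  have "(LINT x|torus. f (x + a)) = (LINT x|torus. f (wrap (x + a)))"
    by (simp add: periodic_wrap[OF per])
  also have "\<dots> = (LINT x|distr torus borel (\<lambda>x. wrap (x + a)). f x)"
    by (subst integral_distr) auto
  also have "\<dots> = (LINT x|torus. f (wrap x))"
    unfolding distr_torus_wrap by (subst integral_distr) auto
  finally show ?thesis by (simp add: periodic_wrap[OF per])
qed

definition fchar :: "int ^ 'n \<Rightarrow> real ^ 'n \<Rightarrow> complex" where
  "fchar k x = cis (char_phase k x)"

lemma char_phase_add: "char_phase k (x + y) = char_phase k x + char_phase k y"
  and char_phase_index_add: "char_phase (k + l) x = char_phase k x + char_phase l x"
  and char_phase_index_minus: "char_phase (- k) x = - char_phase k x"
  and char_phase_zero [simp]: "char_phase 0 x = 0"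
  and char_phase_scaleR: "char_phase k (r *\<^sub>R x) = r * char_phase k x"
  and char_phase_axis [simp]: "char_phase k (axis i a) = of_int (k $ i) * a"
  and char_phase_index_axis: "char_phase (axis i b) x = of_int b * x $ i"
  by (simp_all add: char_phase_def algebra_simps sum.distrib sum_negf sum_distrib_left axis_def
      if_distrib[of "\<lambda>c. c * _"] if_distrib[of "\<lambda>c. _ * c"] if_distrib[of of_int] cong: if_cong)

lemma continuous_on_char_phase [continuous_intros]:
  "continuous_on S f \<Longrightarrow> continuous_on S (\<lambda>x. char_phase k (f x))"
  unfolding char_phase_def by (intro continuous_intros)

lemma continuous_on_fchar [continuous_intros]:
  "continuous_on S f \<Longrightarrow> continuous_on S (\<lambda>x. fchar k (f x))"
  unfolding fchar_def by (intro continuous_intros)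

lemma measurable_fchar [measurable]: "fchar k \<in> borel_measurable borel"
  by (intro borel_measurable_continuous_onI continuous_intros)

lemma fchar_add: "fchar k (x + y) = fchar k x * fchar k y"
  and fchar_index_add: "fchar (k + l) x = fchar k x * fchar l x"
  and cnj_fchar: "cnj (fchar k x) = fchar (- k) x"
  and norm_fchar [simp]: "cmod (fchar k x) = 1"
  and fchar_0 [simp]: "fchar 0 x = 1"
  by (simp_all add: fchar_def char_phase_add char_phase_index_add char_phase_index_minus cis_mult cis_cnj)

lemma periodic_fchar: "periodic (fchar k)"
proof -
  have "cis (of_int n * (2 * pi)) = 1" for n
    using cis_multiple_2pi[of "of_int n"] by (simp add: mult_ac)
  then show ?thesis by (simp add: periodic_def fchar_add fchar_def[of k "axis _ _"])
qed

lemma integral_fchar: "(LINT x|torus. fchar (k :: int ^ 'n) x) = (if k = 0 then 1 else 0)"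
proof (cases "k = 0")
  case True
  have "measure torus (UNIV :: (real ^ 'n) set) = 1"
    by (simp add: measure_def)
  with True show ?thesis by (simp add: scaleR_conv_of_real)
next
  case False
  then obtain i where i: "k $ i \<noteq> 0" by (auto simp: vec_eq_iff)
  \<comment> \<open>Half a period of the character in a direction where k does not vanish: the
    translation flips the sign of the integral, which is therefore 0.\<close>
  define a where "a = (axis i (pi / of_int (k $ i)) :: real ^ 'n)"
  have "fchar k a = -1"
    using i by (simp add: a_def fchar_def)
  then have "(LINT x|torus. fchar k x) = - (LINT x|torus. fchar k x)"
    using integral_torus_translate[OF measurable_fchar periodic_fchar, of k a]
    by (simp add: fchar_add)
  with False show ?thesis by simp
qed

lemma integral_fchar_mult_cnj:
  "(LINT x|torus. fchar k x * cnj (fchar l x)) = (if k = l then 1 else 0)"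
  by (simp add: cnj_fchar integral_fchar flip: fchar_index_add)

section \<open>Square-integrable functions, partial sums and Bessel's inequality\<close>

definition fcoeff :: "(real ^ 'n \<Rightarrow> complex) \<Rightarrow> int ^ 'n \<Rightarrow> complex" where
  "fcoeff u k = (LINT x|torus. u x * cnj (fchar k x))"

definition sq_integrable :: "(real ^ 'n \<Rightarrow> complex) \<Rightarrow> bool" where
  "sq_integrable u \<longleftrightarrow> u \<in> borel_measurable borel \<and> integrable torus (\<lambda>x. (cmod (u x))\<^sup>2)"

lemma weighted_AMGM: fixes a b e :: real assumes "e > 0" shows "a * b \<le> (e * a\<^sup>2 + b\<^sup>2 / e) / 2"
proof -
  have "0 \<le> (e * a - b)\<^sup>2 / e" using assms by simp
  also have "\<dots> = e * a\<^sup>2 + b\<^sup>2 / e - 2 * (a * b)"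
    using assms by (simp add: field_simps power2_eq_square)
  finally show ?thesis by simp
qed

lemma sq_integrable_bounded:
  assumes "u \<in> borel_measurable borel" "\<And>x. cmod (u x) \<le> B"
  shows "sq_integrable u"
  unfolding sq_integrable_def
proof
  show "integrable torus (\<lambda>x. (cmod (u x))\<^sup>2)"
    by (rule torus.integrable_const_bound[where B = "B\<^sup>2"]) (use assms in \<open>auto intro!: AE_I2 power_mono\<close>)
qed fact

lemma sq_integrable_mult:
  assumes "sq_integrable u" "sq_integrable g"
  shows "integrable torus (\<lambda>x. u x * g x)"
proof (rule Bochner_Integration.integrable_bound)
  show "integrable torus (\<lambda>x. (cmod (u x))\<^sup>2 + (cmod (g x))\<^sup>2)"
    using assms by (auto simp: sq_integrable_def)
  show "(\<lambda>x. u x * g x) \<in> borel_measurable torus"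
    using assms by (auto simp: sq_integrable_def)
  show "AE x in torus. norm (u x * g x) \<le> norm ((cmod (u x))\<^sup>2 + (cmod (g x))\<^sup>2)"
    by (auto simp: norm_mult intro!: AE_I2 order_trans[OF weighted_AMGM[of 1]])
qed

lemma sq_integrable_cnj: "sq_integrable u \<Longrightarrow> sq_integrable (\<lambda>x. cnj (u x))"
  unfolding sq_integrable_def
  by (auto intro: borel_measurable_continuous_on[where f = cnj] continuous_intros)

lemma sq_integrable_fchar: "sq_integrable (fchar k)" "sq_integrable (\<lambda>x. cnj (fchar k x))"
  by (rule sq_integrable_bounded[where B = 1]; simp add: cnj_fchar)+

lemma sq_integrable_diff:
  assumes "sq_integrable u" "sq_integrable g"
  shows "sq_integrable (\<lambda>x. u x - g x)"
  unfolding sq_integrable_def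
proof
  show "integrable torus (\<lambda>x. (cmod (u x - g x))\<^sup>2)"
  proof (rule Bochner_Integration.integrable_bound)
    show "integrable torus (\<lambda>x. 2 * (cmod (u x))\<^sup>2 + 2 * (cmod (g x))\<^sup>2)"
      using assms by (auto simp: sq_integrable_def)
    show "(\<lambda>x. (cmod (u x - g x))\<^sup>2) \<in> borel_measurable torus"
      using assms by (auto simp: sq_integrable_def)
    have "(cmod (a - b))\<^sup>2 \<le> 2 * (cmod a)\<^sup>2 + 2 * (cmod b)\<^sup>2" for a b
    proof -
      have "(cmod (a - b))\<^sup>2 \<le> (cmod a + cmod b)\<^sup>2"
        by (intro power_mono norm_triangle_ineq4) auto
      also have "\<dots> \<le> 2 * (cmod a)\<^sup>2 + 2 * (cmod b)\<^sup>2"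
        using sum_squares_bound[of "cmod a" "cmod b"] by (simp add: power2_sum)
      finally show ?thesis .
    qed
    then show "AE x in torus. norm ((cmod (u x - g x))\<^sup>2) \<le> norm (2 * (cmod (u x))\<^sup>2 + 2 * (cmod (g x))\<^sup>2)"
      by auto
  qed
qed (use assms in \<open>auto simp: sq_integrable_def\<close>)

definition partial_sum :: "(real ^ 'n \<Rightarrow> complex) \<Rightarrow> (int ^ 'n) set \<Rightarrow> real ^ 'n \<Rightarrow> complex" where
  "partial_sum u F x = (\<Sum>l\<in>F. fcoeff u l * fchar l x)"

lemma sq_integrable_partial_sum: "sq_integrable (partial_sum u F)"
proof (rule sq_integrable_bounded[where B = "\<Sum>l\<in>F. cmod (fcoeff u l)"])
  show "cmod (partial_sum u F x) \<le> (\<Sum>l\<in>F. cmod (fcoeff u l))" for x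
    unfolding partial_sum_def by (rule order_trans[OF norm_sum]) (simp add: norm_mult)
qed (simp add: partial_sum_def[abs_def])

text \<open>By orthonormality the cross term and the squared norm of the partial sum both equal the
  sum of the squared coefficients, so expanding the square leaves one negative copy of it. This
  yields Bessel's inequality and also the fact that passing to the remainder does not increase the
  norm.\<close>

lemma integral_diff_partial_sum:
  assumes u: "sq_integrable u" and F: "finite F"
  shows "(LINT x|torus. (cmod (u x - partial_sum u F x))\<^sup>2)
       = (LINT x|torus. (cmod (u x))\<^sup>2) - (\<Sum>l\<in>F. (cmod (fcoeff u l))\<^sup>2)"
proof -
  let ?S = "partial_sum u F" and ?N = "\<Sum>l\<in>F. (cmod (fcoeff u l))\<^sup>2"
  note S = sq_integrable_partial_sum[of u F]
  have cS: "sq_integrable (\<lambda>x. cnj (?S x))" by (rule sq_integrable_cnj[OF S])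
  have cu: "sq_integrable (\<lambda>x. cnj (u x))" by (rule sq_integrable_cnj[OF u])
  have 1: "(LINT x|torus. u x * cnj (?S x)) = of_real ?N"
  proof -
    have "(LINT x|torus. u x * cnj (?S x)) = (LINT x|torus. (\<Sum>l\<in>F. cnj (fcoeff u l) * (u x * cnj (fchar l x))))"
      by (simp add: partial_sum_def sum_distrib_left mult_ac)
    also have "\<dots> = (\<Sum>l\<in>F. cnj (fcoeff u l) * (LINT x|torus. (u x * cnj (fchar l x))))"
      by (subst Bochner_Integration.integral_sum)
        (auto intro!: sum.cong integrable_mult_right sq_integrable_mult u sq_integrable_fchar)
    also have "\<dots> = of_real ?N"
      unfolding fcoeff_def[symmetric] of_real_sum complex_norm_square by (simp only: mult.commute)
    finally show ?thesis .
  qed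
  have 2: "(LINT x|torus. ?S x * cnj (?S x)) = of_real ?N"
  proof -
    have "(LINT x|torus. ?S x * cnj (?S x))
        = (LINT x|torus. (\<Sum>l\<in>F. \<Sum>m\<in>F. fcoeff u l * cnj (fcoeff u m) * (fchar l x * cnj (fchar m x))))"
      by (simp add: partial_sum_def sum_product mult_ac)
    also have "\<dots> = (\<Sum>l\<in>F. (LINT x|torus. (\<Sum>m\<in>F. fcoeff u l * cnj (fcoeff u m) * (fchar l x * cnj (fchar m x)))))"
      by (rule Bochner_Integration.integral_sum)
        (auto intro!: Bochner_Integration.integrable_sum integrable_mult_right sq_integrable_mult sq_integrable_fchar)
    also have "\<dots> = (\<Sum>l\<in>F. \<Sum>m\<in>F. fcoeff u l * cnj (fcoeff u m) * (LINT x|torus. fchar l x * cnj (fchar m x)))"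
      by (subst Bochner_Integration.integral_sum)
        (auto intro!: sum.cong integrable_mult_right sq_integrable_mult sq_integrable_fchar)
    also have "\<dots> = of_real ?N"
      using F by (simp add: integral_fchar_mult_cnj if_distrib cong: if_cong)
        (simp only: complex_norm_square flip: of_real_power)
    finally show ?thesis .
  qed
  have "complex_of_real (LINT x|torus. (cmod (u x - ?S x))\<^sup>2) = (LINT x|torus. complex_of_real ((cmod (u x - ?S x))\<^sup>2))"
    by (rule integral_complex_of_real[symmetric])
  also have "\<dots> = (LINT x|torus. u x * cnj (u x) - (u x * cnj (?S x) + cnj (u x * cnj (?S x))) + ?S x * cnj (?S x))"
    by (simp only: complex_norm_square) (simp add: algebra_simps)
  also have "\<dots> = (LINT x|torus. u x * cnj (u x)) - (LINT x|torus. u x * cnj (?S x)) - (LINT x|torus. cnj (u x * cnj (?S x))) + (LINT x|torus. ?S x * cnj (?S x))"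
    using sq_integrable_mult[OF u cu] sq_integrable_mult[OF u cS] sq_integrable_mult[OF S cS] sq_integrable_mult[OF cu S]
    by simp
  also have "(LINT x|torus. cnj (u x * cnj (?S x))) = cnj (of_real ?N)"
    using arg_cong[OF 1, of cnj] by (simp only: Bochner_Integration.integral_cnj)
  also have "(LINT x|torus. u x * cnj (u x)) = of_real (LINT x|torus. (cmod (u x))\<^sup>2)"
    by (simp only: complex_norm_square[symmetric] integral_complex_of_real)
  also have "of_real (LINT x|torus. (cmod (u x))\<^sup>2) - (LINT x|torus. u x * cnj (?S x)) - cnj (of_real ?N) + (LINT x|torus. ?S x * cnj (?S x))
      = complex_of_real ((LINT x|torus. (cmod (u x))\<^sup>2) - ?N)"
    by (simp only: 1 2) simp
  finally show ?thesis by (simp only: of_real_eq_iff)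
qed

lemma Bessel:
  assumes "sq_integrable u" "finite F"
  shows "(\<Sum>l\<in>F. (cmod (fcoeff u l))\<^sup>2) \<le> (LINT x|torus. (cmod (u x))\<^sup>2)"
proof -
  have "0 \<le> (LINT x|torus. (cmod (u x - partial_sum u F x))\<^sup>2)" by simp
  then show ?thesis using integral_diff_partial_sum[OF assms] by simp
qed

section \<open>Uniform approximation of continuous periodic functions by trigonometric
  polynomials\<close>

definition trig_poly :: "(int ^ 'n) set \<Rightarrow> (real ^ 'n \<Rightarrow> complex) \<Rightarrow> bool" where
  "trig_poly F p \<longleftrightarrow> (\<exists>c. p = (\<lambda>x. \<Sum>l\<in>F. c l * fchar l x))"

text \<open>Finite sets exhausting the lattice along a sequence, symmetric under negation; the
  symmetry is used to reindex by -l in Parseval's identity.\<close>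

definition freq_box :: "nat \<Rightarrow> (int ^ 'n) set" where
  "freq_box n = {l. \<forall>i. \<bar>l $ i\<bar> \<le> int n}"

lemma finite_freq_box [simp]: "finite (freq_box n :: (int ^ 'n) set)"
proof -
  have "(freq_box n :: (int ^ 'n) set) \<subseteq> (\<lambda>f. \<chi> i. f i) ` (UNIV \<rightarrow>\<^sub>E {- int n..int n})"
  proof
    fix l :: "int ^ 'n" assume "l \<in> freq_box n"
    then have "(\<lambda>i. l $ i) \<in> UNIV \<rightarrow>\<^sub>E {- int n..int n}"
      by (simp add: freq_box_def abs_le_iff PiE_iff) (metis minus_le_iff)
    then show "l \<in> (\<lambda>f. \<chi> i. f i) ` (UNIV \<rightarrow>\<^sub>E {- int n..int n})"
      by (rule rev_image_eqI) simp
  qed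
  then show ?thesis by (rule finite_subset) (auto intro!: finite_imageI finite_PiE)
qed

lemma finite_subset_freq_box: assumes "finite F" obtains n where "F \<subseteq> freq_box n"
proof -
  define n where "n = nat (\<Sum>l\<in>F. \<Sum>i\<in>UNIV. \<bar>l $ i\<bar>)"
  have "\<bar>l $ i\<bar> \<le> int n" if "l \<in> F" for l i
  proof -
    have "\<bar>l $ i\<bar> \<le> (\<Sum>i\<in>UNIV. \<bar>l $ i\<bar>)" by (rule member_le_sum) auto
    also have "\<dots> \<le> (\<Sum>l\<in>F. \<Sum>i\<in>UNIV. \<bar>l $ i\<bar>)"
      using assms that by (intro member_le_sum) (auto intro!: sum_nonneg)
    finally show ?thesis unfolding n_def by linarith
  qed
  then have "F \<subseteq> freq_box n" by (auto simp: freq_box_def)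
  with that show ?thesis by blast
qed

lemma trig_poly_mono: "trig_poly F p \<Longrightarrow> F \<subseteq> F' \<Longrightarrow> finite F' \<Longrightarrow> trig_poly F' p"
  unfolding trig_poly_def
  apply (erule exE)
  subgoal for c
    by (rule exI[where x = "\<lambda>l. if l \<in> F then c l else 0"])
      (auto intro!: ext sum.mono_neutral_cong_left)
  done

definition trig :: "(real ^ 'n \<Rightarrow> complex) \<Rightarrow> bool" where
  "trig p \<longleftrightarrow> (\<exists>F. finite F \<and> trig_poly F p)"

lemma trig_fchar: "trig (\<lambda>x. a * fchar k x)"
  unfolding trig_def trig_poly_def by (rule exI[where x = "{k}"]) auto

lemma trig_const: "trig (\<lambda>x. a)"
  using trig_fchar[of a 0] by simp

lemma trig_add: assumes "trig p" "trig q" shows "trig (\<lambda>x. p x + q x)"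
proof -
  obtain F F' where F: "finite F" "trig_poly F p" "finite F'" "trig_poly F' q"
    using assms by (auto simp: trig_def)
  then have "trig_poly (F \<union> F') p" "trig_poly (F \<union> F') q"
    by (auto intro: trig_poly_mono)
  then obtain c c' where "p = (\<lambda>x. \<Sum>l\<in>F \<union> F'. c l * fchar l x)" "q = (\<lambda>x. \<Sum>l\<in>F \<union> F'. c' l * fchar l x)"
    by (auto simp: trig_poly_def)
  then have "trig_poly (F \<union> F') (\<lambda>x. p x + q x)"
    unfolding trig_poly_def
    by (intro exI[where x = "\<lambda>l. c l + c' l"]) (auto simp: algebra_simps sum.distrib)
  then show ?thesis using F unfolding trig_def by blast
qed

lemma trig_sum: "(\<And>i. i \<in> I \<Longrightarrow> trig (p i)) \<Longrightarrow> trig (\<lambda>x. \<Sum>i\<in>I. p i x)"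
  by (induction I rule: infinite_finite_induct) (auto intro: trig_add trig_const)

lemma trig_mult: assumes "trig p" "trig q" shows "trig (\<lambda>x. p x * q x)"
proof -
  obtain F c F' c' where "p = (\<lambda>x. \<Sum>l\<in>F. c l * fchar l x)" "q = (\<lambda>x. \<Sum>l\<in>F'. c' l * fchar l x)"
    using assms by (auto simp: trig_def trig_poly_def)
  then have "(\<lambda>x. p x * q x) = (\<lambda>x. \<Sum>l\<in>F. \<Sum>m\<in>F'. (c l * c' m) * fchar (l + m) x)"
    by (simp add: sum_product fchar_index_add) (simp add: mult_ac)
  then show ?thesis by (simp only:) (intro trig_sum trig_fchar)
qed

text \<open>The torus embedded as a product of circles in a Euclidean space. Polynomials in these
  coordinates are trigonometric polynomials, so the Stone-Weierstrass theorem for compact Euclidean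
  sets becomes applicable.\<close>

definition circ :: "real ^ 'n \<Rightarrow> 'n::finite phase" where
  "circ x = (\<chi> i. cos (x $ i), \<chi> i. sin (x $ i))"

lemma trig_cos_sin: "trig (\<lambda>x. complex_of_real (cos (x $ i)))" "trig (\<lambda>x. complex_of_real (sin (x $ i)))"
proof -
  have "(\<lambda>x. complex_of_real (cos (x $ i))) = (\<lambda>x. 1 / 2 * fchar (axis i 1) x + 1 / 2 * fchar (axis i (-1)) x)"
    by (auto simp: fchar_def char_phase_index_axis complex_eq_iff)
  then show "trig (\<lambda>x. complex_of_real (cos (x $ i)))"
    by (simp only:) (intro trig_add trig_fchar)
  have "(\<lambda>x. complex_of_real (sin (x $ i))) = (\<lambda>x. (- \<i> / 2) * fchar (axis i 1) x + (\<i> / 2) * fchar (axis i (-1)) x)"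
    by (auto simp: fchar_def char_phase_index_axis complex_eq_iff)
  then show "trig (\<lambda>x. complex_of_real (sin (x $ i)))"
    by (simp only:) (intro trig_add trig_fchar)
qed

lemma trig_real_polynomial: "real_polynomial_function p \<Longrightarrow> trig (\<lambda>x. complex_of_real (p (circ x)))"
proof (induction rule: real_polynomial_function.induct)
  case (linear f)
  interpret f: bounded_linear f by fact
  have "f (circ x) = (\<Sum>i\<in>UNIV. cos (x $ i) * f (axis i 1, 0)) + (\<Sum>i\<in>UNIV. sin (x $ i) * f (0, axis i 1))" for x
  proof -
    have "circ x = (\<Sum>i\<in>UNIV. cos (x $ i) *\<^sub>R (axis i 1, 0)) + (\<Sum>i\<in>UNIV. sin (x $ i) *\<^sub>R (0, axis i 1))"
      by (simp add: circ_def prod_eq_iff fst_sum snd_sum vec_eq_iff axis_def if_distrib cong: if_cong)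
    then show ?thesis by (simp only: f.add f.sum f.scaleR real_scaleR_def)
  qed
  then show ?case
    by (simp only: of_real_add of_real_sum of_real_mult) (intro trig_add trig_sum trig_mult trig_const trig_cos_sin)
next
  case (const c)
  show ?case by (rule trig_const)
next
  case (add f g)
  then show ?case by (simp add: trig_add)
next
  case (mult f g)
  then show ?case by (simp add: trig_mult)
qed

lemma periodic_circ: assumes "periodic f" "circ x = circ y" shows "f x = f y"
proof -
  have "\<exists>k::int. x $ i = y $ i + 2 * pi * of_int k" for i
  proof -
    have "sin (x $ i) = sin (y $ i) \<and> cos (x $ i) = cos (y $ i)"
      using assms(2) by (auto simp: circ_def vec_eq_iff)
    then show ?thesis using sin_cos_eq_iff by (metis mult.assoc mult.commute)
  qed
  then obtain k where k: "\<And>i. x $ i = y $ i + 2 * pi * of_int (k i :: int)" by metis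
  have "x = y + lattice (\<chi> i. k i)"
    using k by (simp add: vec_eq_iff lattice_def)
  then show ?thesis using periodic_lattice[OF assms(1)] by metis
qed

text \<open>A periodic function factors through \<open>circ\<close>; the factor is continuous on the
  compact image, is approximated there by a polynomial, and is pulled back.\<close>

lemma periodic_approx_real:
  fixes f :: "real ^ 'n \<Rightarrow> real"
  assumes per: "periodic f" and cont: "continuous_on UNIV f" and "e > 0"
  obtains p where "trig p" "\<And>x. cmod (complex_of_real (f x) - p x) \<le> e"
proof -
  let ?Q = "cbox 0 (\<chi> i. 2 * pi) :: (real ^ 'n) set"
  have contc: "continuous_on S circ" for S
    unfolding circ_def by (intro continuous_intros)
  have wQ: "wrap x \<in> ?Q" for x
    using mem_half_cube_iff[of x "cell x"] by (simp add: wrap_def half_cube_def mem_box_cart less_imp_le)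
  have cw: "circ (wrap x) = circ x" for x
  proof -
    have "periodic circ"
      by (simp add: periodic_def circ_def vec_eq_iff axis_def)
    then show ?thesis by (rule periodic_wrap)
  qed
  have img: "circ ` ?Q = range circ"
  proof
    show "range circ \<subseteq> circ ` ?Q"
      using cw wQ by (metis image_eqI image_subsetI)
  qed auto
  \<comment> \<open>The inverse picks an arbitrary preimage; by \<open>periodic_circ\<close> the
    value of f does not depend on the choice.\<close>
  define f' where "f' = f \<circ> inv circ"
  have f': "f' (circ x) = f x" for x
    unfolding f'_def o_def by (rule periodic_circ[OF per]) (simp add: f_inv_into_f)
  \<comment> \<open>The embedding restricted to the compact cube is a closed map: the preimage of a
    closed set under the factor is the image of a compact part of the cube. No continuous inverse of
    \<open>circ\<close> is required.\<close>
  have "continuous_on (circ ` ?Q) f'"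
    unfolding continuous_on_closed_invariant
  proof (intro allI impI)
    fix B :: "real set" assume "closed B"
    then have "closed (f -` B)" using cont by (simp add: continuous_on_closed_vimage closed_vimage)
    then have "compact (?Q \<inter> f -` B)" by (intro compact_Int_closed) auto
    then have "closed (circ ` (?Q \<inter> f -` B))"
      by (intro compact_imp_closed compact_continuous_image contc)
    moreover have "circ ` (?Q \<inter> f -` B) \<inter> circ ` ?Q = f' -` B \<inter> circ ` ?Q"
      using f' by auto
    ultimately show "\<exists>A. closed A \<and> A \<inter> circ ` ?Q = f' -` B \<inter> circ ` ?Q" by blast
  qed
  moreover have "compact (circ ` ?Q)" by (intro compact_continuous_image contc) auto
  ultimately obtain g where g: "real_polynomial_function g" "\<And>z. z \<in> circ ` ?Q \<Longrightarrow> \<bar>f' z - g z\<bar> < e"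
    using Stone_Weierstrass_real_polynomial_function \<open>e > 0\<close> by metis
  show ?thesis
  proof
    show "trig (\<lambda>x. complex_of_real (g (circ x)))" using g(1) by (rule trig_real_polynomial)
    show "cmod (complex_of_real (f x) - complex_of_real (g (circ x))) \<le> e" for x
      using g(2)[of "circ x"] f'[of x] by (simp add: img flip: of_real_diff)
  qed
qed

lemma periodic_approx:
  fixes g :: "real ^ 'n \<Rightarrow> complex"
  assumes per: "periodic g" and cont: "continuous_on UNIV g" and "e > 0"
  obtains F p where "finite F" "trig_poly F p" "\<And>x. cmod (g x - p x) \<le> e"
proof -
  have pr: "periodic (\<lambda>x. Re (g x))" "continuous_on UNIV (\<lambda>x. Re (g x))"
    and pi: "periodic (\<lambda>x. Im (g x))" "continuous_on UNIV (\<lambda>x. Im (g x))"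
    using per cont by (auto simp: periodic_def intro!: continuous_intros)
  obtain p where p: "trig p" "\<And>x. cmod (of_real (Re (g x)) - p x) \<le> e / 2"
    using periodic_approx_real[OF pr, of "e / 2"] \<open>e > 0\<close> by auto
  obtain q where q: "trig q" "\<And>x. cmod (of_real (Im (g x)) - q x) \<le> e / 2"
    using periodic_approx_real[OF pi, of "e / 2"] \<open>e > 0\<close> by auto
  have "trig (\<lambda>x. p x + \<i> * q x)" by (intro trig_add trig_mult trig_const p q)
  moreover have "cmod (g x - (p x + \<i> * q x)) \<le> e" for x
  proof -
    have "g x - (p x + \<i> * q x) = (of_real (Re (g x)) - p x) + \<i> * (of_real (Im (g x)) - q x)"
      by (subst complex_eq[of "g x"]) (simp add: algebra_simps)
    then have "cmod (g x - (p x + \<i> * q x)) \<le> cmod (of_real (Re (g x)) - p x) + cmod (of_real (Im (g x)) - q x)"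
      by (metis norm_triangle_ineq norm_mult norm_ii mult_1)
    then show ?thesis using p(2)[of x] q(2)[of x] by simp
  qed
  ultimately show ?thesis using that by (auto simp: trig_def)
qed

section \<open>Mean-square convergence of Fourier series and Parseval's identity\<close>

lemma fcoeff_diff:
  assumes "sq_integrable u" "sq_integrable g"
  shows "fcoeff (\<lambda>x. u x - g x) l = fcoeff u l - fcoeff g l"
  unfolding fcoeff_def left_diff_distrib
  by (intro Bochner_Integration.integral_diff sq_integrable_mult assms sq_integrable_fchar)

lemma partial_sum_trig_poly:
  assumes "trig_poly F p" "finite F" shows "partial_sum p F = p"
proof -
  obtain c where c: "p = (\<lambda>x. \<Sum>l\<in>F. c l * fchar l x)" using assms by (auto simp: trig_poly_def)
  have "fcoeff p l = c l" if "l \<in> F" for l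
  proof -
    have "fcoeff p l = (LINT x|torus. (\<Sum>m\<in>F. c m * (fchar m x * cnj (fchar l x))))"
      by (simp add: fcoeff_def c sum_distrib_right mult.assoc)
    also have "\<dots> = (\<Sum>m\<in>F. c m * (LINT x|torus. fchar m x * cnj (fchar l x)))"
      by (subst Bochner_Integration.integral_sum)
        (auto intro!: sum.cong integrable_mult_right sq_integrable_mult sq_integrable_fchar)
    also have "\<dots> = c l"
      using assms that by (simp add: integral_fchar_mult_cnj if_distrib cong: if_cong)
    finally show ?thesis .
  qed
  then show ?thesis by (auto simp: partial_sum_def[abs_def] c)
qed

lemma sq_integrable_trig_poly: "trig_poly F p \<Longrightarrow> finite F \<Longrightarrow> sq_integrable p"
  using partial_sum_trig_poly sq_integrable_partial_sum by metis

text \<open>Square integrability is inherited from a trigonometric polynomial within uniform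
  distance 1.\<close>

lemma sq_integrable_periodic:
  fixes g :: "real ^ 'n \<Rightarrow> complex"
  assumes "periodic g" "continuous_on UNIV g" shows "sq_integrable g"
proof -
  obtain F p where p: "finite F" "trig_poly F p" "\<And>x. cmod (g x - p x) \<le> 1"
    using periodic_approx[OF assms, of 1] by auto
  have [measurable]: "g \<in> borel_measurable borel" by (rule borel_measurable_continuous_onI) fact
  note sp = sq_integrable_trig_poly[OF p(2,1)]
  then have [measurable]: "p \<in> borel_measurable borel" by (auto simp: sq_integrable_def)
  have "sq_integrable (\<lambda>x. p x - g x)"
    by (rule sq_integrable_bounded[where B = 1]) (use p(3) in \<open>auto simp: norm_minus_commute\<close>)
  from sq_integrable_diff[OF sp this] show ?thesis by simp
qed

lemma fourier_L2_limit:
  fixes g :: "real ^ 'n \<Rightarrow> complex"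
  assumes per: "periodic g" and cont: "continuous_on UNIV g"
  shows "(\<lambda>n. LINT x|torus. (cmod (g x - partial_sum g (freq_box n) x))\<^sup>2) \<longlonglongrightarrow> 0"
proof (rule LIMSEQ_I)
  fix r :: real assume "r > 0"
  define e where "e = sqrt (r / 2)"
  have e: "e > 0" "e\<^sup>2 < r" using \<open>r > 0\<close> by (auto simp: e_def)
  obtain F p where p: "finite F" "trig_poly F p" "\<And>x. cmod (g x - p x) \<le> e"
    using periodic_approx[OF per cont e(1)] by auto
  obtain N where N: "F \<subseteq> freq_box N" using finite_subset_freq_box[OF p(1)] .
  note sg = sq_integrable_periodic[OF per cont] and sp = sq_integrable_trig_poly[OF p(2,1)]
  show "\<exists>N. \<forall>n\<ge>N. norm ((LINT x|torus. (cmod (g x - partial_sum g (freq_box n) x))\<^sup>2) - 0) < r"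
  proof (intro exI allI impI)
    fix n assume "n \<ge> N"
    then have "freq_box N \<subseteq> (freq_box n :: (int ^ 'n) set)" by (fastforce simp: freq_box_def intro: order_trans)
    then have "trig_poly (freq_box n) p"
      using p N by (intro trig_poly_mono[OF p(2)]) auto
    then have "partial_sum p (freq_box n) = p" by (intro partial_sum_trig_poly) auto
    \<comment> \<open>Once the box contains the frequencies of p, the polynomial is its own partial
      sum and cancels. What remains is the remainder of g - p, whose norm is at most that of g - p
      itself.\<close>
    then have eq: "g x - partial_sum g (freq_box n) x = (g x - p x) - partial_sum (\<lambda>x. g x - p x) (freq_box n) x" for x
      unfolding partial_sum_def by (simp add: fcoeff_diff[OF sg sp] sum_subtractf left_diff_distrib fun_eq_iff)
    then have "(LINT x|torus. (cmod (g x - partial_sum g (freq_box n) x))\<^sup>2)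
        = (LINT x|torus. (cmod (g x - p x))\<^sup>2) - (\<Sum>l\<in>freq_box n. (cmod (fcoeff (\<lambda>x. g x - p x) l))\<^sup>2)"
      unfolding eq by (intro integral_diff_partial_sum sq_integrable_diff[OF sg sp]) simp
    also have "\<dots> \<le> (LINT x|torus. (cmod (g x - p x))\<^sup>2)" by (simp add: sum_nonneg)
    also have "\<dots> \<le> (LINT x|(torus :: (real ^ 'n) measure). e\<^sup>2)"
      using sq_integrable_diff[OF sg sp] p(3)
      by (intro integral_mono) (auto simp: sq_integrable_def intro!: power_mono)
    also have "\<dots> = e\<^sup>2" by (simp add: measure_def)
    finally show "norm ((LINT x|torus. (cmod (g x - partial_sum g (freq_box n) x))\<^sup>2) - 0) < r"
      using e by simp
  qed
qed

text \<open>The pairing is bilinear, without conjugation, hence the coefficient of g at -l. Only g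
  must be continuous: its partial sums converge in mean square, and u is merely paired with the
  remainder.\<close>

lemma Parseval_limit:
  fixes g :: "real ^ 'n \<Rightarrow> complex"
  assumes u: "sq_integrable u" and per: "periodic g" and cont: "continuous_on UNIV g"
  shows "(\<lambda>n. \<Sum>l\<in>freq_box n. fcoeff u l * fcoeff g (- l)) \<longlonglongrightarrow> (LINT x|torus. u x * g x)"
proof (rule LIMSEQ_I)
  fix r :: real assume "r > 0"
  note sg = sq_integrable_periodic[OF per cont]
  define U where "U = (LINT x|torus. (cmod (u x))\<^sup>2)"
  have "U \<ge> 0" by (simp add: U_def)
  \<comment> \<open>Balances the weighted arithmetic-geometric inequality below: each of its two
    terms, before halving, is at most r. The summand 1 covers U = 0.\<close>
  define e where "e = r / (U + 1)"
  have e: "e > 0" "e * U \<le> r" using \<open>r > 0\<close> \<open>U \<ge> 0\<close> by (auto simp: e_def field_simps)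
  obtain N where N: "\<And>n. n \<ge> N \<Longrightarrow> (LINT x|torus. (cmod (g x - partial_sum g (freq_box n) x))\<^sup>2) < e * r"
    using LIMSEQ_D[OF fourier_L2_limit[OF per cont], of "e * r"] e \<open>r > 0\<close> by auto
  show "\<exists>N. \<forall>n\<ge>N. norm ((\<Sum>l\<in>freq_box n. fcoeff u l * fcoeff g (- l)) - (LINT x|torus. u x * g x)) < r"
  proof (intro exI allI impI)
    fix n assume "n \<ge> N"
    let ?S = "partial_sum g (freq_box n)"
    note S = sq_integrable_partial_sum[of g "freq_box n"]
    have neg: "uminus ` freq_box n = (freq_box n :: (int ^ 'n) set)"
      by (auto simp: freq_box_def intro!: image_eqI[of _ _ "- _"])
    have "(LINT x|torus. u x * ?S x) = (LINT x|torus. (\<Sum>l\<in>freq_box n. fcoeff g l * (u x * fchar l x)))"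
      by (simp add: partial_sum_def sum_distrib_left mult_ac)
    also have "\<dots> = (\<Sum>l\<in>freq_box n. fcoeff g l * (LINT x|torus. u x * fchar l x))"
      by (subst Bochner_Integration.integral_sum)
        (auto intro!: sum.cong integrable_mult_right sq_integrable_mult sq_integrable_fchar u)
    also have "\<dots> = (\<Sum>l\<in>uminus ` freq_box n. fcoeff g l * fcoeff u (- l))"
      by (simp add: fcoeff_def cnj_fchar neg)
    also have "\<dots> = (\<Sum>l\<in>freq_box n. fcoeff u l * fcoeff g (- l))"
      by (subst sum.reindex) (auto simp: inj_on_def mult_ac)
    finally have "(\<Sum>l\<in>freq_box n. fcoeff u l * fcoeff g (- l)) - (LINT x|torus. u x * g x)
        = - (LINT x|torus. u x * (g x - ?S x))"
      using sq_integrable_mult[OF u sg] sq_integrable_mult[OF u S] by (simp add: right_diff_distrib)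
    also have "norm \<dots> \<le> (LINT x|torus. norm (u x * (g x - ?S x)))"
      by (simp add: integral_norm_bound)
    also have "\<dots> \<le> (LINT x|torus. (e * (cmod (u x))\<^sup>2 + (cmod (g x - ?S x))\<^sup>2 / e) / 2)"
    proof (intro integral_mono integrable_norm sq_integrable_mult u sq_integrable_diff sg S)
      show "norm (u x * (g x - ?S x)) \<le> (e * (cmod (u x))\<^sup>2 + (cmod (g x - ?S x))\<^sup>2 / e) / 2" for x
        unfolding norm_mult by (rule weighted_AMGM[OF e(1)])
    qed (use u sq_integrable_diff[OF sg S] in \<open>auto simp: sq_integrable_def\<close>)
    also have "\<dots> = (e * U + (LINT x|torus. (cmod (g x - ?S x))\<^sup>2) / e) / 2"
      using u sq_integrable_diff[OF sg S] unfolding U_def by (simp add: sq_integrable_def)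
    also have "\<dots> < (r + e * r / e) / 2"
      using N[OF \<open>n \<ge> N\<close>] e by (intro divide_strict_right_mono add_le_less_mono divide_strict_right_mono) auto
    also have "\<dots> = r" using e by simp
    finally show "norm ((\<Sum>l\<in>freq_box n. fcoeff u l * fcoeff g (- l)) - (LINT x|torus. u x * g x)) < r" .
  qed
qed

section \<open>Integration by parts on phase space\<close>

definition TV :: "'n::finite phase measure" where
  "TV = torus \<Otimes>\<^sub>M lborel"

lemma space_TV [simp]: "space TV = UNIV"
  by (simp add: TV_def space_pair_measure)

lemma sets_TV [simp, measurable_cong]: "sets TV = sets borel"
  unfolding TV_def by (metis borel_prod sets_lborel sets_pair_measure_cong sets_torus)

interpretation TV: pair_sigma_finite "torus :: (real ^ 'n) measure" "lborel :: (real ^ 'n) measure" ..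

lemma sigma_finite_TV: "sigma_finite_measure TV"
  unfolding TV_def by (rule TV.P.sigma_finite_measure_axioms)

lemma nn_integral_TV:
  assumes "f \<in> borel_measurable borel"
  shows "(\<integral>\<^sup>+w. f w \<partial>TV) = (\<integral>\<^sup>+x. \<integral>\<^sup>+v. f (x, v) \<partial>lborel \<partial>torus)"
    and "(\<integral>\<^sup>+w. f w \<partial>TV) = (\<integral>\<^sup>+v. \<integral>\<^sup>+x. f (x, v) \<partial>torus \<partial>lborel)"
proof -
  have "f \<in> borel_measurable TV" using assms by simp
  then have m: "f \<in> borel_measurable (torus \<Otimes>\<^sub>M lborel)" unfolding TV_def .
  show "(\<integral>\<^sup>+w. f w \<partial>TV) = (\<integral>\<^sup>+x. \<integral>\<^sup>+v. f (x, v) \<partial>lborel \<partial>torus)"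
    unfolding TV_def by (rule lborel.nn_integral_fst[OF m, symmetric])
  show "(\<integral>\<^sup>+w. f w \<partial>TV) = (\<integral>\<^sup>+v. \<integral>\<^sup>+x. f (x, v) \<partial>torus \<partial>lborel)"
    unfolding TV_def by (rule TV.nn_integral_snd[OF m, symmetric])
qed

lemma integral_TV_snd:
  fixes f :: "'n::finite phase \<Rightarrow> 'b::{banach, second_countable_topology}"
  assumes "integrable TV f"
  shows "(LINT v|lborel. LINT x|torus. f (x, v)) = (LINT w|TV. f w)"
  using TV.integral_snd[of "\<lambda>x v. f (x, v)"] assms by (simp add: TV_def case_prod_beta')

definition periodic_fst :: "('n::finite phase \<Rightarrow> 'b) \<Rightarrow> bool" where
  "periodic_fst f \<longleftrightarrow> (\<forall>v. periodic (\<lambda>x. f (x, v)))"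

lemma measurable_add_prod [measurable]: "(\<lambda>w. w + c) \<in> borel \<rightarrow>\<^sub>M (borel :: ('a::euclidean_space \<times> 'b::euclidean_space) measure)"
  by (intro borel_measurable_continuous_onI continuous_intros)

lemma add_Pair_left: "(x, v) + c = (x + fst c, v + snd c)"
  by (simp add: plus_prod_def)

lemma nn_integral_TV_translate:
  assumes [measurable]: "f \<in> borel_measurable borel" and per: "periodic_fst f"
  shows "(\<integral>\<^sup>+w. f (w + c) \<partial>TV) = (\<integral>\<^sup>+w. f w \<partial>TV)"
proof -
  have [measurable]: "(\<lambda>x. f (x, v)) \<in> borel_measurable borel" "(\<lambda>v. f (x, v)) \<in> borel_measurable borel" for x v
    by (rule measurable_compose[OF _ assms(1)], simp add: borel_prod[symmetric])+
  have "(\<integral>\<^sup>+w. f (w + c) \<partial>TV) = (\<integral>\<^sup>+v. \<integral>\<^sup>+x. f (x + fst c, v + snd c) \<partial>torus \<partial>lborel)"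
    by (subst nn_integral_TV(2)) (simp_all add: add_Pair_left)
  also have "\<dots> = (\<integral>\<^sup>+v. \<integral>\<^sup>+x. f (x, v + snd c) \<partial>torus \<partial>lborel)"
  proof (rule nn_integral_cong)
    show "(\<integral>\<^sup>+x. f (x + fst c, v + snd c) \<partial>torus) = (\<integral>\<^sup>+x. f (x, v + snd c) \<partial>torus)" for v
      using per by (intro nn_integral_torus_translate) (auto simp: periodic_fst_def)
  qed
  also have "\<dots> = (\<integral>\<^sup>+w. f (w + (0, snd c)) \<partial>TV)"
    by (subst nn_integral_TV(2)) (simp_all add: add_Pair_left)
  also have "\<dots> = (\<integral>\<^sup>+x. \<integral>\<^sup>+v. f (x, v + snd c) \<partial>lborel \<partial>torus)"
    by (subst nn_integral_TV(1)) (simp_all add: add_Pair_left)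
  also have "\<dots> = (\<integral>\<^sup>+x. \<integral>\<^sup>+v. f (x, v) \<partial>lborel \<partial>torus)"
    by (intro nn_integral_cong nn_integral_lborel_translate) simp
  also have "\<dots> = (\<integral>\<^sup>+w. f w \<partial>TV)"
    by (subst nn_integral_TV(1)) simp_all
  finally show ?thesis .
qed

lemma measurable_wrap_fst [measurable]:
  "(\<lambda>w. (wrap (fst w), snd w)) \<in> (borel :: 'n::finite phase measure) \<rightarrow>\<^sub>M borel"
  by (simp add: borel_prod[symmetric])

lemma distr_TV_wrap:
  "distr TV borel (\<lambda>w. (wrap (fst (w + c)), snd (w + c))) = distr TV borel (\<lambda>w. (wrap (fst w), snd w))"
proof (rule measure_eqI)
  have m [measurable]: "(\<lambda>w. (wrap (fst (w + c)), snd (w + c))) \<in> borel \<rightarrow>\<^sub>M borel"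
    by (rule measurable_compose[OF measurable_add_prod measurable_wrap_fst])
  fix A assume "A \<in> sets (distr TV borel (\<lambda>w. (wrap (fst (w + c)), snd (w + c))))"
  then have [measurable]: "A \<in> sets borel" by simp
  have "periodic_fst (\<lambda>w. indicator A (wrap (fst w), snd w) :: ennreal)"
    by (simp add: periodic_fst_def periodic_def wrap_periodic)
  then have "(\<integral>\<^sup>+w. indicator A (wrap (fst (w + c)), snd (w + c)) \<partial>TV) = (\<integral>\<^sup>+w. indicator A (wrap (fst w), snd w) \<partial>TV)"
    by (intro nn_integral_TV_translate[where f = "\<lambda>w. indicator A (wrap (fst w), snd w)"]) auto
  then have "(\<integral>\<^sup>+x. indicator A x \<partial>distr TV borel (\<lambda>w. (wrap (fst (w + c)), snd (w + c)))) = (\<integral>\<^sup>+x. indicator A x \<partial>distr TV borel (\<lambda>w. (wrap (fst w), snd w)))"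
    by (subst (1 2) nn_integral_distr) (auto simp del: fst_add snd_add)
  then show "emeasure (distr TV borel (\<lambda>w. (wrap (fst (w + c)), snd (w + c)))) A = emeasure (distr TV borel (\<lambda>w. (wrap (fst w), snd w))) A"
    by simp
qed simp

lemma periodic_fst_wrap: "periodic_fst f \<Longrightarrow> f (wrap (fst w), snd w) = f w"
  using periodic_wrap[of "\<lambda>x. f (x, snd w)" "fst w"] by (simp add: periodic_fst_def)

lemma TV_translate:
  fixes f :: "'n::finite phase \<Rightarrow> 'b::{banach, second_countable_topology}"
  assumes m [measurable]: "f \<in> borel_measurable borel" and per: "periodic_fst f"
  shows "(LINT w|TV. f (w + c)) = (LINT w|TV. f w)"
    and "integrable TV (\<lambda>w. f (w + c)) \<longleftrightarrow> integrable TV f"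
proof -
  have m' [measurable]: "(\<lambda>w. (wrap (fst (w + c)), snd (w + c))) \<in> borel \<rightarrow>\<^sub>M borel"
    by (rule measurable_compose[OF measurable_add_prod measurable_wrap_fst])
  have 1: "f (w + c) = f (wrap (fst (w + c)), snd (w + c))" for w
    by (rule periodic_fst_wrap[OF per, symmetric])
  have 2: "f w = f (wrap (fst w), snd w)" for w
    by (rule periodic_fst_wrap[OF per, symmetric])
  have "(LINT w|TV. f (w + c)) = (LINT w|distr TV borel (\<lambda>w. (wrap (fst (w + c)), snd (w + c))). f w)"
    by (subst integral_distr) (simp_all del: fst_add snd_add flip: 1)
  also have "\<dots> = (LINT w|TV. f w)"
    unfolding distr_TV_wrap by (subst integral_distr) (simp_all flip: 2)
  finally show "(LINT w|TV. f (w + c)) = (LINT w|TV. f w)" .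
  have "integrable TV (\<lambda>w. f (w + c)) \<longleftrightarrow> integrable (distr TV borel (\<lambda>w. (wrap (fst (w + c)), snd (w + c)))) f"
    by (subst integrable_distr_eq) (simp_all del: fst_add snd_add flip: 1)
  also have "\<dots> \<longleftrightarrow> integrable TV f"
    unfolding distr_TV_wrap by (subst integrable_distr_eq) (simp_all flip: 2)
  finally show "integrable TV (\<lambda>w. f (w + c)) \<longleftrightarrow> integrable TV f" .
qed

text \<open>Integrate the fundamental theorem of calculus along the segment from \<open>w\<close> to \<open>w + e\<close> over all \<open>w\<close>: by
  translation invariance both end points contribute the same.\<close>

lemma integral_TV_derivative_eq_0:
  fixes f f' :: "'n::finite phase \<Rightarrow> complex"
  assumes per: "periodic_fst f" "periodic_fst f'" and cont: "continuous_on UNIV f'"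
    and deriv: "\<And>w r. ((\<lambda>r. f (w + r *\<^sub>R e)) has_vector_derivative f' (w + r *\<^sub>R e)) (at r)"
    and int: "integrable TV f" "integrable TV f'"
  shows "(LINT w|TV. f' w) = 0"
proof -
  interpret M: sigma_finite_measure TV by (rule sigma_finite_TV)
  interpret L: pair_sigma_finite "lborel :: real measure" "TV :: 'n phase measure" ..
  have [measurable]: "f \<in> borel_measurable borel" "f' \<in> borel_measurable borel"
    using int by (auto dest: borel_measurable_integrable)
  have sB: "sets (lborel \<Otimes>\<^sub>M TV) = sets (borel :: (real \<times> 'n phase) measure)"
    by (metis borel_prod sets_lborel sets_pair_measure_cong sets_TV)
  have mc: "(\<lambda>z. f' (snd z + fst z *\<^sub>R e)) \<in> borel_measurable (lborel \<Otimes>\<^sub>M TV)"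
    unfolding measurable_cong_sets[OF sB refl]
    by (intro borel_measurable_continuous_onI continuous_on_compose2[OF cont] continuous_intros) auto
  have FTC: "(LINT r|lborel. indicator {0..1} r *\<^sub>R f' (w + r *\<^sub>R e)) = f (w + e) - f w" for w
  proof -
    have "(LINT r|lborel. indicator {0..1} r *\<^sub>R f' (w + r *\<^sub>R e)) = f (w + 1 *\<^sub>R e) - f (w + 0 *\<^sub>R e)"
      by (rule integral_FTC_Icc)
        (auto intro!: deriv[THEN has_vector_derivative_at_within] continuous_on_compose2[OF cont] continuous_intros)
    then show ?thesis by simp
  qed
  have mI: "(\<lambda>z. indicator {0..1} (fst z) *\<^sub>R f' (snd z + fst z *\<^sub>R e)) \<in> borel_measurable (lborel \<Otimes>\<^sub>M TV)"
    using mc by measurable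
  have intw: "integrable TV (\<lambda>w. f' (w + c))" "integrable TV (\<lambda>w. f (w + c))" for c
    using TV_translate(2)[OF _ per(2)] TV_translate(2)[OF _ per(1)] int by auto
  have "(\<integral>\<^sup>+w. norm (f' (w + c)) \<partial>TV) = (\<integral>\<^sup>+w. norm (f' w) \<partial>TV)" for c
    using per(2) by (intro nn_integral_TV_translate[where f = "\<lambda>w. ennreal (norm (f' w))"])
      (auto simp: periodic_fst_def periodic_def)
  then have "(\<integral>\<^sup>+z. norm (indicator {0..1} (fst z) *\<^sub>R f' (snd z + fst z *\<^sub>R e)) \<partial>(lborel \<Otimes>\<^sub>M TV))
      = (\<integral>\<^sup>+r. \<integral>\<^sup>+w. indicator {0..1} r * norm (f' w) \<partial>TV \<partial>(lborel :: real measure))"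
    using mI by (subst M.nn_integral_fst[symmetric]) (auto simp: nn_integral_cmult indicator_def ennreal_mult' intro!: nn_integral_cong)
  also have "\<dots> = (\<integral>\<^sup>+w. norm (f' w) \<partial>TV)"
    by (simp add: nn_integral_cmult ennreal_mult' ennreal_indicator nn_integral_multc)
  also have "\<dots> < \<infinity>" using int(2) by (simp add: integrable_iff_bounded)
  finally have "integrable (lborel \<Otimes>\<^sub>M TV) (\<lambda>z. indicator {0..1} (fst z) *\<^sub>R f' (snd z + fst z *\<^sub>R e))"
    using mI by (intro integrableI_bounded) auto
  then have "(LINT w|TV. LINT r|lborel. indicator {0..1} r *\<^sub>R f' (w + r *\<^sub>R e)) = (LINT r|lborel. LINT w|TV. indicator {0..1} r *\<^sub>R f' (w + r *\<^sub>R e))"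
    using L.Fubini_integral[of "\<lambda>r w. indicator {0..1} r *\<^sub>R f' (w + r *\<^sub>R e)"] by (simp add: case_prod_beta')
  also have "\<dots> = (LINT r|(lborel :: real measure). indicator {0..1} r *\<^sub>R (LINT w|TV. f' w))"
    by (simp add: TV_translate(1)[OF _ per(2)])
  also have "\<dots> = (LINT w|TV. f' w)" by simp
  finally have "(LINT w|TV. f' w) = (LINT w|TV. f (w + e) - f w)"
    by (simp add: FTC)
  also have "(LINT w|TV. f (w + e) - f w) = 0"
    using intw(2)[of e] int(1) TV_translate(1)[OF _ per(1), of e] by simp
  finally show ?thesis .
qed

section \<open>Integrability of inverse powers of the velocity weight\<close>

lemma nn_integral_decay_real:
  assumes "r > 1 / 2"
  shows "(\<integral>\<^sup>+x. ennreal ((1 + x\<^sup>2) powr (- r)) \<partial>lborel) < \<infinity>"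
proof -
  define f where "f x = ennreal (indicator {1..} x * x powr (- 2 * r))" for x :: real
  have [measurable]: "f \<in> borel_measurable borel" unfolding f_def by measurable
  have "((\<lambda>x. x powr (- 2 * r)) has_integral - (1 powr (- 2 * r + 1)) / (- 2 * r + 1)) {1..}"
    using assms by (intro has_integral_powr_to_inf) auto
  then have "(\<integral>\<^sup>+x. ennreal (x powr (- 2 * r)) * indicator {1..} x \<partial>lborel) = ennreal (- (1 powr (- 2 * r + 1)) / (- 2 * r + 1))"
    by (intro nn_integral_has_integral_lebesgue') auto
  then have fin: "(\<integral>\<^sup>+x. f x \<partial>lborel) < \<infinity>"
    by (simp add: f_def ennreal_mult' ennreal_indicator mult.commute)
  have fin': "(\<integral>\<^sup>+x. f (- x) \<partial>lborel) < \<infinity>"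
    using fin nn_integral_real_affine[of f "-1" 0] by simp
  have "ennreal ((1 + x\<^sup>2) powr (- r)) \<le> indicator {-1..1} x + (f x + f (- x))" for x
  proof -
    have *: "(1 + x\<^sup>2) powr (- r) \<le> \<bar>x\<bar> powr (- 2 * r)" if "\<bar>x\<bar> \<ge> 1"
    proof -
      have "(1 + x\<^sup>2) powr (- r) \<le> (x\<^sup>2) powr (- r)"
        using that assms by (intro powr_mono2') auto
      also have "\<dots> = (\<bar>x\<bar> powr 2) powr (- r)" using that by (simp add: powr_numeral)
      also have "\<dots> = \<bar>x\<bar> powr (2 * (- r))" by (rule powr_powr)
      finally show ?thesis by simp
    qed
    have "(1 + x\<^sup>2) powr (- r) \<le> 1 powr (- r)"
      using assms by (intro powr_mono2') auto
    then have **: "(1 + x\<^sup>2) powr (- r) \<le> 1" by simp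
    consider "x \<in> {-1..1}" | "x > 1" | "x < -1" by fastforce
    then show ?thesis
    proof cases
      case 1
      have "ennreal ((1 + x\<^sup>2) powr (- r)) \<le> 1"
        using ** by (simp add: ennreal_le_1)
      also have "\<dots> \<le> indicator {-1..1} x + (f x + f (- x))" using 1 by (simp add: add_increasing2)
      finally show ?thesis .
    next
      case 2
      then show ?thesis using * by (simp add: f_def ennreal_leI)
    next
      case 3
      then show ?thesis using * by (simp add: f_def ennreal_leI)
    qed
  qed
  then have "(\<integral>\<^sup>+x. ennreal ((1 + x\<^sup>2) powr (- r)) \<partial>lborel) \<le> (\<integral>\<^sup>+x. indicator {-1..1} x + (f x + f (- x)) \<partial>lborel)"
    by (rule nn_integral_mono)
  also have "\<dots> = 2 + ((\<integral>\<^sup>+x. f x \<partial>lborel) + (\<integral>\<^sup>+x. f (- x) \<partial>lborel))"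
    by (simp add: nn_integral_add)
  also have "\<dots> < \<infinity>" using fin fin' by (simp add: less_top)
  finally show ?thesis .
qed

text \<open>The exponent is divided evenly among the coordinates: since |v| dominates each
  coordinate, the weight is at most a product of one-dimensional weights with exponent q / d > 1/2,
  and the integral of the product factorises.\<close>

lemma nn_integral_decay:
  assumes q: "q > real CARD('n) / 2"
  shows "(\<integral>\<^sup>+v. ennreal ((1 + (norm v)\<^sup>2) powr (- q)) \<partial>(lborel :: (real ^ 'n) measure)) < \<infinity>"
proof -
  define d where "d = real CARD('n)"
  have d: "d > 0" by (simp add: d_def)
  have q0: "q > 0" using q d by (simp add: d_def)
  have bound: "(1 + (norm v)\<^sup>2) powr (- q) \<le> (\<Prod>b\<in>Basis. (1 + (v \<bullet> b)\<^sup>2) powr (- (q / d)))" for v :: "real ^ 'n"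
  proof -
    have pos: "1 + (norm v)\<^sup>2 > 0" by (simp add: add_pos_nonneg)
    have "(1 + (norm v)\<^sup>2) powr (- q) = ((1 + (norm v)\<^sup>2) powr (- (q / d))) ^ CARD('n)"
      using d pos by (simp add: powr_power d_def)
    also have "\<dots> = (\<Prod>b\<in>(Basis :: (real ^ 'n) set). (1 + (norm v)\<^sup>2) powr (- (q / d)))" by simp
    also have "\<dots> \<le> (\<Prod>b\<in>Basis. (1 + (v \<bullet> b)\<^sup>2) powr (- (q / d)))"
    proof (intro prod_mono conjI)
      fix b :: "real ^ 'n" assume "b \<in> Basis"
      then have "(v \<bullet> b)\<^sup>2 \<le> (norm v)\<^sup>2" using Basis_le_norm[of b v] by (simp add: abs_le_square_iff flip: abs_le_square_iff)
      then show "(1 + (norm v)\<^sup>2) powr (- (q / d)) \<le> (1 + (v \<bullet> b)\<^sup>2) powr (- (q / d))"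
        using q0 d by (intro powr_mono2') (auto simp: add_pos_nonneg)
    qed simp
    finally show ?thesis .
  qed
  have "(\<integral>\<^sup>+v. ennreal ((1 + (norm v)\<^sup>2) powr (- q)) \<partial>(lborel :: (real ^ 'n) measure))
      \<le> (\<integral>\<^sup>+(v :: real ^ 'n). (\<Prod>b\<in>Basis. ennreal ((1 + (v \<bullet> b)\<^sup>2) powr (- (q / d)))) \<partial>lborel)"
    by (intro nn_integral_mono) (simp add: prod_ennreal ennreal_leI bound)
  also have "\<dots> = (\<Prod>b\<in>(Basis :: (real ^ 'n) set). (\<integral>\<^sup>+x. ennreal ((1 + x\<^sup>2) powr (- (q / d))) \<partial>lborel))"
    by (rule nn_integral_lborel_prod) auto
  also have "\<dots> < \<infinity>"
  proof -
    have "q / d > 1 / 2" using q d by (simp add: d_def field_simps)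
    then show ?thesis using nn_integral_decay_real[of "q / d"] by (simp add: power_less_top_ennreal)
  qed
  finally show ?thesis .
qed

section \<open>Smooth fields and their weighted Sobolev norms\<close>

lemma Ck_on_imp_continuous_on: "Ck_on k f U \<Longrightarrow> continuous_on U f"
  by (cases k) (auto intro!: continuous_at_imp_continuous_on differentiable_imp_continuous_within)

text \<open>Freezing both times turns joint smoothness near the time square into smoothness on all
  of phase space. In the induction, the derivatives of the slice are slices of the derivatives of F
  in the corresponding basis directions.\<close>

lemma Ck_on_slice:
  fixes F :: "'a::euclidean_space \<times> 'b::euclidean_space \<times> 'c::euclidean_space \<Rightarrow> 'd::real_normed_vector"
  assumes "Ck_on k F U" "\<And>w. (t, s, w) \<in> U"
  shows "Ck_on k (\<lambda>w. F (t, s, w)) UNIV"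
  using assms(1)
proof (induction k arbitrary: F)
  case 0
  then show ?case
    using assms(2) by (auto intro!: continuous_on_compose2[of U F] continuous_intros)
next
  case (Suc k)
  have der: "((\<lambda>w. F (t, s, w)) has_derivative (\<lambda>h. frechet_derivative F (at (t, s, w)) (0, 0, h))) (at w)" for w
  proof -
    have "(F has_derivative frechet_derivative F (at (t, s, w))) (at (t, s, w))"
      using Suc.prems assms(2) by (auto simp: frechet_derivative_works)
    moreover have "((\<lambda>w. (t, s, w)) has_derivative (\<lambda>h. (0, 0, h))) (at w)"
      by (auto intro!: derivative_eq_intros)
    ultimately show ?thesis
      by (rule has_derivative_compose[rotated])
  qed
  have fd: "frechet_derivative (\<lambda>w. F (t, s, w)) (at w) = (\<lambda>h. frechet_derivative F (at (t, s, w)) (0, 0, h))" for w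
    using frechet_derivative_at[OF der] by simp
  show ?case
    unfolding Ck_on.simps fd
  proof (intro conjI ballI)
    show "(\<lambda>w. F (t, s, w)) differentiable at w" for w
      using der by (rule differentiableI)
    fix e :: 'c assume "e \<in> Basis"
    then have "(0, 0, e) \<in> (Basis :: ('a \<times> 'b \<times> 'c) set)" by (auto simp: Basis_prod_def)
    then have "Ck_on k (\<lambda>z. frechet_derivative F (at z) (0, 0, e)) U" using Suc.prems by simp
    then show "Ck_on k (\<lambda>w. frechet_derivative F (at (t, s, w)) (0, 0, e)) UNIV" by (rule Suc.IH)
  qed
qed

definition smooth2 :: "('x::euclidean_space \<Rightarrow> 'v::euclidean_space \<Rightarrow> 'b::real_normed_vector) \<Rightarrow> bool" where
  "smooth2 f \<longleftrightarrow> (\<forall>k. Ck_on k (\<lambda>w. f (fst w) (snd w)) UNIV)"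

lemma smooth2_continuous: "smooth2 f \<Longrightarrow> continuous_on UNIV (\<lambda>w. f (fst w) (snd w))"
  unfolding smooth2_def by (blast intro: Ck_on_imp_continuous_on)

lemma smooth2_has_derivative:
  assumes "smooth2 f"
  shows "((\<lambda>w. f (fst w) (snd w)) has_derivative frechet_derivative (\<lambda>w. f (fst w) (snd w)) (at w)) (at w)"
proof -
  have "Ck_on (Suc 0) (\<lambda>w. f (fst w) (snd w)) UNIV" using assms unfolding smooth2_def by blast
  then have "(\<lambda>w. f (fst w) (snd w)) differentiable at w" unfolding Ck_on.simps by blast
  then show ?thesis by (simp add: frechet_derivative_works)
qed

lemma smooth2_frechet:
  assumes "smooth2 f" "e \<in> Basis"
  shows "smooth2 (\<lambda>x v. frechet_derivative (\<lambda>w. f (fst w) (snd w)) (at (x, v)) e)"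
proof -
  have "Ck_on (Suc k) (\<lambda>w. f (fst w) (snd w)) UNIV" for k using assms unfolding smooth2_def by blast
  then show ?thesis using assms(2) unfolding smooth2_def Ck_on.simps by simp
qed

lemma dx_eq_frechet:
  assumes "smooth2 f"
  shows "dx i f x v = frechet_derivative (\<lambda>w. f (fst w) (snd w)) (at (x, v)) (axis i 1, 0)"
proof -
  have "((\<lambda>y. (y, v)) has_derivative (\<lambda>h. (h, 0))) (at x)"
    by (auto intro!: derivative_eq_intros)
  from has_derivative_compose[OF this smooth2_has_derivative[OF assms]]
  have "((\<lambda>y. f y v) has_derivative (\<lambda>h. frechet_derivative (\<lambda>w. f (fst w) (snd w)) (at (x, v)) (h, 0))) (at x)"
    by simp
  from frechet_derivative_at[OF this] show ?thesis unfolding dx_def by metis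
qed

lemma dv_eq_frechet:
  assumes "smooth2 f"
  shows "dv i f x v = frechet_derivative (\<lambda>w. f (fst w) (snd w)) (at (x, v)) (0, axis i 1)"
proof -
  have "((\<lambda>y. (x, y)) has_derivative (\<lambda>h. (0, h))) (at v)"
    by (auto intro!: derivative_eq_intros)
  from has_derivative_compose[OF this smooth2_has_derivative[OF assms]]
  have "((\<lambda>y. f x y) has_derivative (\<lambda>h. frechet_derivative (\<lambda>w. f (fst w) (snd w)) (at (x, v)) (0, h))) (at v)"
    by simp
  from frechet_derivative_at[OF this] show ?thesis unfolding dv_def by metis
qed

lemma smooth2_dx: assumes "smooth2 f" shows "smooth2 (dx i f)"
proof -
  have "dx i f = (\<lambda>x v. frechet_derivative (\<lambda>w. f (fst w) (snd w)) (at (x, v)) (axis i 1, 0))"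
    by (intro ext dx_eq_frechet assms)
  then show ?thesis
    using smooth2_frechet[OF assms, of "(axis i 1, 0)"] by (simp add: Basis_prod_def axis_in_Basis_iff)
qed

lemma smooth2_dv: assumes "smooth2 f" shows "smooth2 (dv i f)"
proof -
  have "dv i f = (\<lambda>x v. frechet_derivative (\<lambda>w. f (fst w) (snd w)) (at (x, v)) (0, axis i 1))"
    by (intro ext dv_eq_frechet assms)
  then show ?thesis
    using smooth2_frechet[OF assms, of "(0, axis i 1)"] by (simp add: Basis_prod_def axis_in_Basis_iff)
qed

lemma smooth2_directional:
  assumes "smooth2 f"
  shows "((\<lambda>r. f (fst (w + r *\<^sub>R e)) (snd (w + r *\<^sub>R e))) has_vector_derivative
     frechet_derivative (\<lambda>w. f (fst w) (snd w)) (at (w + r *\<^sub>R e)) e) (at r)"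
proof -
  have "((\<lambda>r. w + r *\<^sub>R e) has_derivative (\<lambda>h. h *\<^sub>R e)) (at r)"
    by (auto intro!: derivative_eq_intros)
  from has_derivative_compose[OF this smooth2_has_derivative[OF assms]]
  have "((\<lambda>r. f (fst (w + r *\<^sub>R e)) (snd (w + r *\<^sub>R e))) has_derivative
      (\<lambda>h. frechet_derivative (\<lambda>w. f (fst w) (snd w)) (at (w + r *\<^sub>R e)) (h *\<^sub>R e))) (at r)" .
  moreover have "linear (frechet_derivative (\<lambda>w. f (fst w) (snd w)) (at (w + r *\<^sub>R e)))"
    by (rule has_derivative_linear[OF smooth2_has_derivative[OF assms]])
  ultimately show ?thesis
    by (simp add: has_vector_derivative_def linear_cmul)
qed

lemma smooth2_dx_vector_derivative:
  assumes "smooth2 f"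
  shows "((\<lambda>r. f (fst (w + r *\<^sub>R (axis i 1, 0))) (snd (w + r *\<^sub>R (axis i 1, 0)))) has_vector_derivative
     dx i f (fst (w + r *\<^sub>R (axis i 1, 0))) (snd (w + r *\<^sub>R (axis i 1, 0)))) (at r)"
  using smooth2_directional[OF assms, of w "(axis i 1, 0)" r] by (simp add: dx_eq_frechet[OF assms] plus_prod_def)

lemma smooth2_dv_vector_derivative:
  assumes "smooth2 f"
  shows "((\<lambda>r. f (fst (w + r *\<^sub>R (0, axis i 1))) (snd (w + r *\<^sub>R (0, axis i 1)))) has_vector_derivative
     dv i f (fst (w + r *\<^sub>R (0, axis i 1))) (snd (w + r *\<^sub>R (0, axis i 1)))) (at r)"
  using smooth2_directional[OF assms, of w "(0, axis i 1)" r] by (simp add: dv_eq_frechet[OF assms] plus_prod_def)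

definition periodic2 :: "(real ^ 'n \<Rightarrow> real ^ 'n \<Rightarrow> 'b) \<Rightarrow> bool" where
  "periodic2 f \<longleftrightarrow> (\<forall>v. periodic (\<lambda>x. f x v))"

lemma periodic2_dx:
  assumes "smooth2 f" "periodic2 f" shows "periodic2 (dx i f)"
  unfolding periodic2_def periodic_def
proof (intro allI)
  fix v x :: "real ^ 'a" and j :: 'a
  let ?c = "axis j (2 * pi) :: real ^ 'a"
  have "((\<lambda>r. f (x + r *\<^sub>R axis i 1) v) has_vector_derivative dx i f x v) (at 0)"
    using smooth2_dx_vector_derivative[OF assms(1), of "(x, v)" i 0] by simp
  moreover have "((\<lambda>r. f (x + ?c + r *\<^sub>R axis i 1) v) has_vector_derivative dx i f (x + ?c) v) (at 0)"
    using smooth2_dx_vector_derivative[OF assms(1), of "(x + ?c, v)" i 0] by simp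
  moreover have "f (x + ?c + r *\<^sub>R axis i 1) v = f (x + r *\<^sub>R axis i 1) v" for r
    using assms(2) unfolding periodic2_def periodic_def by (metis add.assoc add.commute)
  ultimately show "dx i f (x + ?c) v = dx i f x v"
    by (simp add: vector_derivative_unique_at)
qed

lemma periodic2_dv:
  assumes "smooth2 f" "periodic2 f" shows "periodic2 (dv i f)"
  unfolding periodic2_def periodic_def
proof (intro allI)
  fix v x :: "real ^ 'a" and j :: 'a
  let ?c = "axis j (2 * pi) :: real ^ 'a"
  have "((\<lambda>r. f x (v + r *\<^sub>R axis i 1)) has_vector_derivative dv i f x v) (at 0)"
    using smooth2_dv_vector_derivative[OF assms(1), of "(x, v)" i 0] by simp
  moreover have "((\<lambda>r. f (x + ?c) (v + r *\<^sub>R axis i 1)) has_vector_derivative dv i f (x + ?c) v) (at 0)"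
    using smooth2_dv_vector_derivative[OF assms(1), of "(x + ?c, v)" i 0] by simp
  moreover have "f (x + ?c) (v + r *\<^sub>R axis i 1) = f x (v + r *\<^sub>R axis i 1)" for r
    using assms(2) unfolding periodic2_def periodic_def by metis
  ultimately show "dv i f (x + ?c) v = dv i f x v"
    by (simp add: vector_derivative_unique_at)
qed

lemma smooth2_funpow:
  assumes "smooth2 f"
  shows "smooth2 ((dx i ^^ m) ((dv j ^^ n) f))"
proof -
  have "smooth2 ((dv j ^^ n) f)" by (induction n) (auto intro: smooth2_dv assms)
  then show ?thesis by (induction m) (auto intro: smooth2_dx)
qed

lemma periodic2_funpow:
  assumes "smooth2 f" "periodic2 f"
  shows "periodic2 ((dx i ^^ m) ((dv j ^^ n) f))"
proof -
  have "periodic2 ((dv j ^^ n) f)"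
    by (induction n) (use smooth2_funpow[OF assms(1), where m = 0] assms in \<open>auto intro: periodic2_dv\<close>)
  then show ?thesis
    by (induction m) (use smooth2_funpow[OF assms(1)] in \<open>auto intro: periodic2_dx\<close>)
qed

text \<open>A list with letter counts concentrated at i is forced to be m copies of i, so the choice
  operator in \<open>multi\<close> is harmless here. Only such pure powers are used below, and the
  commutation of partial derivatives is never invoked.\<close>

lemma multi_single: "multi D (\<lambda>a. if a = i then m else 0) = D i ^^ m"
proof -
  define js where "js = (SOME js. \<forall>a. count_list js a = (if a = i then m else 0))"
  have "count_list (replicate n i) a = (if a = i then n else 0)" for n a
    by (induction n) auto
  then have "\<exists>js. \<forall>a. count_list js a = (if a = i then m else 0)" by blast
  then have js: "\<forall>a. count_list js a = (if a = i then m else 0)"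
    unfolding js_def by (rule someI_ex)
  then have "set js \<subseteq> {i}"
    using count_list_0_iff by (metis insertCI subsetI)
  then have "js = replicate (length js) i" by (metis replicate_eqI singletonD subsetD)
  moreover have "count_list (replicate n i) i = n" for n by (induction n) auto
  ultimately have "js = replicate m i" using js by metis
  moreover have "foldr D (replicate n i) = D i ^^ n" for n
    by (induction n) auto
  ultimately show ?thesis by (simp add: multi_def js_def)
qed

lemma esqrt_le_iff: assumes "b \<ge> 0" shows "esqrt x \<le> ennreal b \<longleftrightarrow> x \<le> ennreal (b\<^sup>2)"
proof (cases "x = \<infinity>")
  case False
  then obtain r where r: "x = ennreal r" "r \<ge> 0" by (cases x) auto
  have "sqrt r \<le> b \<longleftrightarrow> r \<le> b\<^sup>2"
    using assms r by (metis real_sqrt_le_iff real_sqrt_unique)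
  then show ?thesis using r assms by (simp add: esqrt_def ennreal_le_iff)
qed (simp add: esqrt_def top_unique)

lemma esqrt_power2: "(esqrt x)\<^sup>2 = x"
proof (cases "x = \<infinity>")
  case False
  then have "x = ennreal (enn2real x)" by (simp add: less_top)
  then show ?thesis using False by (simp add: esqrt_def ennreal_power)
qed (simp add: esqrt_def)

lemma finite_multiindices: "finite {(\<alpha> :: 'n::finite \<Rightarrow> nat, \<beta> :: 'n \<Rightarrow> nat). sum \<alpha> UNIV + sum \<beta> UNIV \<le> p}"
proof -
  have "{(\<alpha> :: 'n \<Rightarrow> nat, \<beta> :: 'n \<Rightarrow> nat). sum \<alpha> UNIV + sum \<beta> UNIV \<le> p}
      \<subseteq> (UNIV \<rightarrow>\<^sub>E {..p}) \<times> (UNIV \<rightarrow>\<^sub>E {..p})"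
  proof (rule subsetI, clarsimp, intro conjI)
    fix \<alpha> \<beta> :: "'n \<Rightarrow> nat" assume *: "sum \<alpha> UNIV + sum \<beta> UNIV \<le> p"
    have "\<alpha> i \<le> sum \<alpha> UNIV" "\<beta> i \<le> sum \<beta> UNIV" for i by (auto intro: member_le_sum)
    then have "\<alpha> i \<le> p" "\<beta> i \<le> p" for i using * by (meson add_leE le_trans)+
    then show "\<alpha> \<in> UNIV \<rightarrow>\<^sub>E {..p}" "\<beta> \<in> UNIV \<rightarrow>\<^sub>E {..p}" by auto
  qed
  then show ?thesis by (rule finite_subset) (auto intro!: finite_PiE)
qed

text \<open>Keeps a single summand of the norm. One direction in x and one in v suffice because all
  integrations by parts in x, and all those in v, are done along a coordinate where the relevant
  frequency attains its maximum.\<close>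

lemma weighted_Sobolev_norm_ge:
  fixes f :: "real ^ 'n \<Rightarrow> real ^ 'n \<Rightarrow> real ^ 'n"
  assumes sm: "smooth2 f" and mn: "m + n \<le> p" and b: "b \<ge> 0"
    and le: "weighted_Sobolev_norm p \<sigma> f \<le> ennreal b"
  shows "(\<integral>\<^sup>+w. ennreal ((1 + (norm (snd w))\<^sup>2) powr \<sigma> *
     (norm ((dx i ^^ m) ((dv j ^^ n) f) (fst w) (snd w)))\<^sup>2) \<partial>TV) \<le> ennreal (b\<^sup>2)"
proof -
  let ?I = "\<lambda>(\<alpha>, \<beta>). \<integral>\<^sup>+x. \<integral>\<^sup>+v. ennreal ((1 + (norm v)\<^sup>2) powr \<sigma> *
         (norm (multi dx \<alpha> (multi dv \<beta> f) x v))\<^sup>2) \<partial>lborel \<partial>torus"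
  let ?S = "{(\<alpha> :: 'n \<Rightarrow> nat, \<beta> :: 'n \<Rightarrow> nat). sum \<alpha> UNIV + sum \<beta> UNIV \<le> p}"
  have cont: "continuous_on UNIV (\<lambda>w. (dx i ^^ m) ((dv j ^^ n) f) (fst w) (snd w))"
    by (intro smooth2_continuous smooth2_funpow sm)
  have "(\<integral>\<^sup>+w. ennreal ((1 + (norm (snd w))\<^sup>2) powr \<sigma> *
     (norm ((dx i ^^ m) ((dv j ^^ n) f) (fst w) (snd w)))\<^sup>2) \<partial>TV)
     = ?I (\<lambda>a. if a = i then m else 0, \<lambda>a. if a = j then n else 0)"
    using borel_measurable_continuous_onI[OF cont]
    by (subst nn_integral_TV(1)) (auto simp: multi_single borel_prod[symmetric])
  also have "\<dots> \<le> sum ?I ?S"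
    using mn by (intro member_le_sum finite_multiindices) (auto simp: sum.delta)
  also have "\<dots> \<le> ennreal (b\<^sup>2)"
    using le unfolding weighted_Sobolev_norm_def esqrt_le_iff[OF b] .
  finally show ?thesis .
qed

lemma has_vector_derivative_cis_mult:
  "((\<lambda>r. cis (r * c)) has_vector_derivative \<i> * of_real c * cis (r * c)) (at r within S)"
proof -
  have "((\<lambda>z. exp (\<i> * (z * of_real c))) has_field_derivative \<i> * of_real c * exp (\<i> * (of_real r * of_real c))) (at (of_real r))"
    by (auto intro!: derivative_eq_intros)
  from has_vector_derivative_real_field[OF this, of S] show ?thesis
    by (simp add: cis_conv_exp)
qed

text \<open>The Cauchy-Schwarz constant of \<open>weighted_L1_le\<close>. The 2 comes from (1 +
  |v|)^2 being at most 2 (1 + |v|^2), and this factor also lowers the exponent from \<sigma> to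
  \<sigma> - 1.\<close>

definition decay_const :: "'n::finite itself \<Rightarrow> real \<Rightarrow> real" where
  "decay_const _ \<sigma> = sqrt (2 * enn2real (\<integral>\<^sup>+v. ennreal ((1 + (norm v)\<^sup>2) powr (- (\<sigma> - 1))) \<partial>(lborel :: (real ^ 'n) measure)))"

lemma decay_const_nonneg: "decay_const N \<sigma> \<ge> 0"
  by (simp add: decay_const_def)

lemma one_plus_norm_sq_pos [simp]: "1 + (norm v)\<^sup>2 > 0"
  by (simp add: add_pos_nonneg)

lemma ennreal_le_of_power2_le:
  assumes "x\<^sup>2 \<le> ennreal (r\<^sup>2)" "r \<ge> 0" shows "x \<le> ennreal r"
proof (cases x)
  case (real y)
  then have "y\<^sup>2 \<le> r\<^sup>2" using assms(1) by (simp add: ennreal_power ennreal_le_iff)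
  then show ?thesis using real assms(2) by (auto intro: ennreal_leI power2_le_imp_le)
next
  case top
  then have "x * x = top" by (simp add: ennreal_mult_eq_top_iff)
  then have "top \<le> ennreal (r\<^sup>2)" using assms(1) unfolding power2_eq_square by metis
  then show ?thesis by (simp add: top_unique)
qed

text \<open>Cauchy-Schwarz with the weight split as (1 + |v|^2) to the powers -\<sigma>/2 and
  \<sigma>/2. The factor 1 + |v| is included because later multipliers grow linearly in v; the
  remaining v-integral converges since \<sigma> - 1 > d/2.\<close>

lemma weighted_L1_le:
  fixes g :: "'n::finite phase \<Rightarrow> 'b::real_normed_vector"
  assumes [measurable]: "(\<lambda>w. norm (g w)) \<in> borel_measurable borel"
    and \<sigma>: "\<sigma> > 1 + real CARD('n) / 2" and b: "b \<ge> 0"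
    and le: "(\<integral>\<^sup>+w. ennreal ((1 + (norm (snd w))\<^sup>2) powr \<sigma> * (norm (g w))\<^sup>2) \<partial>TV) \<le> ennreal (b\<^sup>2)"
  shows "(\<integral>\<^sup>+w. ennreal ((1 + norm (snd w)) * norm (g w)) \<partial>TV) \<le> ennreal (decay_const TYPE('n) \<sigma> * b)"
proof -
  define K where "K = (\<integral>\<^sup>+v. ennreal ((1 + (norm v)\<^sup>2) powr (- (\<sigma> - 1))) \<partial>(lborel :: (real ^ 'n) measure))"
  have "K < \<infinity>" unfolding K_def using \<sigma> by (intro nn_integral_decay) simp
  then have K: "K = ennreal (enn2real K)" by simp
  have [measurable]: "(\<lambda>w. norm (snd w)) \<in> borel_measurable (borel :: 'n phase measure)"
    by (intro borel_measurable_continuous_onI continuous_intros)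
  let ?f = "\<lambda>w :: 'n phase. ennreal ((1 + norm (snd w)) * (1 + (norm (snd w))\<^sup>2) powr (- (\<sigma> / 2)))"
  let ?h = "\<lambda>w :: 'n phase. ennreal ((1 + (norm (snd w))\<^sup>2) powr (\<sigma> / 2) * norm (g w))"
  let ?X = "\<integral>\<^sup>+w. ennreal ((1 + norm (snd w)) * norm (g w)) \<partial>TV"
  have "?f w * ?h w = ennreal ((1 + norm (snd w)) * norm (g w))" for w
  proof -
    let ?u = "1 + (norm (snd w))\<^sup>2"
    have "?u powr (- (\<sigma> / 2)) * ?u powr (\<sigma> / 2) = 1"
      using one_plus_norm_sq_pos[of "snd w"] by (simp add: less_imp_neq[symmetric] flip: powr_add)
    then have "((1 + norm (snd w)) * ?u powr (- (\<sigma> / 2))) * (?u powr (\<sigma> / 2) * norm (g w)) = (1 + norm (snd w)) * norm (g w)"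
      by (simp add: mult.assoc mult.left_commute[of _ "norm (g w)"] flip: mult.assoc[of "_ powr _" "_ powr _"])
    then show ?thesis by (simp flip: ennreal_mult)
  qed
  then have "?X\<^sup>2 = (\<integral>\<^sup>+w. ?f w * ?h w \<partial>TV)\<^sup>2" by simp
  also have "\<dots> \<le> (\<integral>\<^sup>+w. (?f w)\<^sup>2 \<partial>TV) * (\<integral>\<^sup>+w. (?h w)\<^sup>2 \<partial>TV)"
    by (rule Cauchy_Schwarz_nn_integral) measurable
  also have "(\<integral>\<^sup>+w. (?h w)\<^sup>2 \<partial>TV) \<le> ennreal (b\<^sup>2)"
  proof -
    have "((1 + (norm v)\<^sup>2) powr (\<sigma> / 2))\<^sup>2 = (1 + (norm v)\<^sup>2) powr \<sigma>" for v :: "real ^ 'n"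
      by (simp add: power2_eq_square flip: powr_add)
    then show ?thesis using le by (simp add: ennreal_power power_mult_distrib)
  qed
  also have "(\<integral>\<^sup>+w. (?f w)\<^sup>2 \<partial>TV) \<le> (\<integral>\<^sup>+(w :: 'n phase). ennreal (2 * (1 + (norm (snd w))\<^sup>2) powr (- (\<sigma> - 1))) \<partial>TV)"
  proof (intro nn_integral_mono)
    fix w :: "'n phase"
    let ?u = "1 + (norm (snd w))\<^sup>2"
    have "(1 + norm (snd w))\<^sup>2 \<le> 2 * ?u"
      using sum_squares_bound[of 1 "norm (snd w)"] by (simp add: power2_sum)
    moreover have "((?u powr (- (\<sigma> / 2)))\<^sup>2) = ?u powr (- \<sigma>)"
      by (simp add: power2_eq_square flip: powr_add)
    ultimately have "((1 + norm (snd w)) * ?u powr (- (\<sigma> / 2)))\<^sup>2 \<le> 2 * (?u * ?u powr (- \<sigma>))"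
      unfolding mult.assoc[symmetric] power_mult_distrib by (simp add: mult_right_mono)
    also have "?u * ?u powr (- \<sigma>) = ?u powr (- (\<sigma> - 1))"
      using powr_mult_base[of ?u "- \<sigma>"] by (simp add: less_imp_le)
    finally show "(?f w)\<^sup>2 \<le> ennreal (2 * ?u powr (- (\<sigma> - 1)))"
      by (simp add: ennreal_power ennreal_leI)
  qed
  also have "\<dots> = ennreal (2 * enn2real K)"
    by (subst nn_integral_TV(1)) (auto simp: ennreal_mult' nn_integral_cmult K[symmetric], simp add: K_def)
  finally have "?X\<^sup>2 \<le> ennreal (2 * enn2real K) * ennreal (b\<^sup>2)"
    by (simp add: mult_right_mono mult_left_mono)
  also have "\<dots> = ennreal (((sqrt (2 * enn2real K)) * b)\<^sup>2)"
    by (simp add: ennreal_mult power_mult_distrib)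
  also have "sqrt (2 * enn2real K) = decay_const TYPE('n) \<sigma>"
    by (simp add: decay_const_def K_def)
  finally have "?X\<^sup>2 \<le> ennreal ((decay_const TYPE('n) \<sigma> * b)\<^sup>2)" .
  then show ?thesis
    by (rule ennreal_le_of_power2_le) (use b in \<open>simp add: decay_const_nonneg\<close>)
qed

section \<open>A single time slice of the field: integrability and integration by parts\<close>

locale field_bound =
  fixes f :: "real ^ 'n \<Rightarrow> real ^ 'n \<Rightarrow> real ^ 'n" and p :: nat and \<sigma> b :: real
  assumes smooth: "smooth2 f" and periodic: "periodic2 f"
    and sigma: "\<sigma> > 1 + real CARD('n) / 2" and b_nonneg: "b \<ge> 0"
    and norm_le: "weighted_Sobolev_norm p \<sigma> f \<le> ennreal b"
begin

text \<open>The indices i and m govern x, the indices j and n govern v, and the v-derivatives are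
  innermost. This fixes the order of the integrations by parts: those in v first, those in x
  afterwards.\<close>

definition D :: "'n \<Rightarrow> nat \<Rightarrow> 'n \<Rightarrow> nat \<Rightarrow> 'n phase \<Rightarrow> real ^ 'n" where
  "D i m j n w = (dx i ^^ m) ((dv j ^^ n) f) (fst w) (snd w)"

lemma D_0 [simp]: "D i 0 j 0 w = f (fst w) (snd w)"
  by (simp add: D_def)

lemma D_1 [simp]: "D i (Suc 0) j 0 w = dx i f (fst w) (snd w)"
  by (simp add: D_def)

lemma continuous_D: "continuous_on UNIV (D i m j n)"
  unfolding D_def by (intro smooth2_continuous smooth2_funpow smooth)

lemma continuous_on_D [continuous_intros]: "continuous_on S h \<Longrightarrow> continuous_on S (\<lambda>x. D i m j n (h x))"
  using continuous_on_compose2[OF continuous_D] by auto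

lemma measurable_D [measurable]: "D i m j n \<in> borel_measurable borel"
  by (intro borel_measurable_continuous_onI continuous_D)

lemma periodic_D: "periodic_fst (D i m j n)"
  using periodic2_funpow[OF smooth periodic] by (simp add: D_def periodic_fst_def periodic2_def)

lemma D_dx: "((\<lambda>r. D i m j n (w + r *\<^sub>R (axis i 1, 0))) has_vector_derivative D i (Suc m) j n (w + r *\<^sub>R (axis i 1, 0))) (at r)"
  using smooth2_dx_vector_derivative[OF smooth2_funpow[OF smooth]] by (simp add: D_def)

lemma D_dv: "((\<lambda>r. D i 0 j n (w + r *\<^sub>R (0, axis j 1))) has_vector_derivative D i 0 j (Suc n) (w + r *\<^sub>R (0, axis j 1))) (at r)"
  using smooth2_dv_vector_derivative[OF smooth2_funpow[OF smooth, where m = 0]] by (simp add: D_def)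

lemma D_L2: "m + n \<le> p \<Longrightarrow>
   (\<integral>\<^sup>+w. ennreal ((1 + (norm (snd w))\<^sup>2) powr \<sigma> * (norm (D i m j n w))\<^sup>2) \<partial>TV) \<le> ennreal (b\<^sup>2)"
  unfolding D_def by (rule weighted_Sobolev_norm_ge[OF smooth _ b_nonneg norm_le])

lemma D_L1: "m + n \<le> p \<Longrightarrow> (\<integral>\<^sup>+w. ennreal ((1 + norm (snd w)) * norm (D i m j n w)) \<partial>TV) \<le> ennreal (decay_const TYPE('n) \<sigma> * b)"
  by (rule weighted_L1_le[OF _ sigma b_nonneg D_L2]) auto

lemma D_integral:
  assumes mn: "m + n \<le> p" and [measurable]: "E \<in> borel_measurable borel"
    and E: "\<And>w. cmod (E w) \<le> M * (1 + norm (snd w))" and M: "M \<ge> 0"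
  shows "integrable TV (\<lambda>w. E w * of_real (D i m j n w $ a))"
    and "cmod (LINT w|TV. E w * of_real (D i m j n w $ a)) \<le> M * decay_const TYPE('n) \<sigma> * b"
proof -
  have [measurable]: "(\<lambda>w. D i m j n w $ a) \<in> borel_measurable borel"
    "(\<lambda>w. (1 + norm (snd w)) * norm (D i m j n w)) \<in> borel_measurable borel"
    by (intro borel_measurable_continuous_onI continuous_intros)+
  have "(\<integral>\<^sup>+w. ennreal (norm (E w * of_real (D i m j n w $ a))) \<partial>TV)
     \<le> (\<integral>\<^sup>+w. ennreal M * ennreal ((1 + norm (snd w)) * norm (D i m j n w)) \<partial>TV)"
  proof (rule nn_integral_mono)
    fix w
    have "norm (E w * of_real (D i m j n w $ a)) \<le> (M * (1 + norm (snd w))) * norm (D i m j n w)"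
      unfolding norm_mult norm_of_real using E[of w] M
      by (intro mult_mono) (auto simp: component_le_norm_cart)
    then show "ennreal (norm (E w * of_real (D i m j n w $ a))) \<le> ennreal M * ennreal ((1 + norm (snd w)) * norm (D i m j n w))"
      using M by (simp add: ennreal_mult[symmetric] ennreal_leI mult.assoc)
  qed
  also have "\<dots> = ennreal M * (\<integral>\<^sup>+w. ennreal ((1 + norm (snd w)) * norm (D i m j n w)) \<partial>TV)"
    by (rule nn_integral_cmult) simp
  also have "\<dots> \<le> ennreal M * ennreal (decay_const TYPE('n) \<sigma> * b)"
    by (intro mult_left_mono D_L1 mn) auto
  finally have le: "(\<integral>\<^sup>+w. ennreal (norm (E w * of_real (D i m j n w $ a))) \<partial>TV) \<le> ennreal (M * decay_const TYPE('n) \<sigma> * b)"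
    using M b_nonneg by (simp add: ennreal_mult decay_const_nonneg mult.assoc)
  have "(\<integral>\<^sup>+w. ennreal (norm (E w * of_real (D i m j n w $ a))) \<partial>TV) < \<infinity>"
    by (rule le_less_trans[OF le]) simp
  then show int: "integrable TV (\<lambda>w. E w * of_real (D i m j n w $ a))"
    by (intro integrableI_bounded) auto
  have "ennreal (cmod (LINT w|TV. E w * of_real (D i m j n w $ a))) \<le> ennreal (M * decay_const TYPE('n) \<sigma> * b)"
    using integral_norm_bound_ennreal[OF int] le by (rule order_trans)
  then show "cmod (LINT w|TV. E w * of_real (D i m j n w $ a)) \<le> M * decay_const TYPE('n) \<sigma> * b"
    using M b_nonneg by (simp add: ennreal_le_iff decay_const_nonneg)
qed

lemma bounded_imp_linear_growth: "cmod (E w) \<le> M \<Longrightarrow> cmod (E w) \<le> M * (1 + norm (v :: real ^ 'n))"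
proof -
  assume *: "cmod (E w) \<le> M"
  then have "0 \<le> M" using norm_ge_zero order_trans by blast
  then have "M * 1 \<le> M * (1 + norm v)" by (intro mult_left_mono) auto
  with * show ?thesis by simp
qed

lemma of_real_nth_derivative:
  fixes h :: "real \<Rightarrow> real ^ 'n"
  assumes "(h has_vector_derivative h') F"
  shows "((\<lambda>r. complex_of_real (h r $ a)) has_vector_derivative of_real (h' $ a)) F"
proof -
  have "bounded_linear (\<lambda>x :: real ^ 'n. complex_of_real (x $ a))"
    by (intro bounded_linear_compose[OF bounded_linear_of_real] bounded_linear_vec_nth)
  from bounded_linear.has_vector_derivative[OF this assms] show ?thesis .
qed

text \<open>The integral of the x-derivative of the whole product vanishes. Since E depends on v
  alone, the product rule differentiates only the character, which yields the factor from k, and the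
  field.\<close>

lemma parts_dx:
  assumes mn: "Suc m + n \<le> p"
    and E: "continuous_on UNIV E" "\<And>v. cmod (E v) \<le> M * (1 + norm v)" "M \<ge> 0"
  shows "(LINT w|TV. E (snd w) * fchar k (fst w) * of_real (D i (Suc m) j n w $ a))
       = - \<i> * of_int (k $ i) * (LINT w|TV. E (snd w) * fchar k (fst w) * of_real (D i m j n w $ a))"
proof -
  define F where "F w = E (snd w) * fchar k (fst w) * of_real (D i m j n w $ a)" for w
  define G where "G w = E (snd w) * fchar k (fst w) * of_real (D i (Suc m) j n w $ a)" for w
  define F' where "F' w = \<i> * of_int (k $ i) * F w + G w" for w
  have contE: "continuous_on S (\<lambda>w. E (h w))" if "continuous_on S h" for S and h :: "_ \<Rightarrow> real ^ 'n"
    using continuous_on_compose2[OF E(1) that] by auto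
  have mE: "(\<lambda>w. E (snd w) * fchar k (fst w)) \<in> borel_measurable (borel :: 'n phase measure)"
    by (intro borel_measurable_continuous_onI continuous_intros contE)
  have intF: "integrable TV F" and intG: "integrable TV G"
    unfolding F_def[abs_def] G_def[abs_def]
    by ((rule D_integral(1)[OF _ mE, where M = M], use mn E(2,3) in \<open>simp_all add: norm_mult\<close>)[])+
  have "(LINT w|TV. F' w) = 0"
  proof (rule integral_TV_derivative_eq_0[where f = F and e = "(axis i 1, 0)"])
    have "periodic (\<lambda>x. fchar k x)" by (rule periodic_fchar)
    then show "periodic_fst F" "periodic_fst F'"
      using periodic_D[of i m j n] periodic_D[of i "Suc m" j n]
      by (auto simp: periodic_fst_def periodic_def F_def F'_def G_def)
    show "continuous_on UNIV F'"
      unfolding F'_def F_def G_def by (intro continuous_intros contE)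
    show "integrable TV F" by fact
    show "integrable TV F'" unfolding F'_def[abs_def] using intF intG by simp
    fix w :: "'n phase" and r :: real
    let ?w = "\<lambda>r. w + r *\<^sub>R (axis i 1, 0)"
    have 1: "fchar k (fst (?w r)) = fchar k (fst w) * cis (r * of_int (k $ i))" for r
      by (simp add: fchar_add) (simp add: fchar_def char_phase_scaleR)
    have 2: "((\<lambda>r. fchar k (fst (?w r))) has_vector_derivative \<i> * of_int (k $ i) * fchar k (fst (?w r))) (at r)"
      unfolding 1 using has_vector_derivative_mult_right[OF has_vector_derivative_cis_mult[of "of_int (k $ i)" r], of "fchar k (fst w)"]
      by (simp add: mult_ac)
    have "((\<lambda>r. E (snd w) * (fchar k (fst (?w r)) * of_real (D i m j n (?w r) $ a))) has_vector_derivative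
        E (snd w) * (fchar k (fst (?w r)) * of_real (D i (Suc m) j n (?w r) $ a)
         + (\<i> * of_int (k $ i) * fchar k (fst (?w r))) * of_real (D i m j n (?w r) $ a))) (at r)"
      by (intro has_vector_derivative_mult_right has_vector_derivative_mult 2 of_real_nth_derivative D_dx)
    then show "((\<lambda>r. F (?w r)) has_vector_derivative F' (?w r)) (at r)"
      by (simp add: F_def F'_def G_def algebra_simps)
  qed
  then have "\<i> * of_int (k $ i) * (LINT w|TV. F w) + (LINT w|TV. G w) = 0"
    unfolding F'_def using intF intG by simp
  then show ?thesis unfolding F_def G_def by (simp add: add_eq_0_iff2)
qed

text \<open>Here E is an antiderivative of E' along the j-th velocity coordinate and the character
  is constant in v. The order in x is 0 because \<open>D\<close> takes v-derivatives first.\<close>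

lemma parts_dv:
  assumes n: "Suc n \<le> p"
    and E: "continuous_on UNIV E" "\<And>v. cmod (E v) \<le> M * (1 + norm v)" "M \<ge> 0"
    and E': "continuous_on UNIV E'" "\<And>v. cmod (E' v) \<le> M' * (1 + norm v)" "M' \<ge> 0"
    and deriv: "\<And>v r. ((\<lambda>r. E (v + r *\<^sub>R axis j 1)) has_vector_derivative E' (v + r *\<^sub>R axis j 1)) (at r)"
  shows "(LINT w|TV. E' (snd w) * fchar k (fst w) * of_real (D i 0 j n w $ a))
       = - (LINT w|TV. E (snd w) * fchar k (fst w) * of_real (D i 0 j (Suc n) w $ a))"
proof -
  define F where "F w = E (snd w) * fchar k (fst w) * of_real (D i 0 j n w $ a)" for w
  define G where "G w = E (snd w) * fchar k (fst w) * of_real (D i 0 j (Suc n) w $ a)" for w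
  define H where "H w = E' (snd w) * fchar k (fst w) * of_real (D i 0 j n w $ a)" for w
  define F' where "F' w = H w + G w" for w
  have contE: "continuous_on S (\<lambda>w. E (h w))" "continuous_on S (\<lambda>w. E' (h w))"
    if "continuous_on S h" for S and h :: "_ \<Rightarrow> real ^ 'n"
    using continuous_on_compose2[OF E(1) that] continuous_on_compose2[OF E'(1) that] by auto
  have mE: "(\<lambda>w. E (snd w) * fchar k (fst w)) \<in> borel_measurable (borel :: 'n phase measure)"
    "(\<lambda>w. E' (snd w) * fchar k (fst w)) \<in> borel_measurable (borel :: 'n phase measure)"
    by (intro borel_measurable_continuous_onI continuous_intros contE)+
  have intF: "integrable TV F" and intG: "integrable TV G" and intH: "integrable TV H"
    unfolding F_def[abs_def] G_def[abs_def] H_def[abs_def]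
    by ((rule D_integral(1)[OF _ mE(1), where M = M] D_integral(1)[OF _ mE(2), where M = M'], use n E(2,3) E'(2,3) in \<open>simp_all add: norm_mult\<close>)[])+
  have "(LINT w|TV. F' w) = 0"
  proof (rule integral_TV_derivative_eq_0[where f = F and e = "(0, axis j 1)"])
    have "periodic (\<lambda>x. fchar k x)" by (rule periodic_fchar)
    then show "periodic_fst F" "periodic_fst F'"
      using periodic_D[of i 0 j n] periodic_D[of i 0 j "Suc n"]
      by (auto simp: periodic_fst_def periodic_def F_def F'_def G_def H_def)
    show "continuous_on UNIV F'"
      unfolding F'_def H_def G_def by (intro continuous_intros contE)
    show "integrable TV F" by fact
    show "integrable TV F'" unfolding F'_def[abs_def] using intH intG by simp
    fix w :: "'n phase" and r :: real
    let ?w = "\<lambda>r. w + r *\<^sub>R (0, axis j 1)"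
    have 2: "((\<lambda>r. E (snd (?w r))) has_vector_derivative E' (snd (?w r))) (at r)"
      using deriv[of "snd w" r] by simp
    have "((\<lambda>r. fchar k (fst w) * (E (snd (?w r)) * of_real (D i 0 j n (?w r) $ a))) has_vector_derivative
        fchar k (fst w) * (E (snd (?w r)) * of_real (D i 0 j (Suc n) (?w r) $ a)
         + E' (snd (?w r)) * of_real (D i 0 j n (?w r) $ a))) (at r)"
      by (intro has_vector_derivative_mult_right has_vector_derivative_mult 2 of_real_nth_derivative D_dv)
    then show "((\<lambda>r. F (?w r)) has_vector_derivative F' (?w r)) (at r)"
      by (simp add: F_def F'_def G_def H_def algebra_simps)
  qed
  then have "(LINT w|TV. H w) + (LINT w|TV. G w) = 0"
    unfolding F'_def using intH intG by simp
  then show ?thesis unfolding H_def G_def by (simp add: add_eq_0_iff2)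
qed

end

section \<open>Decay of the kernel\<close>

text \<open>The gap between the friction and the free frequency is quadratic in \<tau>. Multiplying
  1 - \<tau> \<le> exp (- \<tau>) by exp \<tau> gives exp \<tau> - 1 \<le> \<tau> exp \<tau>, and
  using this twice gives the second bound.\<close>

lemma exp_minus_one_minus:
  fixes \<tau> :: real assumes "\<tau> \<ge> 0"
  shows "\<tau> \<le> exp \<tau> - 1" "exp \<tau> - 1 - \<tau> \<le> \<tau>\<^sup>2 * exp \<tau>"
proof -
  show 1: "\<tau> \<le> exp \<tau> - 1" using exp_ge_add_one_self[of \<tau>] by linarith
  have "exp \<tau> * (1 - \<tau>) \<le> exp \<tau> * exp (- \<tau>)"
    using exp_ge_add_one_self[of "- \<tau>"] by (intro mult_left_mono) auto
  then have 2: "exp \<tau> - 1 \<le> \<tau> * exp \<tau>" by (simp add: algebra_simps flip: exp_add)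
  have "exp \<tau> - 1 - \<tau> \<le> \<tau> * exp \<tau> - \<tau>" using 2 by simp
  also have "\<dots> = \<tau> * (exp \<tau> - 1)" by (simp add: algebra_simps)
  also have "\<dots> \<le> \<tau> * (\<tau> * exp \<tau>)" using 2 assms by (intro mult_left_mono)
  finally show "exp \<tau> - 1 - \<tau> \<le> \<tau>\<^sup>2 * exp \<tau>" by (simp add: power2_eq_square mult.assoc)
qed

lemma norm_cis_diff_le: "cmod (cis a - cis b) \<le> \<bar>a - b\<bar>"
proof -
  have "cis a - cis b = cis b * (cis (a - b) - 1)"
    by (simp add: algebra_simps cis_mult)
  then have "cmod (cis a - cis b) = cmod (exp (\<i> * of_real (a - b)) - 1)"
    by (simp add: norm_mult cis_conv_exp)
  also have "\<dots> = 2 * \<bar>sin ((a - b) / 2)\<bar>" by (rule dist_exp_i_1)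
  also have "\<dots> \<le> \<bar>a - b\<bar>" using abs_sin_x_le_abs_x[of "(a - b) / 2"] by simp
  finally show ?thesis .
qed

lemma power_diff_le:
  fixes u w :: real assumes "0 \<le> w" "w \<le> u"
  shows "u ^ n - w ^ n \<le> real n * (u - w) * u ^ (n - 1)"
proof (induction n)
  case (Suc n)
  have "u ^ Suc n - w ^ Suc n = u * (u ^ n - w ^ n) + w ^ n * (u - w)"
    by (simp add: algebra_simps)
  also have "\<dots> \<le> u * (real n * (u - w) * u ^ (n - 1)) + u ^ n * (u - w)"
    using assms Suc by (intro add_mono mult_left_mono mult_right_mono power_mono) auto
  also have "\<dots> = real (Suc n) * (u - w) * u ^ n"
    by (cases n) (simp_all add: algebra_simps)
  finally show ?case by simp
qed simp

text \<open>The \<open>n\<close>-fold antiderivative of \<open>v \<mapsto> cis (- \<eta> * char_phase l v)\<close> along a coordinate in which \<open>l\<close> has entry \<open>c\<close>.\<close>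

definition osc :: "int ^ 'n \<Rightarrow> real \<Rightarrow> nat \<Rightarrow> real \<Rightarrow> real ^ 'n \<Rightarrow> complex" where
  "osc l c n \<eta> v = cis (- (\<eta> * char_phase l v)) / (- \<i> * of_real (\<eta> * c)) ^ n"

lemma osc_eq_inverse:
  "osc l c n \<eta> v = cis (- (\<eta> * char_phase l v)) * of_real (inverse \<eta> ^ n) / (- \<i> * of_real c) ^ n"
proof -
  have "- \<i> * of_real (\<eta> * c) = of_real \<eta> * (- \<i> * of_real c)" by simp
  then show ?thesis
    unfolding osc_def by (simp only: power_mult_distrib) (simp add: divide_inverse power_inverse)
qed

text \<open>A mean value estimate in the frequency \<eta>: the derivative of the exponential
  contributes the phase, that of the n-th inverse power contributes n / \<eta>, and both bounds are
  largest at the smaller frequency \<tau>.\<close>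

lemma norm_osc_diff_le:
  assumes "0 < \<tau>" "\<tau> \<le> \<theta>" "c \<noteq> 0"
  shows "cmod (osc l c n \<tau> v - osc l c n \<theta> v)
     \<le> (\<theta> - \<tau>) * (\<bar>char_phase l v\<bar> + real n / \<tau>) / (\<tau> * \<bar>c\<bar>) ^ n"
proof -
  define \<phi> where "\<phi> = char_phase l v"
  define u w where "u = inverse \<tau>" and "w = inverse \<theta>"
  have uw: "0 \<le> w" "w \<le> u" "u > 0" using assms by (auto simp: u_def w_def le_imp_inverse_le)
  have "u - w = (\<theta> - \<tau>) * u * w"
    using assms by (simp add: u_def w_def field_simps)
  also have "\<dots> \<le> (\<theta> - \<tau>) * u * u" using assms uw by (intro mult_left_mono) auto
  finally have uw': "u - w \<le> (\<theta> - \<tau>) * u * u" .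
  have "u ^ n - w ^ n \<le> real n * (u - w) * u ^ (n - 1)"
    by (rule power_diff_le[OF uw(1,2)])
  also have "\<dots> \<le> real n * ((\<theta> - \<tau>) * u * u) * u ^ (n - 1)"
    using uw uw' by (intro mult_left_mono mult_right_mono) auto
  also have "\<dots> = (\<theta> - \<tau>) * (real n * u) * u ^ n"
    by (cases n) (simp_all add: mult_ac)
  finally have 1: "u ^ n - w ^ n \<le> (\<theta> - \<tau>) * (real n * u) * u ^ n" .
  have wu: "w ^ n \<le> u ^ n" by (intro power_mono uw)
  \<comment> \<open>Add and subtract the mixed product, so that the phases and the inverse powers
    are compared separately.\<close>
  have "cis (- (\<tau> * \<phi>)) * of_real (u ^ n) - cis (- (\<theta> * \<phi>)) * of_real (w ^ n)
      = (cis (- (\<tau> * \<phi>)) - cis (- (\<theta> * \<phi>))) * of_real (u ^ n) + cis (- (\<theta> * \<phi>)) * of_real (u ^ n - w ^ n)"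
    by (simp add: algebra_simps)
  also have "cmod \<dots> \<le> cmod (cis (- (\<tau> * \<phi>)) - cis (- (\<theta> * \<phi>))) * u ^ n + (u ^ n - w ^ n)"
    using wu uw by (intro order_trans[OF norm_triangle_ineq] add_mono) (auto simp only: norm_mult norm_cis norm_of_real, auto)
  also have "\<dots> \<le> \<bar>- (\<tau> * \<phi>) - (- (\<theta> * \<phi>))\<bar> * u ^ n + (\<theta> - \<tau>) * (real n * u) * u ^ n"
    using uw by (intro add_mono mult_right_mono norm_cis_diff_le 1) auto
  also have "\<bar>- (\<tau> * \<phi>) - (- (\<theta> * \<phi>))\<bar> = (\<theta> - \<tau>) * \<bar>\<phi>\<bar>"
  proof -
    have "- (\<tau> * \<phi>) - (- (\<theta> * \<phi>)) = (\<theta> - \<tau>) * \<phi>" by (simp add: algebra_simps)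
    then show ?thesis using assms by (simp add: abs_mult)
  qed
  finally have 2: "cmod (cis (- (\<tau> * \<phi>)) * of_real (u ^ n) - cis (- (\<theta> * \<phi>)) * of_real (w ^ n))
      \<le> (\<theta> - \<tau>) * (\<bar>\<phi>\<bar> + real n * u) * u ^ n"
    by (simp add: algebra_simps)
  have "cmod (osc l c n \<tau> v - osc l c n \<theta> v)
      = cmod (cis (- (\<tau> * \<phi>)) * of_real (u ^ n) - cis (- (\<theta> * \<phi>)) * of_real (w ^ n)) / \<bar>c\<bar> ^ n"
    unfolding osc_eq_inverse diff_divide_distrib[symmetric] norm_divide norm_power
    by (simp add: u_def w_def \<phi>_def norm_mult)
  also have "\<dots> \<le> (\<theta> - \<tau>) * (\<bar>\<phi>\<bar> + real n * u) * u ^ n / \<bar>c\<bar> ^ n"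
    by (intro divide_right_mono 2) auto
  also have "\<dots> = (\<theta> - \<tau>) * (\<bar>\<phi>\<bar> + real n / \<tau>) / (\<tau> * \<bar>c\<bar>) ^ n"
    by (simp add: u_def power_mult_distrib divide_inverse power_inverse mult_ac)
  finally show ?thesis by (simp add: \<phi>_def)
qed

text \<open>The maximum norm is convenient because it is attained at a coordinate; integrating by
  parts along that one coordinate gains the full size of the frequency.\<close>

definition supn :: "int ^ 'n \<Rightarrow> real" where
  "supn l = Max (range (\<lambda>i. real_of_int \<bar>l $ i\<bar>))"

lemma supn_ge: "\<bar>real_of_int (l $ i)\<bar> \<le> supn l"
  unfolding supn_def of_int_abs[symmetric] by (rule Max_ge) auto

lemma supn_attained: obtains i where "\<bar>real_of_int (l $ i)\<bar> = supn l"
proof -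
  have "supn l \<in> range (\<lambda>i. real_of_int \<bar>l $ i\<bar>)" unfolding supn_def by (rule Max_in) auto
  then show ?thesis using that by auto
qed

lemma supn_nonneg: "supn l \<ge> 0"
  using supn_attained[of l] by (metis abs_ge_zero)

lemma supn_0 [simp]: "supn 0 = 0"
  by (rule supn_attained[of 0]) simp

lemma supn_ge_1: assumes "l \<noteq> 0" shows "supn l \<ge> 1"
proof -
  obtain i where "l $ i \<noteq> 0" using assms by (auto simp: vec_eq_iff)
  then have "\<bar>real_of_int (l $ i)\<bar> \<ge> 1" by linarith
  then show ?thesis using supn_ge[of l i] by linarith
qed

lemma supn_minus_commute: "supn (k - l) = supn (l - k)"
  by (simp add: supn_def abs_minus_commute)

lemma supn_triangle: "supn k \<le> supn l + supn (k - l)"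
proof -
  obtain i where "\<bar>real_of_int (k $ i)\<bar> = supn k" by (rule supn_attained)
  moreover have "\<bar>real_of_int (k $ i)\<bar> \<le> \<bar>real_of_int (l $ i)\<bar> + \<bar>real_of_int ((k - l) $ i)\<bar>" by simp
  ultimately show ?thesis using supn_ge[of l i] supn_ge[of "k - l" i] by linarith
qed

lemma abs_char_phase_le: "\<bar>char_phase l v\<bar> \<le> real CARD('n) * supn l * norm (v :: real ^ 'n)"
proof -
  have "\<bar>char_phase l v\<bar> \<le> (\<Sum>i\<in>(UNIV :: 'n set). supn l * norm v)"
    unfolding char_phase_def
  proof (rule order_trans[OF sum_abs], rule sum_mono)
    show "\<bar>real_of_int (l $ i) * v $ i\<bar> \<le> supn l * norm v" for i
      unfolding abs_mult by (intro mult_mono supn_ge component_le_norm_cart supn_nonneg) auto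
  qed
  then show ?thesis by simp
qed

text \<open>Moves the H^1 weight from the output frequency k to the input frequency l at the price
  of one power of 1 + |k - l|. For l nonzero the norm of l is at least 1, so it absorbs both the
  constant 1 and the triangle inequality.\<close>

lemma sqrt_one_plus_sum_le:
  fixes k l :: "int ^ 'n" assumes "l \<noteq> 0"
  shows "sqrt (1 + (\<Sum>i\<in>UNIV. (of_int (k $ i))\<^sup>2)) \<le> real (CARD('n) + 1) * supn l * (1 + supn (k - l))"
proof -
  let ?L = "supn l" and ?s = "supn (k - l)"
  have L: "?L \<ge> 1" and s: "?s \<ge> 0" using supn_ge_1[OF assms] supn_nonneg by auto
  have "supn k \<le> ?L + ?s" by (rule supn_triangle)
  also have "\<dots> \<le> ?L * (1 + ?s)" using L s by (simp add: algebra_simps mult_le_cancel_right1)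
  finally have kL: "supn k \<le> ?L * (1 + ?s)" .
  have "1 \<le> ?L * (1 + ?s)" using L s mult_mono[of 1 ?L 1 "1 + ?s"] by simp
  then have X1: "1 \<le> (?L * (1 + ?s))\<^sup>2" by simp
  have "(\<Sum>i\<in>UNIV. (real_of_int (k $ i))\<^sup>2) \<le> (\<Sum>i\<in>(UNIV :: 'n set). (?L * (1 + ?s))\<^sup>2)"
  proof (rule sum_mono)
    fix i
    have "\<bar>real_of_int (k $ i)\<bar> \<le> ?L * (1 + ?s)" using supn_ge[of k i] kL by linarith
    then show "(real_of_int (k $ i))\<^sup>2 \<le> (?L * (1 + ?s))\<^sup>2" using L s
      by (subst abs_le_square_iff[symmetric]) simp
  qed
  then have "1 + (\<Sum>i\<in>UNIV. (real_of_int (k $ i))\<^sup>2) \<le> real (CARD('n) + 1) * (?L * (1 + ?s))\<^sup>2"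
    using X1 by (simp add: algebra_simps)
  also have "\<dots> \<le> (real (CARD('n) + 1))\<^sup>2 * (?L * (1 + ?s))\<^sup>2"
    by (intro mult_right_mono) (auto simp: power2_eq_square)
  finally have "1 + (\<Sum>i\<in>UNIV. (real_of_int (k $ i))\<^sup>2) \<le> (real (CARD('n) + 1) * ?L * (1 + ?s))\<^sup>2"
    by (simp only: power_mult_distrib mult_ac)
  then show ?thesis using L s by (intro real_le_lsqrt) auto
qed

lemma continuous_on_osc [continuous_intros]: "continuous_on S h \<Longrightarrow> continuous_on S (\<lambda>x. osc l c n \<eta> (h x))"
  unfolding osc_def divide_inverse by (intro continuous_intros)

lemma osc_derivative:
  assumes "\<eta> * c \<noteq> 0" "of_int (l $ j) = c"
  shows "((\<lambda>r. osc l c (Suc n) \<eta> (v + r *\<^sub>R axis j 1)) has_vector_derivative osc l c n \<eta> (v + r *\<^sub>R axis j 1)) (at r)"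
proof -
  let ?d = "(- \<i> * of_real (\<eta> * c))"
  have eq: "osc l c n \<eta> (v + r *\<^sub>R axis j 1) = cis (- (\<eta> * char_phase l v)) / ?d ^ n * cis (r * (- (\<eta> * c)))" for r n
  proof -
    have "- (\<eta> * char_phase l (v + r *\<^sub>R axis j 1)) = - (\<eta> * char_phase l v) + r * (- (\<eta> * c))"
      using assms(2) by (simp add: char_phase_add char_phase_scaleR algebra_simps)
    then show ?thesis by (simp only: osc_def flip: cis_mult) simp
  qed
  have d: "?d \<noteq> 0" using assms(1) by simp
  have "((\<lambda>r. cis (- (\<eta> * char_phase l v)) / ?d ^ Suc n * cis (r * (- (\<eta> * c)))) has_vector_derivative
      cis (- (\<eta> * char_phase l v)) / ?d ^ Suc n * (\<i> * of_real (- (\<eta> * c)) * cis (r * (- (\<eta> * c))))) (at r)"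
    by (intro has_vector_derivative_mult_right has_vector_derivative_cis_mult)
  also have "cis (- (\<eta> * char_phase l v)) / ?d ^ Suc n * (\<i> * of_real (- (\<eta> * c)) * cis (r * (- (\<eta> * c))))
      = cis (- (\<eta> * char_phase l v)) / ?d ^ n * cis (r * (- (\<eta> * c))) * (?d / ?d)"
    by simp
  also have "?d / ?d = 1" using d by (rule divide_self)
  finally show ?thesis unfolding eq by simp
qed

context field_bound
begin

lemma iterated_parts_dx:
  assumes mn: "m + n \<le> p"
    and E: "continuous_on UNIV E" "\<And>v. cmod (E v) \<le> M * (1 + norm v)" "M \<ge> 0"
  shows "(LINT w|TV. E (snd w) * fchar k (fst w) * of_real (D i m j n w $ a))
       = (- \<i> * of_int (k $ i)) ^ m * (LINT w|TV. E (snd w) * fchar k (fst w) * of_real (D i 0 j n w $ a))"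
  using mn
proof (induction m)
  case (Suc m)
  then show ?case using parts_dx[OF _ E, of m n k i j a] by (simp del: D_0 D_1)
qed simp

text \<open>Both oscillations are integrated in parallel along the same coordinate, so their
  difference, and with it the gain from the frequency gap, survives all n steps.\<close>

lemma iterated_parts_dv:
  assumes n: "n \<le> p" and \<tau>: "0 < \<tau>" "\<tau> \<le> \<theta>" and c: "c \<noteq> 0" "of_int (l $ j) = c"
  shows "(LINT w|TV. (osc l c 0 \<tau> (snd w) - osc l c 0 \<theta> (snd w)) * fchar k (fst w) * of_real (D i 0 j 0 w $ a))
       = (-1) ^ n * (LINT w|TV. (osc l c n \<tau> (snd w) - osc l c n \<theta> (snd w)) * fchar k (fst w) * of_real (D i 0 j n w $ a))"
  using n
proof (induction n)
  case (Suc n)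
  let ?E = "\<lambda>n v. osc l c n \<tau> v - osc l c n \<theta> v"
  define M where "M n = 1 / (\<tau> * \<bar>c\<bar>) ^ n + 1 / (\<theta> * \<bar>c\<bar>) ^ n" for n
  have "cmod (osc l c n \<eta> v) = 1 / (\<eta> * \<bar>c\<bar>) ^ n" if "\<eta> > 0" for n \<eta> v
    using that by (simp add: osc_def norm_divide norm_power norm_mult abs_mult)
  then have "cmod (?E n v) \<le> M n" for n v
    unfolding M_def using \<tau> by (intro order_trans[OF norm_triangle_ineq4] add_mono) auto
  then have bd: "cmod (?E n v) \<le> M n * (1 + norm v)" for n v
    by (rule bounded_imp_linear_growth)
  have M: "M n \<ge> 0" for n unfolding M_def using \<tau> by auto
  have "(LINT w|TV. ?E n (snd w) * fchar k (fst w) * of_real (D i 0 j n w $ a))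
      = - (LINT w|TV. ?E (Suc n) (snd w) * fchar k (fst w) * of_real (D i 0 j (Suc n) w $ a))"
  proof (rule parts_dv[where M = "M (Suc n)" and M' = "M n"])
    show "((\<lambda>r. ?E (Suc n) (v + r *\<^sub>R axis j 1)) has_vector_derivative ?E n (v + r *\<^sub>R axis j 1)) (at r)" for v r
      using \<tau> c by (intro has_vector_derivative_diff osc_derivative) auto
  qed (use Suc.prems bd M in \<open>auto intro!: continuous_intros\<close>)
  with Suc show ?case by simp
qed simp

text \<open>The frequency gap is combined with decay in both frequencies. The 16 is 2^4 from 1 +
  \<tau> L \<le> 2 \<tau> L in the range \<tau> L \<ge> 1 and from 1 + \<tau> L \<le> 2 below it;
  2^(d + 2) arises likewise in x. In d + 4, the d bounds the phase by the maximum norm and the 4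
  bounds the n / \<tau> of \<open>norm_osc_diff_le\<close>.\<close>

lemma osc_integral_bound:
  fixes l k :: "int ^ 'n"
  assumes p: "p \<ge> CARD('n) + 6" and \<tau>: "\<tau> > 0" and l: "l \<noteq> 0"
  defines "L \<equiv> supn l" and "d \<equiv> CARD('n)" and "\<theta> \<equiv> exp \<tau> - 1"
  shows "cmod (LINT w|TV. (cis (- (\<tau> * char_phase l (snd w))) - cis (- (\<theta> * char_phase l (snd w)))) * fchar k (fst w) * of_real (f (fst w) (snd w) $ a))
       \<le> 2 ^ (d + 2) * (16 * (real d + 4) * exp \<tau> * \<tau>\<^sup>2 * L / (1 + \<tau> * L) ^ 4) * (decay_const TYPE('n) \<sigma> * b) / (1 + supn k) ^ (d + 2)"
proof -
  let ?A = "decay_const TYPE('n) \<sigma>"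
  have L1: "L \<ge> 1" unfolding L_def by (rule supn_ge_1[OF l])
  have \<theta>: "\<tau> \<le> \<theta>" "\<theta> - \<tau> \<le> \<tau>\<^sup>2 * exp \<tau>"
    using exp_minus_one_minus[of \<tau>] \<tau> by (auto simp: \<theta>_def)
  obtain j where j: "\<bar>real_of_int (l $ j)\<bar> = L" unfolding L_def by (rule supn_attained)
  obtain i where i: "\<bar>real_of_int (k $ i)\<bar> = supn k" by (rule supn_attained)
  define c where "c = real_of_int (l $ j)"
  have c: "c \<noteq> 0" "\<bar>c\<bar> = L" using j L1 by (auto simp: c_def)
  \<comment> \<open>For \<tau> L < 1 each integration by parts would divide by a small number, while
    the desired denominator is bounded there anyway; so none is made.\<close>
  define n :: nat where "n = (if \<tau> * L \<ge> 1 then 4 else 0)"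
  \<comment> \<open>For k = 0 there is nothing to gain, as the target factor is then 1.\<close>
  define m :: nat where "m = (if k = 0 then 0 else d + 2)"
  have n: "n \<le> 4" and mn: "m + n \<le> p" using p by (auto simp: n_def m_def d_def)
  let ?E = "\<lambda>n v. osc l c n \<tau> v - osc l c n \<theta> v"
  define M where "M = 16 * (real d + 4) * exp \<tau> * \<tau>\<^sup>2 * L / (1 + \<tau> * L) ^ 4"
  have M0: "M \<ge> 0" using L1 \<tau> by (auto simp: M_def)
  have bound: "cmod (?E n v) \<le> M * (1 + norm v)" for v
  proof -
    have "cmod (?E n v) \<le> (\<theta> - \<tau>) * (\<bar>char_phase l v\<bar> + real n / \<tau>) / (\<tau> * L) ^ n"
      using norm_osc_diff_le[OF \<tau> \<theta>(1) c(1), of l n v] c by simp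
    also have "\<dots> \<le> (\<tau>\<^sup>2 * exp \<tau>) * ((real d + 4) * L * (1 + norm v)) / (\<tau> * L) ^ n"
    proof (intro divide_right_mono mult_mono \<theta>)
      \<comment> \<open>Either n = 0, or n = 4 with \<tau> L \<ge> 1. This turns the singular n /
        \<tau> into a multiple of L.\<close>
      have "real n \<le> 4 * (\<tau> * L)" using \<tau> L1 by (simp add: n_def)
      then have "real n / \<tau> \<le> 4 * L" using \<tau> by (simp add: pos_divide_le_eq mult_ac)
      then have "\<bar>char_phase l v\<bar> + real n / \<tau> \<le> real d * L * norm v + 4 * L"
        using abs_char_phase_le[of l v] by (simp add: L_def d_def)
      also have "\<dots> \<le> (real d + 4) * L * (1 + norm v)"
        using L1 by (simp add: algebra_simps)
      finally show "\<bar>char_phase l v\<bar> + real n / \<tau> \<le> (real d + 4) * L * (1 + norm v)" .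
    qed (use \<tau> L1 in auto)
    also have "\<dots> = (real d + 4) * exp \<tau> * \<tau>\<^sup>2 * L * (1 + norm v) * (1 / (\<tau> * L) ^ n)"
      by (simp add: mult_ac)
    also have "\<dots> \<le> (real d + 4) * exp \<tau> * \<tau>\<^sup>2 * L * (1 + norm v) * (16 / (1 + \<tau> * L) ^ 4)"
    proof (intro mult_left_mono)
      have pos: "1 + \<tau> * L > 0" using \<tau> L1 by (simp add: add_pos_nonneg)
      have "(1 + \<tau> * L) ^ 4 \<le> 16 * (\<tau> * L) ^ n"
      proof (cases "\<tau> * L \<ge> 1")
        case True
        then have "(1 + \<tau> * L) ^ 4 \<le> (2 * (\<tau> * L)) ^ 4" using pos by (intro power_mono) linarith+
        also have "\<dots> = 16 * (\<tau> * L) ^ 4" by (simp only: power_mult_distrib) simp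
        finally show ?thesis using True by (simp add: n_def)
      next
        case False
        then have "(1 + \<tau> * L) ^ 4 \<le> 2 ^ 4" using pos by (intro power_mono) auto
        then show ?thesis using False by (simp add: n_def)
      qed
      moreover have "1 / x \<le> 16 / y" if "y \<le> 16 * x" "x > 0" "y > 0" for x y :: real
        using that by (simp add: field_simps)
      moreover have "(\<tau> * L) ^ n > 0" "(1 + \<tau> * L) ^ 4 > 0"
        using pos \<tau> L1 by (auto intro!: zero_less_power mult_pos_pos)
      ultimately show "1 / (\<tau> * L) ^ n \<le> 16 / (1 + \<tau> * L) ^ 4" by blast
    qed (use \<tau> L1 in auto)
    finally show ?thesis by (simp add: M_def mult_ac)
  qed
  let ?I = "LINT w|TV. (cis (- (\<tau> * char_phase l (snd w))) - cis (- (\<theta> * char_phase l (snd w)))) * fchar k (fst w) * of_real (f (fst w) (snd w) $ a)"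
  let ?J = "LINT w|TV. ?E n (snd w) * fchar k (fst w) * of_real (D i 0 j n w $ a)"
  have "?I = (LINT w|TV. ?E 0 (snd w) * fchar k (fst w) * of_real (D i 0 j 0 w $ a))"
    by (simp add: osc_def)
  also have "\<dots> = (-1) ^ n * ?J"
    using mn c by (intro iterated_parts_dv \<tau> \<theta>) (auto simp: c_def)
  finally have IJ: "cmod ?I = cmod ?J" by (simp add: norm_mult norm_power)
  have contE: "continuous_on UNIV (?E n)" by (intro continuous_intros)
  have "supn k ^ m * cmod ?J = cmod ((- \<i> * of_int (k $ i)) ^ m * ?J)"
    by (simp add: norm_mult norm_power i)
  also have "\<dots> = cmod (LINT w|TV. ?E n (snd w) * fchar k (fst w) * of_real (D i m j n w $ a))"
    by (subst iterated_parts_dx[OF mn contE bound M0]) simp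
  also have "\<dots> \<le> M * ?A * b"
  proof (rule D_integral(2)[OF mn _ _ M0])
    show "(\<lambda>w. ?E n (snd w) * fchar k (fst w)) \<in> borel_measurable borel"
      by (intro borel_measurable_continuous_onI continuous_intros)
  qed (use bound in \<open>simp add: norm_mult\<close>)
  finally have Jm: "supn k ^ m * cmod ?J \<le> M * ?A * b" .
  have "(1 + supn k) ^ (d + 2) \<le> 2 ^ (d + 2) * supn k ^ m"
  proof (cases "k = 0")
    case False
    then have "(1 + supn k) ^ (d + 2) \<le> (2 * supn k) ^ (d + 2)"
      using supn_ge_1[of k] by (intro power_mono) auto
    with False show ?thesis by (simp only: m_def power_mult_distrib if_False)
  next
    case True
    show ?thesis
      unfolding True supn_0 m_def using one_le_power[of "2 :: real" "d + 2"]
      by (simp only: add_0_right power_one if_True power_0 mult_1_right refl)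
  qed
  then have "(1 + supn k) ^ (d + 2) * cmod ?J \<le> 2 ^ (d + 2) * (supn k ^ m * cmod ?J)"
    unfolding mult.assoc[symmetric] by (intro mult_right_mono) auto
  also have "\<dots> \<le> 2 ^ (d + 2) * (M * ?A * b)" by (intro mult_left_mono Jm) simp
  finally have "(1 + supn k) ^ (d + 2) * cmod ?I \<le> 2 ^ (d + 2) * (M * ?A * b)"
    unfolding IJ .
  moreover have "(1 + supn k) ^ (d + 2) > 0" using supn_nonneg[of k] by (intro zero_less_power) simp
  ultimately show ?thesis unfolding M_def[symmetric] by (simp add: pos_le_divide_eq mult_ac)
qed

text \<open>The x-divergence of exp(-i k.x) f with the character factored out again; this is what
  the k-th Fourier coefficient sees after the gradient of H is moved away.\<close>

definition twisted_div :: "int ^ 'n \<Rightarrow> 'n phase \<Rightarrow> complex" where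
  "twisted_div k w = (\<Sum>a\<in>UNIV. of_real (dx a f (fst w) (snd w) $ a) - \<i> * of_int (k $ a) * of_real (f (fst w) (snd w) $ a))"

text \<open>One integration by parts in x replaces the twisted divergence by the inner product of -i
  l with the field: l - k comes from the character and k from the twist. Three powers of L then meet
  \<tau>^2: one from this product, one from the H^1 weight, one from the frequency gap.\<close>

lemma kernel_bound:
  fixes l k :: "int ^ 'n"
  assumes p: "p \<ge> CARD('n) + 6" and \<tau>: "\<tau> > 0"
  defines "L \<equiv> supn l" and "d \<equiv> CARD('n)" and "\<theta> \<equiv> exp \<tau> - 1"
  shows "sqrt (1 + (\<Sum>i\<in>UNIV. (of_int (k $ i))\<^sup>2)) *
     cmod (LINT w|TV. (cis (- (\<tau> * char_phase l (snd w))) - cis (- (\<theta> * char_phase l (snd w)))) * fchar (l - k) (fst w) * twisted_div k w)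
       \<le> 2 ^ (d + 2) * 16 * (real d + 4) * real d * (real d + 1) * decay_const TYPE('n) \<sigma> * exp \<tau> * b
          * (1 / (1 + supn (k - l)) ^ (d + 1)) * (L / (1 + \<tau> * L)\<^sup>2)"
\<comment> \<open>At l = 0 both phases are trivial and their difference vanishes, as does the
  right-hand side.\<close>
proof (cases "l = 0")
  case True
  then show ?thesis by (simp add: L_def)
next
  case False
  let ?A = "decay_const TYPE('n) \<sigma>" and ?s = "supn (k - l)"
  have L1: "L \<ge> 1" unfolding L_def by (rule supn_ge_1[OF False])
  have s: "?s \<ge> 0" by (rule supn_nonneg)
  let ?E = "\<lambda>v. cis (- (\<tau> * char_phase l v)) - cis (- (\<theta> * char_phase l v))"
  have contE: "continuous_on UNIV ?E" by (intro continuous_intros)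
  have bdE: "cmod (?E v) \<le> 2 * (1 + norm v)" for v
    by (rule bounded_imp_linear_growth) (rule order_trans[OF norm_triangle_ineq4], simp)
  have mE: "(\<lambda>w. ?E (snd w) * fchar (l - k) (fst w)) \<in> borel_measurable (borel :: 'n phase measure)"
    by (intro borel_measurable_continuous_onI continuous_intros)
  let ?X = "\<lambda>a w. ?E (snd w) * fchar (l - k) (fst w) * of_real (dx a f (fst w) (snd w) $ a)"
  let ?Y = "\<lambda>a w. ?E (snd w) * fchar (l - k) (fst w) * of_real (f (fst w) (snd w) $ a)"
  let ?J = "\<lambda>a. LINT w|TV. ?Y a w" and ?Q = "LINT w|TV. ?E (snd w) * fchar (l - k) (fst w) * twisted_div k w"
  let ?K = "2 ^ (d + 2) * 16 * (real d + 4) * real d * (real d + 1) * ?A * exp \<tau> * b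
          * (1 / (1 + ?s) ^ (d + 1))"
  have int0: "integrable TV (\<lambda>w. ?Y a w)" for a
    using D_integral(1)[OF _ mE, of 0 0 2] bdE by (simp add: norm_mult)
  have int1: "integrable TV (\<lambda>w. ?X a w)" for a
    using D_integral(1)[OF _ mE, of "Suc 0" 0 2 a] bdE p by (simp add: norm_mult)
  have int: "(LINT w|TV. ?X a w) = - \<i> * of_int ((l - k) $ a) * ?J a" for a
    using parts_dx[OF _ contE bdE, of 0 0 "l - k" a] p by simp
  have "e * h * twisted_div k w = (\<Sum>a\<in>UNIV. e * h * of_real (dx a f (fst w) (snd w) $ a)
          - \<i> * of_int (k $ a) * (e * h * of_real (f (fst w) (snd w) $ a)))" for e h w
    unfolding twisted_div_def sum_distrib_left by (rule sum.cong) (simp_all add: algebra_simps)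
  then have "?Q
      = (LINT w|TV. (\<Sum>a\<in>UNIV. ?X a w
          - \<i> * of_int (k $ a) * ?Y a w))"
    by (simp only:)
  also have "\<dots> = (\<Sum>a\<in>UNIV. (LINT w|TV. ?X a w
          - \<i> * of_int (k $ a) * ?Y a w))"
    by (intro Bochner_Integration.integral_sum Bochner_Integration.integrable_diff int1 integrable_mult_right int0)
  also have "\<dots> = (\<Sum>a\<in>UNIV. - \<i> * of_int (l $ a) * ?J a)"
  proof (rule sum.cong[OF refl])
    fix a
    have "(LINT w|TV. ?X a w - \<i> * of_int (k $ a) * ?Y a w)
       = (LINT w|TV. ?X a w)
         - (LINT w|TV. \<i> * of_int (k $ a) * ?Y a w)"
      by (intro Bochner_Integration.integral_diff int1 integrable_mult_right int0)
    also have "(LINT w|TV. \<i> * of_int (k $ a) * ?Y a w)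
        = \<i> * of_int (k $ a) * ?J a"
      by (rule integral_mult_right_zero)
    finally show "(LINT w|TV. ?X a w
          - \<i> * of_int (k $ a) * ?Y a w)
       = - \<i> * of_int (l $ a) * ?J a"
      unfolding int by (simp add: algebra_simps)
  qed
  finally have eq: "?Q = (\<Sum>a\<in>UNIV. - \<i> * of_int (l $ a) * ?J a)" .
  define R where "R = 2 ^ (d + 2) * (16 * (real d + 4) * exp \<tau> * \<tau>\<^sup>2 * L / (1 + \<tau> * L) ^ 4) * (?A * b) / (1 + ?s) ^ (d + 2)"
  have J: "cmod (?J a) \<le> R" for a
    using osc_integral_bound[OF p \<tau> False, of "l - k" a]
    unfolding R_def L_def d_def \<theta>_def by (simp add: supn_minus_commute[of l k])
  have R0: "R \<ge> 0" using J norm_ge_zero order_trans by blast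
  have "cmod ?Q \<le> (\<Sum>a\<in>(UNIV :: 'n set). L * R)"
    unfolding eq
  proof (rule order_trans[OF norm_sum], rule sum_mono)
    fix a
    show "cmod (- \<i> * of_int (l $ a) * ?J a) \<le> L * R"
      unfolding norm_mult using supn_ge[of l a] J[of a] L1 by (intro mult_mono) (auto simp: L_def)
  qed
  then have Q: "cmod ?Q \<le> real d * L * R"
    by (simp add: d_def)
  have "sqrt (1 + (\<Sum>i\<in>UNIV. (of_int (k $ i))\<^sup>2)) * cmod ?Q
      \<le> (real (d + 1) * L * (1 + ?s)) * (real d * L * R)"
    using sqrt_one_plus_sum_le[OF False, of k] L1 s R0 unfolding d_def[symmetric] L_def[symmetric]
    by (intro mult_mono Q) auto
  also have "\<dots> = ?K * (L * ((\<tau> * L)\<^sup>2 / (1 + \<tau> * L) ^ 4))"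
  proof -
    \<comment> \<open>Stated over free variables so that only commutative algebra remains. The
      factor \<open>S\<close>, here 1 + |k - l| from the H^1 weight, cancels one of the d + 2 powers
      in the denominator.\<close>
    have alg: "(x * y * S) * (e * y * (c * (16 * g * h * t\<^sup>2 * y / W) * (u * v) / (Y * S)))
        = (c * 16 * g * e * x * u * h * v * (1 / Y)) * (y * ((t * y)\<^sup>2 / W))"
      if "S \<noteq> 0" for x y S e c g h t W u v Y :: real
      using that by (simp add: power2_eq_square mult_ac)
    have "(1 + ?s) ^ (d + 2) = (1 + ?s) ^ (d + 1) * (1 + ?s)" by simp
    moreover have "real (d + 1) = real d + 1" "1 + ?s \<noteq> 0" using s by auto
    ultimately show ?thesis unfolding R_def by (simp only:) (rule alg)
  qed
  \<comment> \<open>Two of the four powers of 1 + \<tau> L absorb the square of \<tau> L.\<close>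
  also have "\<dots> \<le> ?K * (L / (1 + \<tau> * L)\<^sup>2)"
  proof (intro mult_left_mono)
    have pos: "1 + \<tau> * L > 0" using \<tau> L1 by (simp add: add_pos_nonneg)
    have "(\<tau> * L)\<^sup>2 \<le> (1 + \<tau> * L)\<^sup>2" using \<tau> L1 by (intro power_mono) auto
    then have "(\<tau> * L)\<^sup>2 / (1 + \<tau> * L) ^ 4 \<le> (1 + \<tau> * L)\<^sup>2 / (1 + \<tau> * L) ^ 4"
      using pos by (intro divide_right_mono) auto
    also have "\<dots> = 1 / (1 + \<tau> * L)\<^sup>2"
    proof -
      have "x\<^sup>2 / x ^ 4 = 1 / x\<^sup>2" if "x > 0" for x :: real
        using that by (simp add: power_eq_if[of _ 4] power_eq_if[of _ 3] power2_eq_square)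
      then show ?thesis using pos by blast
    qed
    finally have "L * ((\<tau> * L)\<^sup>2 / (1 + \<tau> * L) ^ 4) \<le> L * (1 / (1 + \<tau> * L)\<^sup>2)"
      using L1 by (intro mult_left_mono) auto
    then show "L * ((\<tau> * L)\<^sup>2 / (1 + \<tau> * L) ^ 4) \<le> L / (1 + \<tau> * L)\<^sup>2" by simp
  qed (use s b_nonneg in \<open>auto intro!: mult_nonneg_nonneg divide_nonneg_nonneg simp: decay_const_nonneg\<close>)
  finally show ?thesis .
qed

end

section \<open>The Schur test\<close>

lemma ennreal_sqrt_sq: "x \<ge> 0 \<Longrightarrow> (ennreal (sqrt x))\<^sup>2 = ennreal x"
  by (simp add: ennreal_power)

text \<open>Write K as the square of its root and apply Cauchy-Schwarz in y, keeping one root with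
  h; the integral over y of K is bounded by A, and after Tonelli the integral over x is bounded by
  B.\<close>

lemma Schur_test:
  fixes K :: "'a \<Rightarrow> 'b \<Rightarrow> real" and h :: "'b \<Rightarrow> ennreal"
  assumes sf: "pair_sigma_finite M N"
    and K: "(\<lambda>z. K (fst z) (snd z)) \<in> borel_measurable (M \<Otimes>\<^sub>M N)" "\<And>x y. K x y \<ge> 0"
    and h: "h \<in> borel_measurable N"
    and A: "\<And>x. x \<in> space M \<Longrightarrow> (\<integral>\<^sup>+y. K x y \<partial>N) \<le> A"
    and B: "\<And>y. y \<in> space N \<Longrightarrow> (\<integral>\<^sup>+x. K x y \<partial>M) \<le> B"
  shows "(\<integral>\<^sup>+x. (\<integral>\<^sup>+y. K x y * h y \<partial>N)\<^sup>2 \<partial>M) \<le> A * B * (\<integral>\<^sup>+y. (h y)\<^sup>2 \<partial>N)"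
proof -
  interpret pair_sigma_finite M N by (rule sf)
  note [measurable] = K(1) h
  have mx [measurable]: "K x \<in> borel_measurable N" if "x \<in> space M" for x
    using measurable_Pair2[OF K(1) that] by simp
  have my [measurable]: "(\<lambda>x. K x y) \<in> borel_measurable M" if "y \<in> space N" for y
    using measurable_Pair1[OF K(1) that] by simp
  have "(\<integral>\<^sup>+x. (\<integral>\<^sup>+y. K x y * h y \<partial>N)\<^sup>2 \<partial>M) \<le> (\<integral>\<^sup>+x. A * (\<integral>\<^sup>+y. K x y * (h y)\<^sup>2 \<partial>N) \<partial>M)"
  proof (rule nn_integral_mono)
    fix x assume x: "x \<in> space M"
    note [measurable] = mx[OF x]
    have "(\<integral>\<^sup>+y. K x y * h y \<partial>N) = (\<integral>\<^sup>+y. ennreal (sqrt (K x y)) * (ennreal (sqrt (K x y)) * h y) \<partial>N)"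
      by (intro nn_integral_cong) (simp add: K(2) ennreal_sqrt_sq flip: mult.assoc power2_eq_square)
    then have "(\<integral>\<^sup>+y. K x y * h y \<partial>N)\<^sup>2
        \<le> (\<integral>\<^sup>+y. (ennreal (sqrt (K x y)))\<^sup>2 \<partial>N) * (\<integral>\<^sup>+y. (ennreal (sqrt (K x y)) * h y)\<^sup>2 \<partial>N)"
      by (simp only:) (rule Cauchy_Schwarz_nn_integral; measurable)
    also have "\<dots> = (\<integral>\<^sup>+y. K x y \<partial>N) * (\<integral>\<^sup>+y. K x y * (h y)\<^sup>2 \<partial>N)"
      by (simp add: power_mult_distrib ennreal_sqrt_sq K(2))
    also have "\<dots> \<le> A * (\<integral>\<^sup>+y. K x y * (h y)\<^sup>2 \<partial>N)" by (intro mult_right_mono A x) simp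
    finally show "(\<integral>\<^sup>+y. K x y * h y \<partial>N)\<^sup>2 \<le> A * (\<integral>\<^sup>+y. K x y * (h y)\<^sup>2 \<partial>N)" .
  qed
  also have "\<dots> = A * (\<integral>\<^sup>+x. (\<integral>\<^sup>+y. K x y * (h y)\<^sup>2 \<partial>N) \<partial>M)"
    by (rule nn_integral_cmult) measurable
  also have "(\<integral>\<^sup>+x. (\<integral>\<^sup>+y. K x y * (h y)\<^sup>2 \<partial>N) \<partial>M) = (\<integral>\<^sup>+y. (\<integral>\<^sup>+x. K x y * (h y)\<^sup>2 \<partial>M) \<partial>N)"
    by (rule Fubini'[symmetric]) measurable
  also have "\<dots> = (\<integral>\<^sup>+y. (\<integral>\<^sup>+x. K x y \<partial>M) * (h y)\<^sup>2 \<partial>N)"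
    by (intro nn_integral_cong nn_integral_multc) measurable
  also have "\<dots> \<le> (\<integral>\<^sup>+y. B * (h y)\<^sup>2 \<partial>N)"
    by (intro nn_integral_mono mult_right_mono B) auto
  also have "\<dots> = B * (\<integral>\<^sup>+y. (h y)\<^sup>2 \<partial>N)"
    by (rule nn_integral_cmult) measurable
  finally show ?thesis by (simp add: mult.assoc mult_left_mono)
qed

section \<open>Sums over frequencies and summability of the frequency weight\<close>

lemma nn_integral_count_space_freq_box:
  fixes f :: "int ^ 'n \<Rightarrow> ennreal"
  shows "(\<integral>\<^sup>+l. f l \<partial>count_space UNIV) = (SUP n. \<Sum>l\<in>freq_box n. f l)"
proof -
  have box: "(\<integral>\<^sup>+l. f l * indicator (freq_box n) l \<partial>count_space UNIV) = (\<Sum>l\<in>freq_box n. f l)" for n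
    by (simp add: nn_integral_count_space_indicator[symmetric] nn_integral_count_space_finite)
  have "(SUP n. f l * indicator (freq_box n) l) = f l" for l
  proof (rule antisym)
    show "(SUP n. f l * indicator (freq_box n) l) \<le> f l"
      by (intro SUP_least) (auto simp: indicator_def)
    obtain n where "{l} \<subseteq> freq_box n" by (rule finite_subset_freq_box[of "{l}"]) auto
    then show "f l \<le> (SUP n. f l * indicator (freq_box n) l)"
      by (intro SUP_upper2[of n]) auto
  qed
  then have "(\<integral>\<^sup>+l. f l \<partial>count_space UNIV) = (\<integral>\<^sup>+l. (SUP n. f l * indicator (freq_box n) l) \<partial>count_space UNIV)"
    by simp
  also have "\<dots> = (SUP n. \<integral>\<^sup>+l. f l * indicator (freq_box n) l \<partial>count_space UNIV)"
  proof (rule nn_integral_monotone_convergence_SUP)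
    have "indicator (freq_box m) l \<le> (indicator (freq_box n) l :: ennreal)" if "m \<le> n" for m n and l :: "int ^ 'n"
      using that by (fastforce simp: indicator_def freq_box_def intro: order_trans)
    then show "incseq (\<lambda>n l. f l * indicator (freq_box n) l)"
      by (auto simp: incseq_def le_fun_def intro!: mult_left_mono)
  qed simp
  finally show ?thesis by (simp add: box)
qed

lemma sum_le_nn_integral_count_space:
  fixes f :: "'a \<Rightarrow> ennreal"
  assumes "finite F" shows "(\<Sum>l\<in>F. f l) \<le> (\<integral>\<^sup>+l. f l \<partial>count_space UNIV)"
proof -
  have "(\<Sum>l\<in>F. f l) = (\<integral>\<^sup>+l. f l * indicator F l \<partial>count_space UNIV)"
    using assms by (simp add: nn_integral_count_space_indicator[symmetric] nn_integral_count_space_finite)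
  also have "\<dots> \<le> (\<integral>\<^sup>+l. f l \<partial>count_space UNIV)"
    by (intro nn_integral_mono) (auto simp: indicator_def)
  finally show ?thesis .
qed

lemma infsum_le_nn_integral_count_space:
  fixes f :: "'a \<Rightarrow> ennreal"
  shows "infsum f UNIV \<le> (\<integral>\<^sup>+l. f l \<partial>count_space UNIV)"
proof -
  have "infsum f UNIV = (SUP F\<in>{F. finite F \<and> F \<subseteq> UNIV}. sum f F)"
    by (rule nonneg_infsum_complete) simp
  also have "\<dots> \<le> (\<integral>\<^sup>+l. f l \<partial>count_space UNIV)"
    by (intro SUP_least sum_le_nn_integral_count_space) auto
  finally show ?thesis .
qed

definition weight_sum :: "'n::finite itself \<Rightarrow> ennreal" where
  "weight_sum _ = (\<integral>\<^sup>+m. ennreal (1 / (1 + supn (m :: int ^ 'n)) ^ (CARD('n) + 1)) \<partial>count_space UNIV)"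

text \<open>Integral comparison: on the translate of the cube by \<open>lattice m\<close>, the
  function (1 + |x|^2) to the power -(d + 1)/2 is at least a constant times the m-th summand. By the
  tiling identity the sum is controlled by a convergent integral, as (d + 1)/2 > d/2.\<close>

lemma weight_sum_finite: "weight_sum TYPE('n::finite) < \<infinity>"
proof -
  define d where "d = CARD('n)"
  define q where "q = real (d + 1) / 2"
  \<comment> \<open>Each coordinate of a point in the m-th translate is at most 2 pi (1 + |m|) in
    absolute value; B collects the d squares and the leading 1.\<close>
  define B where "B = 1 + real d * (2 * pi)\<^sup>2"
  have B: "B \<ge> 1" by (simp add: B_def)
  define c where "c = B powr (- q) * (2 * pi) ^ d"
  have c: "c > 0" using B by (simp add: c_def)
  have lower: "ennreal (B powr (- q) * (1 / (1 + supn m) ^ (d + 1))) \<le> ennreal ((1 + (norm (x + lattice m))\<^sup>2) powr (- q))"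
    if x: "x \<in> half_cube" for x :: "real ^ 'n" and m
  proof -
    let ?S = "1 + supn m"
    have S: "?S \<ge> 1" using supn_nonneg[of m] by simp
    have "(norm (x + lattice m))\<^sup>2 = (\<Sum>i\<in>UNIV. ((x + lattice m) $ i)\<^sup>2)"
      by (simp add: norm_vec_def L2_set_def sum_nonneg)
    also have "\<dots> \<le> (\<Sum>i\<in>(UNIV :: 'n set). (2 * pi * ?S)\<^sup>2)"
    proof (rule sum_mono)
      fix i
      have "\<bar>(x + lattice m) $ i\<bar> \<le> \<bar>x $ i\<bar> + 2 * pi * \<bar>of_int (m $ i)\<bar>"
        using abs_triangle_ineq[of "x $ i" "2 * pi * of_int (m $ i)"] by (simp add: lattice_def abs_mult)
      also have "\<dots> \<le> 2 * pi + 2 * pi * supn m"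
        using x supn_ge[of m i] by (intro add_mono mult_left_mono) (auto simp: half_cube_def less_imp_le)
      finally have "\<bar>(x + lattice m) $ i\<bar> \<le> \<bar>2 * pi * ?S\<bar>" using S by (simp add: algebra_simps)
      then show "((x + lattice m) $ i)\<^sup>2 \<le> (2 * pi * ?S)\<^sup>2" by (simp only: abs_le_square_iff)
    qed
    also have "\<dots> = real d * (2 * pi)\<^sup>2 * ?S\<^sup>2" by (simp add: d_def power_mult_distrib)
    finally have "1 + (norm (x + lattice m))\<^sup>2 \<le> 1 + real d * (2 * pi)\<^sup>2 * ?S\<^sup>2" by simp
    also have "\<dots> \<le> ?S\<^sup>2 + real d * (2 * pi)\<^sup>2 * ?S\<^sup>2" using S by simp
    also have "\<dots> = B * ?S\<^sup>2" by (simp add: B_def algebra_simps)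
    finally have "(B * ?S\<^sup>2) powr (- q) \<le> (1 + (norm (x + lattice m))\<^sup>2) powr (- q)"
      by (intro powr_mono2') (auto simp: q_def)
    moreover have "(B * ?S\<^sup>2) powr (- q) = B powr (- q) * (?S\<^sup>2) powr (- q)"
      using B by (simp add: powr_mult)
    moreover have "(?S\<^sup>2) powr (- q) = 1 / ?S ^ (d + 1)"
    proof -
      have "(?S\<^sup>2) powr (- q) = ?S powr (2 * (- q))"
        using S by (subst powr_powr[symmetric]) (simp add: powr_numeral)
      also have "2 * (- q) = - real (d + 1)" by (simp add: q_def field_simps)
      finally have "(?S\<^sup>2) powr (- q) = ?S powr (- real (d + 1))" .
      moreover have "x powr (- real n) = 1 / x ^ n" if "x > 0" for x :: real and n
        using that by (simp add: powr_minus_divide powr_realpow)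
      ultimately show ?thesis using S by (metis less_le_trans zero_less_one)
    qed
    ultimately show ?thesis by (intro ennreal_leI) simp
  qed
  have "(\<integral>\<^sup>+m. ennreal c * ennreal (1 / (1 + supn (m :: int ^ 'n)) ^ (d + 1)) \<partial>count_space UNIV)
      = (\<integral>\<^sup>+m. (\<integral>\<^sup>+(x :: real ^ 'n). ennreal (B powr (- q) * (1 / (1 + supn m) ^ (d + 1))) * indicator half_cube x \<partial>lborel) \<partial>count_space (UNIV :: (int ^ 'n) set))"
  proof (intro nn_integral_cong)
    fix m :: "int ^ 'n"
    have "emeasure lborel (half_cube :: (real ^ 'n) set) = ennreal ((2 * pi) ^ d)"
    proof -
      have "emeasure lborel (half_cube :: (real ^ 'n) set) = emeasure lborel (cbox 0 (\<chi> i. 2 * pi) :: (real ^ 'n) set)"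
        by (rule emeasure_eq_AE) (use AE_half_cube in \<open>auto elim: eventually_mono\<close>)
      then show ?thesis by (simp add: emeasure_lborel_cube d_def)
    qed
    then have "(\<integral>\<^sup>+(x :: real ^ 'n). ennreal (B powr (- q) * (1 / (1 + supn m) ^ (d + 1))) * indicator half_cube x \<partial>lborel)
       = ennreal (B powr (- q) * (1 / (1 + supn m) ^ (d + 1))) * ennreal ((2 * pi) ^ d)"
      by (subst nn_integral_cmult_indicator) auto
    also have "\<dots> = ennreal c * ennreal (1 / (1 + supn m) ^ (d + 1))"
      using supn_nonneg[of m] by (subst (1 2) ennreal_mult[symmetric]) (auto simp: c_def mult_ac)
    finally show "ennreal c * ennreal (1 / (1 + supn m) ^ (d + 1))
       = (\<integral>\<^sup>+(x :: real ^ 'n). ennreal (B powr (- q) * (1 / (1 + supn m) ^ (d + 1))) * indicator half_cube x \<partial>lborel)" by simp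
  qed
  also have "\<dots> \<le> (\<integral>\<^sup>+m. (\<integral>\<^sup>+(x :: real ^ 'n). ennreal ((1 + (norm (x + lattice m))\<^sup>2) powr (- q)) * indicator half_cube x \<partial>lborel) \<partial>count_space (UNIV :: (int ^ 'n) set))"
    by (intro nn_integral_mono) (use lower in \<open>auto simp: indicator_def\<close>)
  also have "\<dots> = (\<integral>\<^sup>+(x :: real ^ 'n). ennreal ((1 + (norm x)\<^sup>2) powr (- q)) \<partial>lborel)"
    by (rule nn_integral_lborel_tiling[symmetric]) measurable
  also have "\<dots> < \<infinity>"
    by (rule nn_integral_decay) (simp add: q_def d_def)
  finally have "ennreal c * weight_sum TYPE('n) < \<infinity>"
    by (simp add: nn_integral_cmult weight_sum_def d_def)
  then show ?thesis using c by (auto simp: ennreal_mult_less_top ennreal_eq_0_iff less_top)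
qed

text \<open>The antiderivative is -1 / (1 + \<tau> L). For L > 0 the integral is exactly 1 whatever
  L is, by scaling; this is the uniformity in frequency on which the estimate rests.\<close>

lemma nn_integral_time_kernel:
  assumes "L \<ge> 0"
  shows "(\<integral>\<^sup>+\<tau>. ennreal (L / (1 + \<tau> * L)\<^sup>2) * indicator {0..} \<tau> \<partial>lborel) \<le> 1"
proof (cases "L = 0")
  case False
  then have L: "L > 0" using assms by simp
  have pos: "1 + \<tau> * L > 0" if "\<tau> \<ge> 0" for \<tau> using that L by (simp add: add_pos_nonneg)
  have "(\<integral>\<^sup>+\<tau>. ennreal (L / (1 + \<tau> * L)\<^sup>2) * indicator {0..} \<tau> \<partial>lborel) = ennreal (0 - (- 1 / (1 + 0 * L)))"
  proof (rule nn_integral_FTC_atLeast)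
    show "((\<lambda>\<tau>. - 1 / (1 + \<tau> * L)) has_real_derivative L / (1 + \<tau> * L)\<^sup>2) (at \<tau>)" if "0 \<le> \<tau>" for \<tau>
      using pos[OF that] by (auto intro!: derivative_eq_intros simp: power2_eq_square)
    have "filterlim (\<lambda>\<tau>. 1 + \<tau> * L) at_top at_top"
      using L by (intro filterlim_tendsto_add_at_top[OF tendsto_const] filterlim_at_top_mult_tendsto_pos[OF tendsto_const] filterlim_ident)
    then show "((\<lambda>\<tau>. - 1 / (1 + \<tau> * L)) \<longlongrightarrow> 0) at_top"
      by (rule tendsto_divide_0[OF tendsto_const filterlim_at_top_imp_at_infinity])
  qed (use L in auto)
  then show ?thesis by simp
qed simp

text \<open>Extended by zero off 0 < s < t, so that the Schur test runs over the whole line and its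
  constant does not involve T.\<close>

definition time_kernel :: "real \<Rightarrow> real \<Rightarrow> real \<Rightarrow> real" where
  "time_kernel L t s = (if 0 < s \<and> s < t then L / (1 + (t - s) * L)\<^sup>2 else 0)"

lemma time_kernel_nonneg: "L \<ge> 0 \<Longrightarrow> time_kernel L t s \<ge> 0"
  by (simp add: time_kernel_def)

lemma measurable_time_kernel [measurable]:
  "(\<lambda>z. time_kernel L (fst z) (snd z)) \<in> borel_measurable (borel \<Otimes>\<^sub>M borel)"
  unfolding time_kernel_def by measurable

text \<open>The kernel lies below a function of t - s alone, so both marginal integrals reduce to
  \<open>nn_integral_time_kernel\<close> by an affine substitution.\<close>

lemma time_kernel_Schur:
  fixes h :: "real \<Rightarrow> ennreal"
  assumes L: "L \<ge> 0" and h [measurable]: "h \<in> borel_measurable borel"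
  shows "(\<integral>\<^sup>+t. (\<integral>\<^sup>+s. time_kernel L t s * h s \<partial>lborel)\<^sup>2 \<partial>lborel) \<le> (\<integral>\<^sup>+s. (h s)\<^sup>2 \<partial>lborel)"
proof -
  let ?g = "\<lambda>\<tau>. ennreal (L / (1 + \<tau> * L)\<^sup>2) * indicator {0..} \<tau>"
  have [measurable]: "?g \<in> borel_measurable borel" by measurable
  have le: "ennreal (time_kernel L t s) \<le> ?g (t - s)" for t s
    using L by (auto simp: time_kernel_def indicator_def)
  have "(\<integral>\<^sup>+t. (\<integral>\<^sup>+s. time_kernel L t s * h s \<partial>lborel)\<^sup>2 \<partial>lborel) \<le> 1 * 1 * (\<integral>\<^sup>+s. (h s)\<^sup>2 \<partial>lborel)"
  proof (rule Schur_test)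
    show "pair_sigma_finite lborel (lborel :: real measure)" ..
    show "(\<integral>\<^sup>+s. time_kernel L t s \<partial>lborel) \<le> 1" for t
    proof -
      have "(\<integral>\<^sup>+s. time_kernel L t s \<partial>lborel) \<le> (\<integral>\<^sup>+s. ?g (t + (- 1) * s) \<partial>lborel)"
        by (intro nn_integral_mono) (use le in auto)
      also have "\<dots> = (\<integral>\<^sup>+\<tau>. ?g \<tau> \<partial>lborel)"
        using nn_integral_real_affine[of ?g "-1" t] by simp
      also have "\<dots> \<le> 1" by (rule nn_integral_time_kernel[OF L])
      finally show ?thesis .
    qed
    show "(\<integral>\<^sup>+t. time_kernel L t s \<partial>lborel) \<le> 1" for s
    proof -
      have "(\<integral>\<^sup>+t. time_kernel L t s \<partial>lborel) \<le> (\<integral>\<^sup>+t. ?g (- s + 1 * t) \<partial>lborel)"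
        by (intro nn_integral_mono) (use le in auto)
      also have "\<dots> = (\<integral>\<^sup>+\<tau>. ?g \<tau> \<partial>lborel)"
        using nn_integral_real_affine[of ?g "1" "- s"] by simp
      also have "\<dots> \<le> 1" by (rule nn_integral_time_kernel[OF L])
      finally show ?thesis .
    qed
    show "(\<lambda>z. time_kernel L (fst z) (snd z)) \<in> borel_measurable (lborel \<Otimes>\<^sub>M lborel)" by measurable
  qed (use L in \<open>auto simp: time_kernel_nonneg\<close>)
  then show ?thesis by simp
qed

lemma weight_Schur:
  fixes V :: "int ^ 'n \<Rightarrow> ennreal"
  shows "(\<integral>\<^sup>+k. (\<integral>\<^sup>+l. ennreal (1 / (1 + supn (k - l)) ^ (CARD('n) + 1)) * V l \<partial>count_space UNIV)\<^sup>2 \<partial>count_space UNIV)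
     \<le> weight_sum TYPE('n) * weight_sum TYPE('n) * (\<integral>\<^sup>+l. (V l)\<^sup>2 \<partial>count_space UNIV)"
proof (rule Schur_test)
  show "pair_sigma_finite (count_space (UNIV :: (int ^ 'n) set)) (count_space (UNIV :: (int ^ 'n) set))"
    by (intro pair_sigma_finite.intro sigma_finite_measure_count_space_countable countableI_type)
  show "(\<lambda>z. 1 / (1 + supn (fst z - snd z)) ^ (CARD('n) + 1)) \<in> borel_measurable (count_space (UNIV :: (int ^ 'n) set) \<Otimes>\<^sub>M count_space (UNIV :: (int ^ 'n) set))"
    by (simp add: pair_measure_countable)
  have "bij (\<lambda>l. k - l)" "bij (\<lambda>l. l - k)" for k :: "int ^ 'n"
    by (rule bij_betw_byWitness[where f' = "\<lambda>l. k - l"] bij_betw_byWitness[where f' = "\<lambda>l. l + k"]; auto)+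
  note bij = this
  show "(\<integral>\<^sup>+l. ennreal (1 / (1 + supn (k - l)) ^ (CARD('n) + 1)) \<partial>count_space UNIV) \<le> weight_sum TYPE('n)" for k :: "int ^ 'n"
    using nn_integral_bij_count_space[OF bij(1), of "\<lambda>m. ennreal (1 / (1 + supn m) ^ (CARD('n) + 1))"]
    unfolding weight_sum_def by simp
  show "(\<integral>\<^sup>+k. ennreal (1 / (1 + supn (k - l)) ^ (CARD('n) + 1)) \<partial>count_space UNIV) \<le> weight_sum TYPE('n)" for l :: "int ^ 'n"
    using nn_integral_bij_count_space[OF bij(2), of "\<lambda>m. ennreal (1 / (1 + supn m) ^ (CARD('n) + 1))"]
    unfolding weight_sum_def by simp
qed (auto intro!: divide_nonneg_nonneg zero_le_power add_nonneg_nonneg mult_nonneg_nonneg supn_nonneg)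

section \<open>Fourier expansion of the averages\<close>

lemma one_plus_norm_sq_nonzero [simp]: "1 + (norm v)\<^sup>2 \<noteq> 0"
  using one_plus_norm_sq_pos[of v] by linarith

text \<open>Serves only to prove convergence of integrals; the constant of the final estimate comes
  from \<open>decay_const\<close>.\<close>

definition decay_mass :: "'n::finite itself \<Rightarrow> real \<Rightarrow> ennreal" where
  "decay_mass _ \<sigma> = (\<integral>\<^sup>+v. ennreal ((1 + (norm v)\<^sup>2) powr (- \<sigma>)) \<partial>(lborel :: (real ^ 'n) measure))"

lemma mult_le_weighted_squares:
  fixes a b e :: real assumes "e > 0"
  shows "\<bar>a * b\<bar> \<le> e * a\<^sup>2 + b\<^sup>2 / e"
proof -
  have "\<bar>a\<bar> * \<bar>b\<bar> \<le> (e * \<bar>a\<bar>\<^sup>2 + \<bar>b\<bar>\<^sup>2 / e) / 2" by (rule weighted_AMGM[OF assms])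
  moreover have "0 \<le> e * a\<^sup>2 + b\<^sup>2 / e" using assms by simp
  ultimately show ?thesis by (simp add: abs_mult)
qed

text \<open>With c = \<eta> v, transport along the characteristic becomes an oscillation in v of
  frequency \<eta> l. This is where the phases of the kernel originate.\<close>

lemma fcoeff_translate:
  assumes m [measurable]: "g \<in> borel_measurable borel" and per: "periodic g"
  shows "fcoeff (\<lambda>y. g (y + c)) (- l) = cis (- char_phase l c) * (LINT y|torus. g y * fchar l y)"
proof -
  have "fcoeff (\<lambda>y. g (y + c)) (- l) = (LINT y|torus. g (y + c) * fchar l y)"
    by (simp add: fcoeff_def cnj_fchar)
  also have "\<dots> = (LINT y|torus. cis (- char_phase l c) * (g (y + c) * fchar l (y + c)))"
    by (intro Bochner_Integration.integral_cong refl)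
      (simp add: fchar_add fchar_def[of l c] mult_ac flip: mult.assoc[of "cis _" "cis _"], simp add: cis_mult)
  also have "\<dots> = cis (- char_phase l c) * (LINT y|torus. g (y + c) * fchar l (y + c))"
    by (rule integral_mult_right_zero)
  also have "(LINT y|torus. g (y + c) * fchar l (y + c)) = (LINT y|torus. g y * fchar l y)"
    by (rule integral_torus_translate[of "\<lambda>y. g y * fchar l y"])
      (use per periodic_fchar[of l] in \<open>auto simp: periodic_def\<close>)
  finally show ?thesis .
qed

context field_bound
begin

lemma twisted_div_eq:
  "twisted_div k w = (\<Sum>a\<in>UNIV. of_real (D a (Suc 0) a 0 w $ a) - \<i> * of_int (k $ a) * of_real (D a 0 a 0 w $ a))"
  by (simp add: twisted_div_def)

lemma continuous_on_twisted_div [continuous_intros]: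
  "continuous_on S h \<Longrightarrow> continuous_on S (\<lambda>x. twisted_div k (h x))"
  unfolding twisted_div_eq by (intro continuous_intros)

definition mode :: "int ^ 'n \<Rightarrow> 'n phase \<Rightarrow> complex" where
  "mode k w = cnj (fchar k (fst w)) * twisted_div k w"

lemma continuous_on_mode [continuous_intros]:
  "continuous_on S h \<Longrightarrow> continuous_on S (\<lambda>x. mode k (h x))"
  unfolding mode_def by (intro continuous_intros)

lemma measurable_mode [measurable]: "mode k \<in> borel_measurable borel"
  by (intro borel_measurable_continuous_onI continuous_intros)

lemma periodic_mode: "periodic (\<lambda>y. mode k (y, v))"
  using periodic_D periodic_fchar[of k] unfolding mode_def twisted_div_eq
  by (simp add: periodic_def periodic_fst_def del: D_0 D_1)

lemma periodic_mode_shift: "periodic (\<lambda>y. mode k (y + c, v))"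
  using periodic_mode[of k v] unfolding periodic_def by (metis add.assoc add.commute)

lemma continuous_mode_shift: "continuous_on UNIV (\<lambda>y. mode k (y + c, v))"
  by (intro continuous_intros)

definition mode_bound :: "int ^ 'n \<Rightarrow> real" where
  "mode_bound k = 4 * (1 + supn k)\<^sup>2 * (real CARD('n))\<^sup>2 * b\<^sup>2"

lemma norm_mode_le:
  "(cmod (mode k w))\<^sup>2 \<le> 2 * (1 + supn k)\<^sup>2 * real CARD('n) * (\<Sum>a\<in>UNIV. (norm (D a (Suc 0) a 0 w))\<^sup>2 + (norm (D a 0 a 0 w))\<^sup>2)"
proof -
  let ?X = "\<lambda>a. norm (D a (Suc 0) a 0 w)" and ?Y = "\<lambda>a. norm (D a 0 a 0 w)"
  let ?Z = "\<lambda>a. of_real (D a (Suc 0) a 0 w $ a) - \<i> * of_int (k $ a) * of_real (D a 0 a 0 w $ a)"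
  let ?M = "1 + supn k"
  have M: "?M \<ge> 1" using supn_nonneg[of k] by simp
  have "cmod (mode k w) = cmod (twisted_div k w)" by (simp add: mode_def norm_mult)
  also have "\<dots> \<le> (\<Sum>a\<in>UNIV. ?M * (?X a + ?Y a))"
    unfolding twisted_div_eq
  proof (rule order_trans[OF norm_sum], rule sum_mono)
    fix a
    have "cmod (?Z a)
        \<le> \<bar>D a (Suc 0) a 0 w $ a\<bar> + \<bar>of_int (k $ a)\<bar> * \<bar>D a 0 a 0 w $ a\<bar>"
      by (rule order_trans[OF norm_triangle_ineq4]) (simp add: norm_mult)
    also have "\<dots> \<le> ?M * ?X a + ?M * ?Y a"
    proof (rule add_mono)
      have "\<bar>D a (Suc 0) a 0 w $ a\<bar> \<le> 1 * ?X a" using component_le_norm_cart by simp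
      also have "\<dots> \<le> ?M * ?X a" using M by (intro mult_right_mono) auto
      finally show "\<bar>D a (Suc 0) a 0 w $ a\<bar> \<le> ?M * ?X a" .
      show "\<bar>of_int (k $ a)\<bar> * \<bar>D a 0 a 0 w $ a\<bar> \<le> ?M * ?Y a"
        using supn_ge[of k a] M component_le_norm_cart[of "D a 0 a 0 w" a] by (intro mult_mono) auto
    qed
    finally show "cmod (?Z a)
        \<le> ?M * (?X a + ?Y a)" by (simp add: algebra_simps)
  qed
  finally have "(cmod (mode k w))\<^sup>2 \<le> (\<Sum>a\<in>UNIV. ?M * (?X a + ?Y a))\<^sup>2"
    by (intro power_mono) auto
  also have "\<dots> \<le> (\<Sum>a\<in>UNIV. (?M * (?X a + ?Y a))\<^sup>2) * real CARD('n)"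
    by (rule sum_squared_le_sum_of_squares)
  also have "\<dots> \<le> (\<Sum>a\<in>UNIV. 2 * ?M\<^sup>2 * ((?X a)\<^sup>2 + (?Y a)\<^sup>2)) * real CARD('n)"
  proof (intro mult_right_mono sum_mono)
    fix a
    have "(x + y)\<^sup>2 \<le> 2 * (x\<^sup>2 + y\<^sup>2)" for x y :: real
      using sum_squares_bound[of x y] by (simp add: power2_sum)
    then show "(?M * (?X a + ?Y a))\<^sup>2 \<le> 2 * ?M\<^sup>2 * ((?X a)\<^sup>2 + (?Y a)\<^sup>2)"
      unfolding power_mult_distrib by (simp add: mult.assoc mult.left_commute[of 2] mult_left_mono del: D_0 D_1)
  qed simp
  also have "\<dots> = 2 * ?M\<^sup>2 * real CARD('n) * (\<Sum>a\<in>UNIV. (?X a)\<^sup>2 + (?Y a)\<^sup>2)"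
    unfolding sum_distrib_left[symmetric] by (simp only: mult_ac)
  finally show ?thesis .
qed

lemma mode_L2:
  assumes p: "p \<ge> 1"
  shows "(\<integral>\<^sup>+w. ennreal ((1 + (norm (snd w))\<^sup>2) powr \<sigma> * (cmod (mode k w))\<^sup>2) \<partial>TV) \<le> ennreal (mode_bound k)"
proof -
  define C where "C = 2 * (1 + supn k)\<^sup>2 * real CARD('n)"
  have C: "C \<ge> 0" by (simp add: C_def)
  let ?W = "\<lambda>w :: 'n phase. (1 + (norm (snd w))\<^sup>2) powr \<sigma>"
  let ?S = "\<lambda>w. \<Sum>a\<in>UNIV. ennreal (?W w * (norm (D a (Suc 0) a 0 w))\<^sup>2) + ennreal (?W w * (norm (D a 0 a 0 w))\<^sup>2)"
  let ?I = "\<lambda>m a. \<integral>\<^sup>+w. ennreal (?W w * (norm (D a m a 0 w))\<^sup>2) \<partial>TV"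
  have [measurable]: "(\<lambda>w. norm (snd w)) \<in> borel_measurable (borel :: 'n phase measure)"
    by (intro borel_measurable_continuous_onI continuous_intros)
  have "(\<integral>\<^sup>+w. ennreal (?W w * (cmod (mode k w))\<^sup>2) \<partial>TV)
      \<le> (\<integral>\<^sup>+w. ennreal C * ?S w \<partial>TV)"
  proof (rule nn_integral_mono)
    fix w
    have "?W w * (cmod (mode k w))\<^sup>2 \<le> ?W w * (C * (\<Sum>a\<in>UNIV. (norm (D a (Suc 0) a 0 w))\<^sup>2 + (norm (D a 0 a 0 w))\<^sup>2))"
      unfolding C_def by (intro mult_left_mono norm_mode_le) simp
    also have "\<dots> = C * (\<Sum>a\<in>UNIV. ?W w * (norm (D a (Suc 0) a 0 w))\<^sup>2 + ?W w * (norm (D a 0 a 0 w))\<^sup>2)"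
      by (simp add: sum_distrib_left algebra_simps del: D_0 D_1)
    finally have "ennreal (?W w * (cmod (mode k w))\<^sup>2) \<le> ennreal \<dots>" by (rule ennreal_leI)
    also have "\<dots> = ennreal C * ?S w"
      by (simp add: ennreal_mult'[OF C] sum_nonneg flip: ennreal_plus sum_ennreal)
    finally show "ennreal (?W w * (cmod (mode k w))\<^sup>2) \<le> ennreal C * ?S w" .
  qed
  also have "\<dots> = ennreal C * (\<Sum>a\<in>UNIV. ?I (Suc 0) a + ?I 0 a)"
    by (simp add: nn_integral_cmult nn_integral_sum nn_integral_add del: D_0 D_1)
  also have "\<dots> \<le> ennreal C * (\<Sum>a\<in>(UNIV :: 'n set). ennreal (b\<^sup>2) + ennreal (b\<^sup>2))"
    using p by (intro mult_left_mono sum_mono add_mono D_L2) auto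
  also have "(\<Sum>a\<in>(UNIV :: 'n set). ennreal (b\<^sup>2) + ennreal (b\<^sup>2)) = ennreal (real CARD('n) * (b\<^sup>2 + b\<^sup>2))"
  proof -
    have "(\<Sum>a\<in>(UNIV :: 'n set). ennreal (b\<^sup>2) + ennreal (b\<^sup>2)) = of_nat CARD('n) * (ennreal (b\<^sup>2) + ennreal (b\<^sup>2))"
      by (rule sum_constant)
    also have "\<dots> = ennreal (real CARD('n)) * ennreal (b\<^sup>2 + b\<^sup>2)"
      by (simp only: ennreal_of_nat_eq_real_of_nat ennreal_plus[OF zero_le_power2 zero_le_power2])
    also have "\<dots> = ennreal (real CARD('n) * (b\<^sup>2 + b\<^sup>2))"
      by (rule ennreal_mult[symmetric]) auto
    finally show ?thesis .
  qed
  also have "ennreal C * \<dots> = ennreal (C * (real CARD('n) * (b\<^sup>2 + b\<^sup>2)))"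
    by (simp add: ennreal_mult'[OF C])
  also have "C * (real CARD('n) * (b\<^sup>2 + b\<^sup>2)) = mode_bound k"
    by (simp add: mode_bound_def C_def power2_eq_square algebra_simps)
  finally show ?thesis .
qed

text \<open>For fixed v the displacement is a translation in the torus variable, and the weight
  depends on v alone.\<close>

lemma nn_integral_mode_shift:
  "(\<integral>\<^sup>+v. \<integral>\<^sup>+y. ennreal ((1 + (norm v)\<^sup>2) powr \<sigma> * (cmod (mode k (y + \<eta> *\<^sub>R v, v)))\<^sup>2) \<partial>torus \<partial>lborel)
   = (\<integral>\<^sup>+w. ennreal ((1 + (norm (snd w))\<^sup>2) powr \<sigma> * (cmod (mode k w))\<^sup>2) \<partial>TV)"
proof -
  have "(\<integral>\<^sup>+v. \<integral>\<^sup>+y. ennreal ((1 + (norm v)\<^sup>2) powr \<sigma> * (cmod (mode k (y + \<eta> *\<^sub>R v, v)))\<^sup>2) \<partial>torus \<partial>lborel)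
      = (\<integral>\<^sup>+v. \<integral>\<^sup>+y. ennreal ((1 + (norm v)\<^sup>2) powr \<sigma> * (cmod (mode k (y, v)))\<^sup>2) \<partial>torus \<partial>lborel)"
  proof (rule nn_integral_cong)
    fix v :: "real ^ 'n"
    have "(\<lambda>y. mode k (y, v)) \<in> borel_measurable borel"
      by (intro borel_measurable_continuous_onI continuous_intros)
    then show "(\<integral>\<^sup>+y. ennreal ((1 + (norm v)\<^sup>2) powr \<sigma> * (cmod (mode k (y + \<eta> *\<^sub>R v, v)))\<^sup>2) \<partial>torus)
        = (\<integral>\<^sup>+y. ennreal ((1 + (norm v)\<^sup>2) powr \<sigma> * (cmod (mode k (y, v)))\<^sup>2) \<partial>torus)"
      using periodic_mode[of k v]
      by (intro nn_integral_torus_translate[where f = "\<lambda>y. ennreal ((1 + (norm v)\<^sup>2) powr \<sigma> * (cmod (mode k (y, v)))\<^sup>2)"])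
        (auto simp: periodic_def)
  qed
  also have "\<dots> = (\<integral>\<^sup>+w. ennreal ((1 + (norm (snd w))\<^sup>2) powr \<sigma> * (cmod (mode k w))\<^sup>2) \<partial>TV)"
  proof (subst nn_integral_TV(2))
    have [measurable]: "(\<lambda>w. norm (snd w)) \<in> borel_measurable (borel :: 'n phase measure)"
      by (intro borel_measurable_continuous_onI continuous_intros)
    show "(\<lambda>w. ennreal ((1 + (norm (snd w))\<^sup>2) powr \<sigma> * (cmod (mode k w))\<^sup>2)) \<in> borel_measurable borel"
      by measurable
  qed simp
  finally show ?thesis .
qed

lemma measurable_mode_shift:
  "(\<lambda>z. mode k (snd z + \<eta> *\<^sub>R fst z, fst z)) \<in> borel_measurable (lborel \<Otimes>\<^sub>M torus)"
proof -
  have "sets (lborel \<Otimes>\<^sub>M torus) = sets (borel :: 'n phase measure)"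
    by (metis borel_prod sets_lborel sets_pair_measure_cong sets_torus)
  moreover have "(\<lambda>z. mode k (snd z + \<eta> *\<^sub>R fst z, fst z)) \<in> borel_measurable borel"
    by (intro borel_measurable_continuous_onI continuous_intros)
  ultimately show ?thesis by (simp cong: measurable_cong_sets)
qed

text \<open>Up to sign, the contribution of one instant to the k-th Fourier coefficient of an
  average: \<eta> = t - s in the free case and \<eta> = exp (t - s) - 1 with friction. The gradient
  already sits on the smooth factor, so u may be merely square integrable.\<close>

definition pairing :: "int ^ 'n \<Rightarrow> (real ^ 'n \<Rightarrow> real) \<Rightarrow> real \<Rightarrow> complex" where
  "pairing k u \<eta> = (LINT v|lborel. LINT y|torus. of_real (u y) * mode k (y + \<eta> *\<^sub>R v, v))"

text \<open>A crude bound for absolute convergence: the weighted arithmetic-geometric inequality,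
  with the reciprocal of the velocity weight on u, separates an integrable function of v times the
  energy of u from the weighted norm of the mode.\<close>

lemma nn_integral_pairing_le:
  assumes p: "p \<ge> 1" and [measurable]: "u \<in> borel_measurable borel"
  shows "(\<integral>\<^sup>+v. \<integral>\<^sup>+y. ennreal (cmod (of_real (u y) * mode k (y + \<eta> *\<^sub>R v, v))) \<partial>torus \<partial>lborel)
    \<le> decay_mass TYPE('n) \<sigma> * (\<integral>\<^sup>+y. ennreal ((u y)\<^sup>2) \<partial>torus) + ennreal (mode_bound k)"
proof -
  let ?W = "\<lambda>v :: real ^ 'n. (1 + (norm v)\<^sup>2) powr \<sigma>"
  have m [measurable]: "(\<lambda>y. mode k (y + c, v)) \<in> borel_measurable borel" for c v
    by (intro borel_measurable_continuous_onI continuous_intros)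
  have m2: "(\<lambda>z. ennreal (?W (fst z) * (cmod (mode k (snd z + \<eta> *\<^sub>R fst z, fst z)))\<^sup>2)) \<in> borel_measurable (lborel \<Otimes>\<^sub>M torus)"
    using measurable_mode_shift[of k \<eta>] by measurable
  have [measurable]: "(\<lambda>v. \<integral>\<^sup>+y. ennreal (?W v * (cmod (mode k (y + \<eta> *\<^sub>R v, v)))\<^sup>2) \<partial>torus) \<in> borel_measurable lborel"
    using torus.borel_measurable_nn_integral[of "\<lambda>v y. ennreal (?W v * (cmod (mode k (y + \<eta> *\<^sub>R v, v)))\<^sup>2)" lborel] m2
    by (simp add: case_prod_beta')
  have "(\<integral>\<^sup>+v. \<integral>\<^sup>+y. ennreal (cmod (of_real (u y) * mode k (y + \<eta> *\<^sub>R v, v))) \<partial>torus \<partial>lborel)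
      \<le> (\<integral>\<^sup>+v. \<integral>\<^sup>+y. ennreal (?W v powr (-1)) * ennreal ((u y)\<^sup>2) + ennreal (?W v * (cmod (mode k (y + \<eta> *\<^sub>R v, v)))\<^sup>2) \<partial>torus \<partial>lborel)"
  proof (intro nn_integral_mono)
    fix v y :: "real ^ 'n"
    let ?g = "cmod (mode k (y + \<eta> *\<^sub>R v, v))"
    have W: "?W v > 0" using one_plus_norm_sq_pos[of v] by simp
    have "cmod (of_real (u y) * mode k (y + \<eta> *\<^sub>R v, v)) = \<bar>u y * ?g\<bar>" by (simp add: norm_mult abs_mult)
    also have "\<dots> \<le> ?W v powr (-1) * (u y)\<^sup>2 + ?g\<^sup>2 / ?W v powr (-1)"
      using W by (intro mult_le_weighted_squares) simp
    also have "?g\<^sup>2 / ?W v powr (-1) = ?W v * ?g\<^sup>2" using W by (simp add: powr_minus field_simps)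
    finally show "ennreal (cmod (of_real (u y) * mode k (y + \<eta> *\<^sub>R v, v)))
        \<le> ennreal (?W v powr (-1)) * ennreal ((u y)\<^sup>2) + ennreal (?W v * ?g\<^sup>2)"
      by (simp add: ennreal_leI flip: ennreal_mult ennreal_plus)
  qed
  also have "\<dots> = (\<integral>\<^sup>+v. ennreal (?W v powr (-1)) * (\<integral>\<^sup>+y. ennreal ((u y)\<^sup>2) \<partial>torus) + (\<integral>\<^sup>+y. ennreal (?W v * (cmod (mode k (y + \<eta> *\<^sub>R v, v)))\<^sup>2) \<partial>torus) \<partial>lborel)"
    by (intro nn_integral_cong) (subst nn_integral_add, auto simp: nn_integral_cmult)
  also have "\<dots> = (\<integral>\<^sup>+v. ennreal (?W v powr (-1)) * (\<integral>\<^sup>+y. ennreal ((u y)\<^sup>2) \<partial>torus) \<partial>lborel) + (\<integral>\<^sup>+v. \<integral>\<^sup>+y. ennreal (?W v * (cmod (mode k (y + \<eta> *\<^sub>R v, v)))\<^sup>2) \<partial>torus \<partial>lborel)"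
    by (rule nn_integral_add) measurable
  also have "(\<integral>\<^sup>+v. ennreal (?W v powr (-1)) * (\<integral>\<^sup>+y. ennreal ((u y)\<^sup>2) \<partial>torus) \<partial>lborel) = decay_mass TYPE('n) \<sigma> * (\<integral>\<^sup>+y. ennreal ((u y)\<^sup>2) \<partial>torus)"
    by (subst nn_integral_multc) (auto simp: powr_minus_divide decay_mass_def)
  also have "(\<integral>\<^sup>+v. \<integral>\<^sup>+y. ennreal (?W v * (cmod (mode k (y + \<eta> *\<^sub>R v, v)))\<^sup>2) \<partial>torus \<partial>lborel) \<le> ennreal (mode_bound k)"
    unfolding nn_integral_mode_shift by (rule mode_L2[OF p])
  finally show ?thesis by (simp add: add_left_mono)
qed

lemma decay_mass_finite: "decay_mass TYPE('n) \<sigma> < \<infinity>"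
  unfolding decay_mass_def using sigma by (intro nn_integral_decay) simp

lemma pairing_limit:
  fixes k :: "int ^ 'n" and \<eta> :: real
  assumes p: "p \<ge> 1" and u [measurable]: "u \<in> borel_measurable borel"
    and U: "(\<integral>\<^sup>+y. ennreal ((u y)\<^sup>2) \<partial>torus) < \<infinity>"
  defines "F \<equiv> \<lambda>l w. cis (- (\<eta> * char_phase l (snd w))) * fchar (l - k) (fst w) * twisted_div k w"
  shows "\<And>l. integrable TV (F l)"
    and "(\<lambda>n. \<Sum>l\<in>freq_box n. fcoeff (\<lambda>y. of_real (u y)) l * (LINT w|TV. F l w)) \<longlonglongrightarrow> pairing k u \<eta>"
proof -
  let ?u = "\<lambda>y. complex_of_real (u y)"
  have sq: "sq_integrable ?u"
    unfolding sq_integrable_def using U by (auto simp: integrable_iff_bounded)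
  define g where "g v y = mode k (y + \<eta> *\<^sub>R v, v)" for v y
  show intF: "integrable TV (F l)" for l
  proof -
    let ?E = "\<lambda>w. cis (- (\<eta> * char_phase l (snd w))) * fchar (l - k) (fst w)"
    have mE: "?E \<in> borel_measurable (borel :: 'n phase measure)"
      by (intro borel_measurable_continuous_onI continuous_intros)
    have bd: "cmod (?E w) \<le> 1 * (1 + norm (snd w))" for w
      by (simp add: norm_mult)
    have i1: "integrable TV (\<lambda>w. ?E w * of_real (D a (Suc 0) a 0 w $ a))" for a
      using p by (intro D_integral(1)[OF _ mE bd]) auto
    have i0: "integrable TV (\<lambda>w. ?E w * of_real (D a 0 a 0 w $ a))" for a
      using p by (intro D_integral(1)[OF _ mE bd]) auto
    have "F l = (\<lambda>w. \<Sum>a\<in>UNIV. ?E w * of_real (D a (Suc 0) a 0 w $ a)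
        - \<i> * of_int (k $ a) * (?E w * of_real (D a 0 a 0 w $ a)))"
      unfolding F_def twisted_div_eq sum_distrib_left
      by (intro ext sum.cong refl) (simp add: algebra_simps del: D_0 D_1)
    then show ?thesis
      by (simp only:) (intro Bochner_Integration.integrable_sum Bochner_Integration.integrable_diff i1 integrable_mult_right i0)
  qed
  \<comment> \<open>The coefficient of the shifted mode is the y-integral of F, phase included; the
    v-integral thus completes an integral over phase space.\<close>
  have coeff: "fcoeff (g v) (- l) = (LINT y|torus. F l (y, v))" for v l
  proof -
    have m: "(\<lambda>y. mode k (y, v)) \<in> borel_measurable borel"
      by (intro borel_measurable_continuous_onI continuous_intros)
    have "fcoeff (g v) (- l) = cis (- char_phase l (\<eta> *\<^sub>R v)) * (LINT y|torus. mode k (y, v) * fchar l y)"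
      unfolding g_def by (rule fcoeff_translate[OF m periodic_mode])
    also have "\<dots> = (LINT y|torus. cis (- char_phase l (\<eta> *\<^sub>R v)) * (mode k (y, v) * fchar l y))"
      by (rule integral_mult_right_zero[symmetric])
    also have "\<dots> = (LINT y|torus. F l (y, v))"
      by (intro Bochner_Integration.integral_cong refl)
        (simp add: F_def mode_def char_phase_scaleR cnj_fchar diff_conv_add_uminus fchar_index_add mult_ac del: add_uminus_conv_diff)
    finally show ?thesis .
  qed
  have int_coeff: "integrable lborel (\<lambda>v. fcoeff (g v) (- l))" for l
    unfolding coeff using TV.integrable_snd[of "\<lambda>x v. F l (x, v)"] intF[of l] by (simp add: TV_def case_prod_beta')
  have sqg: "sq_integrable (g v)" for v
    unfolding g_def by (rule sq_integrable_periodic[OF periodic_mode_shift continuous_mode_shift])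
  define W where "W v = (1 + (norm v)\<^sup>2) powr \<sigma>" for v :: "real ^ 'n"
  have W: "W v > 0" for v using one_plus_norm_sq_pos[of v] by (simp add: W_def)
  have [measurable]: "W \<in> borel_measurable borel" unfolding W_def by measurable
  define N where "N v = (LINT y|torus. (cmod (g v y))\<^sup>2)" for v
  define R where "R = (LINT y|torus. (cmod (?u y))\<^sup>2)"
  \<comment> \<open>The dominating function: weighted arithmetic-geometric inequality termwise, then
    Bessel for u and for the mode. It is independent of n, and integrable because both the
    reciprocal weight and the weighted norm of the mode are.\<close>
  define w where "w v = inverse (W v) * R + N v * W v" for v
  have [measurable]: "N \<in> borel_measurable lborel"
    unfolding N_def using measurable_mode_shift[of k \<eta>]
      torus.borel_measurable_lebesgue_integral[of "\<lambda>v y. (cmod (g v y))\<^sup>2" lborel]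
    by (simp add: g_def case_prod_beta')
  have intN: "integrable lborel (\<lambda>v. N v * W v)"
  proof (rule integrableI_bounded)
    have "ennreal (norm (N v * W v)) = (\<integral>\<^sup>+y. ennreal ((1 + (norm v)\<^sup>2) powr \<sigma> * (cmod (mode k (y + \<eta> *\<^sub>R v, v)))\<^sup>2) \<partial>torus)" for v
    proof -
      have "(\<integral>\<^sup>+y. ennreal (W v * (cmod (g v y))\<^sup>2) \<partial>torus) = ennreal (LINT y|torus. W v * (cmod (g v y))\<^sup>2)"
        using sqg[of v] W[of v] by (intro nn_integral_eq_integral) (auto simp: sq_integrable_def intro!: integrable_mult_right)
      also have "(LINT y|torus. W v * (cmod (g v y))\<^sup>2) = norm (N v * W v)"
        using W[of v] by (simp add: N_def abs_mult)
      finally show ?thesis by (simp add: W_def g_def)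
    qed
    then show "(\<integral>\<^sup>+v. ennreal (norm (N v * W v)) \<partial>lborel) < \<infinity>"
      using mode_L2[OF p, of k] by (simp add: nn_integral_mode_shift le_less_trans)
  qed measurable
  have intW: "integrable lborel (\<lambda>v. inverse (W v))"
  proof (rule integrableI_bounded)
    have "ennreal (norm (inverse (W v))) = ennreal ((1 + (norm v)\<^sup>2) powr (- \<sigma>))" for v
      using W[of v] by (simp add: W_def powr_minus)
    then show "(\<integral>\<^sup>+v. ennreal (norm (inverse (W v))) \<partial>lborel) < \<infinity>"
      using decay_mass_finite by (simp add: decay_mass_def)
  qed measurable
  have "(\<lambda>n. LINT v|lborel. (\<Sum>l\<in>freq_box n. fcoeff ?u l * fcoeff (g v) (- l))) \<longlonglongrightarrow> (LINT v|lborel. LINT y|torus. ?u y * g v y)"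
  proof (rule integral_dominated_convergence[where w = w])
    show "integrable lborel w"
      unfolding w_def using intN intW by simp
    show "AE v in lborel. (\<lambda>n. \<Sum>l\<in>freq_box n. fcoeff ?u l * fcoeff (g v) (- l)) \<longlonglongrightarrow> (LINT y|torus. ?u y * g v y)"
      unfolding g_def by (intro AE_I2 Parseval_limit sq periodic_mode_shift continuous_mode_shift)
    show "AE v in lborel. norm (\<Sum>l\<in>freq_box n. fcoeff ?u l * fcoeff (g v) (- l)) \<le> w v" for n
    proof (rule AE_I2)
      fix v
      have "norm (\<Sum>l\<in>freq_box n. fcoeff ?u l * fcoeff (g v) (- l))
          \<le> (\<Sum>l\<in>freq_box n. inverse (W v) * (cmod (fcoeff ?u l))\<^sup>2 + W v * (cmod (fcoeff (g v) (- l)))\<^sup>2)"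
      proof (rule order_trans[OF norm_sum], rule sum_mono)
        fix l :: "int ^ 'n"
        show "norm (fcoeff ?u l * fcoeff (g v) (- l)) \<le> inverse (W v) * (cmod (fcoeff ?u l))\<^sup>2 + W v * (cmod (fcoeff (g v) (- l)))\<^sup>2"
          using mult_le_weighted_squares[of "inverse (W v)" "cmod (fcoeff ?u l)" "cmod (fcoeff (g v) (- l))"] W[of v]
          by (simp add: norm_mult field_simps)
      qed
      also have "\<dots> = inverse (W v) * (\<Sum>l\<in>freq_box n. (cmod (fcoeff ?u l))\<^sup>2) + W v * (\<Sum>l\<in>uminus ` freq_box n. (cmod (fcoeff (g v) l))\<^sup>2)"
        by (subst sum.reindex) (auto simp: sum.distrib sum_distrib_left inj_on_def)
      also have "\<dots> \<le> inverse (W v) * R + W v * N v"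
        unfolding R_def N_def using W[of v] by (intro add_mono mult_left_mono Bessel sq sqg) auto
      finally show "norm (\<Sum>l\<in>freq_box n. fcoeff ?u l * fcoeff (g v) (- l)) \<le> w v" by (simp add: w_def mult.commute)
    qed
    show "(\<lambda>v. LINT y|torus. ?u y * g v y) \<in> borel_measurable lborel"
      using measurable_mode_shift[of k \<eta>] torus.borel_measurable_lebesgue_integral[of "\<lambda>v y. ?u y * g v y" lborel]
      by (simp add: g_def case_prod_beta')
    show "(\<lambda>v. \<Sum>l\<in>freq_box n. fcoeff ?u l * fcoeff (g v) (- l)) \<in> borel_measurable lborel" for n
      using int_coeff by (intro borel_measurable_sum borel_measurable_times) auto
  qed
  moreover have "(LINT v|lborel. (\<Sum>l\<in>freq_box n. fcoeff ?u l * fcoeff (g v) (- l))) = (\<Sum>l\<in>freq_box n. fcoeff ?u l * (LINT w|TV. F l w))" for n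
  proof -
    have "(LINT v|lborel. (\<Sum>l\<in>freq_box n. fcoeff ?u l * fcoeff (g v) (- l))) = (\<Sum>l\<in>freq_box n. fcoeff ?u l * (LINT v|lborel. fcoeff (g v) (- l)))"
      using int_coeff by (subst Bochner_Integration.integral_sum) auto
    then show ?thesis unfolding coeff integral_TV_snd[OF intF] .
  qed
  ultimately show "(\<lambda>n. \<Sum>l\<in>freq_box n. fcoeff ?u l * (LINT w|TV. F l w)) \<longlonglongrightarrow> pairing k u \<eta>"
    by (simp add: pairing_def g_def)
qed

end

definition kernel_const :: "'n::finite itself \<Rightarrow> real \<Rightarrow> real" where
  "kernel_const _ \<sigma> = 2 ^ (CARD('n) + 2) * 16 * (real CARD('n) + 4) * real CARD('n) * (real CARD('n) + 1) * decay_const TYPE('n) \<sigma>"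

lemma kernel_const_nonneg: "kernel_const N \<sigma> \<ge> 0"
  by (simp add: kernel_const_def decay_const_nonneg)

context field_bound
begin

text \<open>The two limits of \<open>pairing_limit\<close> are subtracted before taking absolute
  values, so that \<open>kernel_bound\<close> applies termwise; the bound is uniform in the box and
  passes to the limit.\<close>

lemma pairing_diff_le:
  assumes p: "p \<ge> CARD('n) + 6" and u: "u \<in> borel_measurable borel"
    and U: "(\<integral>\<^sup>+y. ennreal ((u y)\<^sup>2) \<partial>torus) < \<infinity>" and \<tau>: "\<tau> > 0"
  shows "ennreal (sqrt (1 + (\<Sum>i\<in>UNIV. (of_int (k $ i))\<^sup>2)) * cmod (pairing k u \<tau> - pairing k u (exp \<tau> - 1)))
    \<le> (\<integral>\<^sup>+l. ennreal (kernel_const TYPE('n) \<sigma> * exp \<tau> * b * (1 / (1 + supn (k - l)) ^ (CARD('n) + 1)) * (supn l / (1 + \<tau> * supn l)\<^sup>2)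
        * cmod (fcoeff (\<lambda>y. of_real (u y)) l)) \<partial>count_space UNIV)"
proof -
  let ?\<theta> = "exp \<tau> - 1" and ?c = "fcoeff (\<lambda>y. of_real (u y))"
  let ?r = "sqrt (1 + (\<Sum>i\<in>UNIV. (of_int (k $ i))\<^sup>2))"
  let ?F = "\<lambda>\<eta> l w. cis (- (\<eta> * char_phase l (snd w))) * fchar (l - k) (fst w) * twisted_div k w"
  let ?B = "\<lambda>l. kernel_const TYPE('n) \<sigma> * exp \<tau> * b * (1 / (1 + supn (k - l)) ^ (CARD('n) + 1)) * (supn l / (1 + \<tau> * supn l)\<^sup>2) * cmod (?c l)"
  have p1: "p \<ge> 1" using p by simp
  note lim = pairing_limit[OF p1 u U, where k = k]
  have "(\<lambda>n. (\<Sum>l\<in>freq_box n. ?c l * (LINT w|TV. ?F \<tau> l w)) - (\<Sum>l\<in>freq_box n. ?c l * (LINT w|TV. ?F ?\<theta> l w)))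
      \<longlonglongrightarrow> pairing k u \<tau> - pairing k u ?\<theta>"
    by (intro tendsto_diff lim(2))
  moreover have "(\<Sum>l\<in>freq_box n. ?c l * (LINT w|TV. ?F \<tau> l w)) - (\<Sum>l\<in>freq_box n. ?c l * (LINT w|TV. ?F ?\<theta> l w))
      = (\<Sum>l\<in>freq_box n. ?c l * (LINT w|TV. ?F \<tau> l w - ?F ?\<theta> l w))" for n
    using lim(1) by (simp add: sum_subtractf right_diff_distrib)
  moreover have "?F \<tau> l w - ?F ?\<theta> l w = (cis (- (\<tau> * char_phase l (snd w))) - cis (- (?\<theta> * char_phase l (snd w)))) * fchar (l - k) (fst w) * twisted_div k w" for l w
    by (simp add: left_diff_distrib)
  ultimately have "(\<lambda>n. \<Sum>l\<in>freq_box n. ?c l * (LINT w|TV. (cis (- (\<tau> * char_phase l (snd w))) - cis (- (?\<theta> * char_phase l (snd w)))) * fchar (l - k) (fst w) * twisted_div k w))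
      \<longlonglongrightarrow> pairing k u \<tau> - pairing k u ?\<theta>" (is "(\<lambda>n. \<Sum>l\<in>freq_box n. ?c l * ?Q l) \<longlonglongrightarrow> _")
    by (simp only:)
  then have lim': "(\<lambda>n. ennreal (?r * cmod (\<Sum>l\<in>freq_box n. ?c l * ?Q l))) \<longlonglongrightarrow> ennreal (?r * cmod (pairing k u \<tau> - pairing k u ?\<theta>))"
    by (intro tendsto_ennrealI tendsto_mult tendsto_const tendsto_norm)
  have le: "ennreal (?r * cmod (\<Sum>l\<in>freq_box n. ?c l * ?Q l)) \<le> (\<integral>\<^sup>+l. ennreal (?B l) \<partial>count_space UNIV)" for n
  proof -
    have "?r * cmod (\<Sum>l\<in>freq_box n. ?c l * ?Q l) \<le> ?r * (\<Sum>l\<in>freq_box n. cmod (?c l * ?Q l))"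
      by (intro mult_left_mono norm_sum) (simp add: sum_nonneg)
    also have "\<dots> = (\<Sum>l\<in>freq_box n. (?r * cmod (?Q l)) * cmod (?c l))"
      by (simp only: sum_distrib_left norm_mult mult_ac)
    also have "\<dots> \<le> (\<Sum>l\<in>freq_box n. ?B l)"
    proof (intro sum_mono mult_right_mono)
      show "?r * cmod (?Q l) \<le> kernel_const TYPE('n) \<sigma> * exp \<tau> * b * (1 / (1 + supn (k - l)) ^ (CARD('n) + 1)) * (supn l / (1 + \<tau> * supn l)\<^sup>2)" for l
        unfolding kernel_const_def by (rule kernel_bound[OF p \<tau>])
    qed simp
    finally have "ennreal (?r * cmod (\<Sum>l\<in>freq_box n. ?c l * ?Q l)) \<le> ennreal (\<Sum>l\<in>freq_box n. ?B l)"
      by (rule ennreal_leI)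
    also have "\<dots> = (\<Sum>l\<in>freq_box n. ennreal (?B l))"
    proof (rule sum_ennreal[symmetric])
      show "?B l \<ge> 0" for l
        using \<tau> b_nonneg supn_nonneg[of l] supn_nonneg[of "k - l"] kernel_const_nonneg[of "TYPE('n)" \<sigma>]
        by (auto intro!: mult_nonneg_nonneg divide_nonneg_nonneg add_nonneg_nonneg)
    qed
    also have "\<dots> \<le> (\<integral>\<^sup>+l. ennreal (?B l) \<partial>count_space UNIV)"
      by (rule sum_le_nn_integral_count_space) simp
    finally show ?thesis .
  qed
  show ?thesis
    by (rule tendsto_upperbound[OF lim']) (use le in auto)
qed

end

section \<open>The averaging operators\<close>

text \<open>Holds unconditionally, since the Bochner integral of a non-integrable function is
  0.\<close>

lemma norm_integral_le_nn_integral: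
  fixes f :: "'a \<Rightarrow> 'b::{banach, second_countable_topology}"
  shows "ennreal (norm (LINT x|M. f x)) \<le> (\<integral>\<^sup>+x. ennreal (norm (f x)) \<partial>M)"
  by (cases "integrable M f") (auto simp: not_integrable_integral_eq intro: integral_norm_bound_ennreal)

text \<open>Cosine and sine test functions produce the real and the negated imaginary part of the
  divergence of exp(-i k.x) f, in agreement with the signs in \<open>fourier_coeff\<close>.\<close>

lemma divergence_char:
  fixes f :: "real ^ 'n \<Rightarrow> real ^ 'n \<Rightarrow> real ^ 'n"
  assumes f: "field_bound f p \<sigma> b"
  shows "divergence (\<lambda>y. cos (char_phase k (y + c)) *\<^sub>R f (y + c) v) y = Re (field_bound.mode f k (y + c, v))"
    and "divergence (\<lambda>y. sin (char_phase k (y + c)) *\<^sub>R f (y + c) v) y = - Im (field_bound.mode f k (y + c, v))"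
proof -
  interpret field_bound f p \<sigma> b by (rule f)
  let ?F = "frechet_derivative (\<lambda>w. f (fst w) (snd w)) (at (y + c, v))"
  let ?\<phi> = "char_phase k (y + c)"
  have "((\<lambda>y. (y + c, v)) has_derivative (\<lambda>h. (h, 0))) (at y)"
    by (auto intro!: derivative_eq_intros)
  from has_derivative_compose[OF this smooth2_has_derivative[OF smooth]]
  have df: "((\<lambda>y. f (y + c) v) has_derivative (\<lambda>h. ?F (h, 0))) (at y)" by simp
  have dphi: "((\<lambda>y. char_phase k (y + c)) has_derivative char_phase k) (at y)"
    unfolding char_phase_def by (auto intro!: derivative_eq_intros bounded_linear.has_derivative[OF bounded_linear_vec_nth])
  have dc: "((\<lambda>y. cos (char_phase k (y + c))) has_derivative (\<lambda>h. - sin ?\<phi> * char_phase k h)) (at y)"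
    using DERIV_compose_FDERIV[OF DERIV_cos dphi] by (simp add: mult.commute)
  have ds: "((\<lambda>y. sin (char_phase k (y + c))) has_derivative (\<lambda>h. cos ?\<phi> * char_phase k h)) (at y)"
    using DERIV_compose_FDERIV[OF DERIV_sin dphi] by (simp add: mult.commute)
  have F: "?F (axis i 1, 0) = dx i f (y + c) v" for i
    by (rule dx_eq_frechet[OF smooth, symmetric])
  have 1: "frechet_derivative (\<lambda>y. cos (char_phase k (y + c)) *\<^sub>R f (y + c) v) (at y)
      = (\<lambda>h. cos ?\<phi> *\<^sub>R ?F (h, 0) + (- sin ?\<phi> * char_phase k h) *\<^sub>R f (y + c) v)"
    using frechet_derivative_at[OF has_derivative_scaleR[OF dc df]] by simp
  have 2: "frechet_derivative (\<lambda>y. sin (char_phase k (y + c)) *\<^sub>R f (y + c) v) (at y)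
      = (\<lambda>h. sin ?\<phi> *\<^sub>R ?F (h, 0) + (cos ?\<phi> * char_phase k h) *\<^sub>R f (y + c) v)"
    using frechet_derivative_at[OF has_derivative_scaleR[OF ds df]] by simp
  define P where "P = (\<Sum>i\<in>UNIV. dx i f (y + c) v $ i)"
  define Q where "Q = (\<Sum>i\<in>UNIV. of_int (k $ i) * (f (y + c) v $ i))"
  have td: "twisted_div k (y + c, v) = Complex P (- Q)"
    by (simp add: twisted_div_def P_def Q_def complex_eq_iff sum_negf)
  show "divergence (\<lambda>y. cos (char_phase k (y + c)) *\<^sub>R f (y + c) v) y = Re (mode k (y + c, v))"
    unfolding divergence_def 1 mode_def td F
    by (simp add: fchar_def P_def Q_def sum.distrib sum_distrib_left sum_negf sum_subtractf mult_ac)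
  show "divergence (\<lambda>y. sin (char_phase k (y + c)) *\<^sub>R f (y + c) v) y = - Im (mode k (y + c, v))"
    unfolding divergence_def 2 mode_def td F
    by (simp add: fchar_def P_def Q_def sum.distrib sum_distrib_left sum_negf sum_subtractf mult_ac)
qed

lemma shift_grad_eq:
  "shift (- (\<eta> *\<^sub>R v)) (grad h) (\<lambda>x. \<psi> x *\<^sub>R g x) = - (LINT y|torus. h y * divergence (\<lambda>y. \<psi> (y + \<eta> *\<^sub>R v) *\<^sub>R g (y + \<eta> *\<^sub>R v)) y)"
  by (simp add: shift_def grad_def)

context field_bound
begin

text \<open>The functionals are defined on real test functions, the Fourier analysis is complex.
  Real and imaginary parts are exchanged with the two integrals by means of their integrability,
  which finite energy of u supplies.\<close>

lemma pairing_parts: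
  assumes p: "p \<ge> 1" and u [measurable]: "u \<in> borel_measurable borel"
    and U: "(\<integral>\<^sup>+y. ennreal ((u y)\<^sup>2) \<partial>torus) < \<infinity>"
  shows "(LINT v|lborel. - (LINT y|torus. u y * Re (mode k (y + \<eta> *\<^sub>R v, v)))) = - Re (pairing k u \<eta>)"
    and "(LINT v|lborel. - (LINT y|torus. u y * - Im (mode k (y + \<eta> *\<^sub>R v, v)))) = Im (pairing k u \<eta>)"
proof -
  let ?u = "\<lambda>y. complex_of_real (u y)"
  have sq: "sq_integrable ?u"
    unfolding sq_integrable_def using U by (auto simp: integrable_iff_bounded)
  have int: "integrable torus (\<lambda>y. ?u y * mode k (y + \<eta> *\<^sub>R v, v))" for v
    by (intro sq_integrable_mult sq sq_integrable_periodic periodic_mode_shift continuous_mode_shift)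
  have intv: "integrable lborel (\<lambda>v. LINT y|torus. ?u y * mode k (y + \<eta> *\<^sub>R v, v))"
  proof (rule integrableI_bounded)
    show "(\<lambda>v. LINT y|torus. ?u y * mode k (y + \<eta> *\<^sub>R v, v)) \<in> borel_measurable lborel"
      using measurable_mode_shift[of k \<eta>] torus.borel_measurable_lebesgue_integral[of "\<lambda>v y. ?u y * mode k (y + \<eta> *\<^sub>R v, v)" lborel]
      by (simp add: case_prod_beta')
    have "(\<integral>\<^sup>+v. ennreal (norm (LINT y|torus. ?u y * mode k (y + \<eta> *\<^sub>R v, v))) \<partial>lborel)
        \<le> (\<integral>\<^sup>+v. \<integral>\<^sup>+y. ennreal (cmod (?u y * mode k (y + \<eta> *\<^sub>R v, v))) \<partial>torus \<partial>lborel)"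
      by (rule nn_integral_mono) (rule norm_integral_le_nn_integral)
    also have "\<dots> \<le> decay_mass TYPE('n) \<sigma> * (\<integral>\<^sup>+y. ennreal ((u y)\<^sup>2) \<partial>torus) + ennreal (mode_bound k)"
      by (rule nn_integral_pairing_le[OF p u])
    also have "\<dots> < \<infinity>"
      using U decay_mass_finite by (simp add: ennreal_mult_less_top)
    finally show "(\<integral>\<^sup>+v. ennreal (norm (LINT y|torus. ?u y * mode k (y + \<eta> *\<^sub>R v, v))) \<partial>lborel) < \<infinity>" .
  qed
  have Re: "(LINT y|torus. u y * Re (mode k (y + \<eta> *\<^sub>R v, v))) = Re (LINT y|torus. ?u y * mode k (y + \<eta> *\<^sub>R v, v))" for v
    using integral_Re[OF int[of v]] by simp
  have Im: "(LINT y|torus. u y * - Im (mode k (y + \<eta> *\<^sub>R v, v))) = - Im (LINT y|torus. ?u y * mode k (y + \<eta> *\<^sub>R v, v))" for v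
    using integral_Im[OF int[of v]] by simp
  show "(LINT v|lborel. - (LINT y|torus. u y * Re (mode k (y + \<eta> *\<^sub>R v, v)))) = - Re (pairing k u \<eta>)"
    unfolding Re pairing_def using integral_Re[OF intv] by simp
  show "(LINT v|lborel. - (LINT y|torus. u y * - Im (mode k (y + \<eta> *\<^sub>R v, v)))) = Im (pairing k u \<eta>)"
    unfolding Im pairing_def using integral_Im[OF intv] by simp
qed

end

lemma Ck_on_Suc_0_imp:
  assumes "Ck_on (Suc 0) F U"
  shows "continuous_on U F" "\<And>x. x \<in> U \<Longrightarrow> F differentiable (at x)"
    "\<And>e. e \<in> Basis \<Longrightarrow> continuous_on U (\<lambda>x. frechet_derivative F (at x) e)"
  using assms Ck_on_imp_continuous_on[OF assms] by auto

section \<open>The source function and its energy\<close>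

locale source =
  fixes H :: "real \<Rightarrow> real ^ 'n \<Rightarrow> real" and T :: real
  assumes H: "in_L2_L2 T H"
begin

text \<open>Measurability of H is assumed on the open time interval only. The extension by zero is
  measurable everywhere and agrees with H at all times that enter the averages.\<close>

definition H' :: "real \<Rightarrow> real ^ 'n \<Rightarrow> real" where
  "H' s y = indicator {0<..<T} s * H s y"

lemma measurable_H': "(\<lambda>z. H' (fst z) (snd z)) \<in> borel_measurable (borel \<Otimes>\<^sub>M borel)"
proof -
  have "(\<lambda>z. indicator ({0<..<T} \<times> UNIV) z *\<^sub>R (case z of (t, x) \<Rightarrow> H t x)) \<in> borel_measurable borel"
    using H by (simp add: in_L2_L2_def set_borel_measurable_def)
  moreover have "(\<lambda>z. indicator ({0<..<T} \<times> UNIV) z *\<^sub>R (case z of (t, x) \<Rightarrow> H t x)) = (\<lambda>z. H' (fst z) (snd z))"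
    by (auto simp: H'_def indicator_def)
  ultimately show ?thesis by (simp add: borel_prod)
qed

lemma measurable_H'_slice [measurable]: "H' s \<in> borel_measurable borel"
  using measurable_Pair2[OF measurable_H', of s] by simp

definition energy :: "real \<Rightarrow> ennreal" where
  "energy s = (\<integral>\<^sup>+y. ennreal ((H' s y)\<^sup>2) \<partial>torus)"

lemma measurable_energy [measurable]: "energy \<in> borel_measurable borel"
proof -
  have "(\<lambda>z. ennreal ((H' (fst z) (snd z))\<^sup>2)) \<in> borel_measurable (borel \<Otimes>\<^sub>M torus)"
    using measurable_H' by measurable
  then show ?thesis
    using torus.borel_measurable_nn_integral[of "\<lambda>s y. ennreal ((H' s y)\<^sup>2)" borel]
    by (simp add: energy_def[abs_def] case_prod_beta')
qed

lemma energy_total: "(\<integral>\<^sup>+s. energy s \<partial>lborel) = (L2_L2_norm T H)\<^sup>2"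
  unfolding L2_L2_norm_def esqrt_power2 energy_def
  by (intro nn_integral_cong) (auto simp: H'_def indicator_def)

lemma energy_total_finite: "(\<integral>\<^sup>+s. energy s \<partial>lborel) < \<infinity>"
  unfolding energy_total using H by (simp add: in_L2_L2_def power2_eq_square ennreal_mult_less_top)

lemma AE_energy_finite: "AE s in lborel. energy s < \<infinity>"
  using nn_integral_PInf_AE[of energy lborel] energy_total_finite by (auto simp: less_top)

text \<open>Placed before any assumption on G: for vanishing H the inner integrals are 0 for almost
  every s, whatever the field is, even if its norm is infinite.\<close>

lemma K_eq_0:
  assumes zero: "L2_L2_norm T H = 0" and t: "t \<in> {0<..<T}"
  shows "K_free G H t \<psi> = 0" "K_fric G H t \<psi> = 0"
proof -
  have "(\<integral>\<^sup>+s. energy s \<partial>lborel) = 0" using zero by (simp add: energy_total)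
  then have E: "AE s in lborel. energy s = 0" by (subst (asm) nn_integral_0_iff_AE) auto
  have "AE s in lborel. indicator {0<..<t} s *\<^sub>R (LINT v|lborel. shift (a s v) (grad (H s)) (\<Phi> s v)) = (0 :: real)" for a \<Phi>
    using E
  proof eventually_elim
    case (elim s)
    show ?case
    proof (cases "s \<in> {0<..<t}")
      case True
      then have "H' s = H s" using t by (auto simp: H'_def)
      moreover have "AE y in torus. H' s y = 0"
        using elim unfolding energy_def by (subst (asm) nn_integral_0_iff_AE) auto
      ultimately have "(LINT y|torus. H s y * X y) = 0" for X :: "real ^ 'n \<Rightarrow> real"
        by (intro integral_eq_zero_AE) (auto elim: eventually_mono)
      then show ?thesis by (simp add: shift_def grad_def)
    qed simp
  qed
  then show "K_free G H t \<psi> = 0" "K_fric G H t \<psi> = 0"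
    unfolding K_free_def K_fric_def set_lebesgue_integral_def by (auto intro!: integral_eq_zero_AE)
qed

end

section \<open>The averages of a field with bounded norm\<close>

locale averaging = source H T
  for H :: "real \<Rightarrow> real ^ 'n \<Rightarrow> real" and T :: real +
  fixes G :: "real \<Rightarrow> real \<Rightarrow> real ^ 'n \<Rightarrow> real ^ 'n \<Rightarrow> real ^ 'n" and p :: nat and \<sigma> b :: real
  assumes p: "p \<ge> CARD('n) + 6" and sigma: "\<sigma> > 1 + real CARD('n) / 2"
    and smooth_G: "smooth_on (\<lambda>(t, s, x, v). G t s x v) ({0..T} \<times> {0..T} \<times> UNIV \<times> UNIV)"
    and periodic_G: "\<And>t s v. t \<in> {0..T} \<Longrightarrow> s \<in> {0..T} \<Longrightarrow> periodic (\<lambda>x. G t s x v)"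
    and b_nonneg: "b \<ge> 0"
    and norm_G: "\<And>t s. t \<in> {0..T} \<Longrightarrow> s \<in> {0..T} \<Longrightarrow> weighted_Sobolev_norm p \<sigma> (G t s) \<le> ennreal b"
begin

lemma field_bound_G:
  assumes "t \<in> {0..T}" "s \<in> {0..T}" shows "field_bound (G t s) p \<sigma> b"
proof
  obtain U where U: "{0..T} \<times> {0..T} \<times> UNIV \<times> UNIV \<subseteq> U" "\<And>k. Ck_on k (\<lambda>(t, s, x, v). G t s x v) U"
    using smooth_G by (auto simp: smooth_on_def)
  have "Ck_on k (\<lambda>w. (\<lambda>(t, s, x, v). G t s x v) (t, s, w)) UNIV" for k
    by (rule Ck_on_slice[OF U(2)]) (use assms U(1) in auto)
  then show "smooth2 (G t s)" by (simp add: smooth2_def case_prod_beta')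
  show "periodic2 (G t s)" using periodic_G[OF assms] by (simp add: periodic2_def)
qed (use sigma b_nonneg norm_G assms in auto)

abbreviation mode_G :: "real \<Rightarrow> int ^ 'n \<Rightarrow> real \<Rightarrow> 'n phase \<Rightarrow> complex" where
  "mode_G t k s \<equiv> field_bound.mode (G t s) k"

text \<open>Joint measurability in s, x and v, as required by the iterated integrals. It comes from
  joint continuity on 0 < s < t: the spatial derivatives of the slices are components of the
  derivative of G in all variables, which is continuous near the time square.\<close>

lemma measurable_mode_G:
  assumes t: "t \<in> {0..T}"
  shows "(\<lambda>z. indicator {0<..<t} (fst z) *\<^sub>R mode_G t k (fst z) (snd z)) \<in> borel_measurable borel"
proof -
  let ?F = "\<lambda>(t, s, x, v). G t s x v"
  obtain U where U: "{0..T} \<times> {0..T} \<times> UNIV \<times> UNIV \<subseteq> U" "\<And>k. Ck_on k ?F U"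
    using smooth_G by (auto simp: smooth_on_def)
  note C = Ck_on_Suc_0_imp[OF U(2)]
  let ?A = "{0<..<t} \<times> (UNIV :: 'n phase set)"
  have sub: "(t, z) \<in> U" if "z \<in> ?A" for z
    using that t U(1) by (cases z) auto
  have c0: "continuous_on ?A (\<lambda>z. G t (fst z) (fst (snd z)) (snd (snd z)))"
    using continuous_on_compose2[OF C(1), of ?A "\<lambda>z. (t, z)"] sub
    by (force intro!: continuous_intros simp: case_prod_beta')
  have d: "dx a (G t (fst z)) (fst (snd z)) (snd (snd z)) = frechet_derivative ?F (at (t, z)) (0, 0, (axis a 1, 0))"
    if z: "z \<in> ?A" for z a
  proof -
    obtain s w where sw: "z = (s, w)" by (cases z)
    have s: "s \<in> {0..T}" using z t by (auto simp: sw)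
    interpret field_bound "G t s" p \<sigma> b by (rule field_bound_G[OF t s])
    have "(?F has_derivative frechet_derivative ?F (at (t, s, w))) (at (t, s, w))"
      using C(2)[OF sub[OF z]] by (simp add: frechet_derivative_works sw)
    moreover have "((\<lambda>w. (t, s, w)) has_derivative (\<lambda>h. (0, 0, h))) (at w)"
      by (auto intro!: derivative_eq_intros)
    ultimately have "((\<lambda>w. ?F (t, s, w)) has_derivative (\<lambda>h. frechet_derivative ?F (at (t, s, w)) (0, 0, h))) (at w)"
      by (rule has_derivative_compose[rotated])
    from frechet_derivative_at[OF this]
    have "frechet_derivative (\<lambda>w. G t s (fst w) (snd w)) (at w) = (\<lambda>h. frechet_derivative ?F (at (t, s, w)) (0, 0, h))"
      by (simp add: case_prod_beta')
    then show ?thesis using dx_eq_frechet[OF smooth, of a "fst w" "snd w"] by (simp add: sw)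
  qed
  have c1: "continuous_on ?A (\<lambda>z. dx a (G t (fst z)) (fst (snd z)) (snd (snd z)))" for a
  proof -
    have "(0, 0, (axis a 1, 0)) \<in> (Basis :: (real \<times> real \<times> 'n phase) set)"
      by (auto simp: Basis_prod_def axis_in_Basis_iff)
    from continuous_on_compose2[OF C(3)[OF this], of ?A "\<lambda>z. (t, z)"] sub
    have "continuous_on ?A (\<lambda>z. frechet_derivative ?F (at (t, z)) (0, 0, (axis a 1, 0)))"
      by (force intro!: continuous_intros)
    then show ?thesis by (rule continuous_on_eq) (use d in auto)
  qed
  have "continuous_on ?A (\<lambda>z. cnj (fchar k (fst (snd z))) * (\<Sum>a\<in>UNIV. of_real (dx a (G t (fst z)) (fst (snd z)) (snd (snd z)) $ a)
      - \<i> * of_int (k $ a) * of_real (G t (fst z) (fst (snd z)) (snd (snd z)) $ a)))"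
    by (intro continuous_intros c0 c1)
  then have "continuous_on ?A (\<lambda>z. mode_G t k (fst z) (snd z))"
  proof (rule continuous_on_eq)
    fix z assume z: "z \<in> ?A"
    then interpret field_bound "G t (fst z)" p \<sigma> b using t by (intro field_bound_G) auto
    show "cnj (fchar k (fst (snd z))) * (\<Sum>a\<in>UNIV. of_real (dx a (G t (fst z)) (fst (snd z)) (snd (snd z)) $ a)
      - \<i> * of_int (k $ a) * of_real (G t (fst z) (fst (snd z)) (snd (snd z)) $ a)) = mode_G t k (fst z) (snd z)"
      by (simp add: mode_def twisted_div_def)
  qed
  moreover have "?A \<in> sets borel" by (intro borel_open open_Times) auto
  ultimately have "(\<lambda>z. indicator ?A z *\<^sub>R mode_G t k (fst z) (snd z)) \<in> borel_measurable borel"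
    by (intro borel_measurable_continuous_on_indicator)
  moreover have "indicator ?A z = (indicator {0<..<t} (fst z) :: real)" for z
    by (cases z) (simp add: indicator_def)
  ultimately show ?thesis by simp
qed

text \<open>The displacement is a parameter, so that one set of lemmas serves both
  operators.\<close>

definition avg :: "real \<Rightarrow> int ^ 'n \<Rightarrow> (real \<Rightarrow> real) \<Rightarrow> real \<Rightarrow> complex" where
  "avg t k \<eta> s = indicator {0<..<t} s *\<^sub>R field_bound.pairing (G t s) k (H' s) (\<eta> s)"

lemma measurable_double_integral:
  fixes Z :: "real \<Rightarrow> real ^ 'n \<Rightarrow> real ^ 'n \<Rightarrow> 'b::{banach, second_countable_topology}"
  assumes "(\<lambda>q. Z (fst (fst q)) (snd (fst q)) (snd q)) \<in> borel_measurable ((borel \<Otimes>\<^sub>M borel) \<Otimes>\<^sub>M torus)"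
  shows "(\<lambda>s. LINT v|lborel. LINT y|torus. Z s v y) \<in> borel_measurable lborel"
proof -
  from torus.borel_measurable_lebesgue_integral[of "\<lambda>r y. Z (fst r) (snd r) y" "borel \<Otimes>\<^sub>M borel"] assms
  have "(\<lambda>r. LINT y|torus. Z (fst r) (snd r) y) \<in> borel_measurable (borel \<Otimes>\<^sub>M lborel)"
    by (simp add: case_prod_beta' cong: measurable_cong_sets)
  from lborel.borel_measurable_lebesgue_integral[of "\<lambda>s v. LINT y|torus. Z s v y" borel] this
  show ?thesis by (simp add: case_prod_beta')
qed

lemma measurable_mode_G_shift:
  assumes t: "t \<in> {0..T}" and \<eta>: "continuous_on UNIV \<eta>"
  shows "(\<lambda>q. indicator {0<..<t} (fst (fst q)) *\<^sub>R mode_G t k (fst (fst q)) (snd q + \<eta> (fst (fst q)) *\<^sub>R snd (fst q), snd (fst q)))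
    \<in> borel_measurable ((borel \<Otimes>\<^sub>M borel) \<Otimes>\<^sub>M torus)"
proof -
  have s3: "sets ((borel \<Otimes>\<^sub>M borel) \<Otimes>\<^sub>M torus) = sets (borel :: ((real \<times> (real ^ 'n)) \<times> (real ^ 'n)) measure)"
    by (metis borel_prod sets_pair_measure_cong sets_torus)
  have "(\<lambda>q. (fst (fst q), (snd q + \<eta> (fst (fst q)) *\<^sub>R snd (fst q), snd (fst q)))) \<in> (borel :: ((real \<times> (real ^ 'n)) \<times> (real ^ 'n)) measure) \<rightarrow>\<^sub>M borel"
    by (intro borel_measurable_continuous_onI continuous_intros continuous_on_compose2[OF \<eta>]) auto
  from measurable_compose[OF this measurable_mode_G[OF t, of k]]
  show ?thesis by (simp add: measurable_cong_sets[OF s3 refl])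
qed

lemma measurable_H'_joint: "(\<lambda>q. H' (fst (fst q)) (snd q)) \<in> borel_measurable ((borel \<Otimes>\<^sub>M (borel :: (real ^ 'n) measure)) \<Otimes>\<^sub>M torus)"
  by (rule measurable_compose[OF _ measurable_H', of "\<lambda>q. (fst (fst q), snd q)", simplified]) measurable

text \<open>\<^const>\<open>K_free\<close> and \<^const>\<open>K_fric\<close> are separate Bochner integrals, with value 0 if the integrand is not
  integrable, so each must be shown to converge before their difference can be estimated.\<close>

lemma integrable_avg:
  assumes t: "t \<in> {0<..<T}" and \<eta>: "continuous_on UNIV \<eta>"
  shows "integrable lborel (avg t k \<eta>)"
proof (rule integrableI_bounded)
  have t': "t \<in> {0..T}" using t by auto
  let ?Z = "\<lambda>s v y. of_real (H' s y) * (indicator {0<..<t} s *\<^sub>R mode_G t k s (y + \<eta> s *\<^sub>R v, v))"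
  have avg: "avg t k \<eta> s = (LINT v|lborel. LINT y|torus. ?Z s v y)" for s
  proof (cases "s \<in> {0<..<t}")
    case True
    then interpret field_bound "G t s" p \<sigma> b using t by (intro field_bound_G) auto
    show ?thesis using True by (simp add: avg_def pairing_def)
  qed (simp add: avg_def)
  have "(\<lambda>q. ?Z (fst (fst q)) (snd (fst q)) (snd q)) \<in> borel_measurable ((borel \<Otimes>\<^sub>M borel) \<Otimes>\<^sub>M torus)"
    by (intro borel_measurable_times measurable_mode_G_shift t' \<eta>
        borel_measurable_continuous_on[of complex_of_real, OF _ measurable_H'_joint] continuous_intros)
  from measurable_double_integral[OF this]
  show "avg t k \<eta> \<in> borel_measurable lborel"
    unfolding avg[abs_def] .
  \<comment> \<open>The value of \<open>mode_bound k\<close>, the same for every s; hence the second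
    term is integrable over the bounded interval.\<close>
  define R where "R = 4 * (1 + supn k)\<^sup>2 * (real CARD('n))\<^sup>2 * b\<^sup>2"
  have "(\<integral>\<^sup>+s. ennreal (norm (avg t k \<eta> s)) \<partial>lborel)
      \<le> (\<integral>\<^sup>+s. decay_mass TYPE('n) \<sigma> * energy s + ennreal R * indicator {0<..<t} s \<partial>lborel)"
  proof (rule nn_integral_mono)
    fix s
    show "ennreal (norm (avg t k \<eta> s)) \<le> decay_mass TYPE('n) \<sigma> * energy s + ennreal R * indicator {0<..<t} s"
    proof (cases "s \<in> {0<..<t}")
      case True
      then interpret field_bound "G t s" p \<sigma> b using t by (intro field_bound_G) auto
      have p1: "p \<ge> 1" using p by simp
      have "ennreal (norm (pairing k (H' s) (\<eta> s)))
          \<le> (\<integral>\<^sup>+v. ennreal (norm (LINT y|torus. of_real (H' s y) * mode k (y + \<eta> s *\<^sub>R v, v))) \<partial>lborel)"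
        unfolding pairing_def by (rule norm_integral_le_nn_integral)
      also have "\<dots> \<le> (\<integral>\<^sup>+v. \<integral>\<^sup>+y. ennreal (cmod (of_real (H' s y) * mode k (y + \<eta> s *\<^sub>R v, v))) \<partial>torus \<partial>lborel)"
        by (rule nn_integral_mono) (rule norm_integral_le_nn_integral)
      also have "\<dots> \<le> decay_mass TYPE('n) \<sigma> * energy s + ennreal (mode_bound k)"
        unfolding energy_def by (rule nn_integral_pairing_le[OF p1]) simp
      finally show ?thesis using True by (simp add: avg_def R_def mode_bound_def)
    qed (simp add: avg_def)
  qed
  also have "\<dots> = decay_mass TYPE('n) \<sigma> * (\<integral>\<^sup>+s. energy s \<partial>lborel) + ennreal R * emeasure lborel {0<..<t}"
    by (simp add: nn_integral_add nn_integral_cmult nn_integral_cmult_indicator)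
  also have "\<dots> < \<infinity>"
  proof -
    have "decay_mass TYPE('n) \<sigma> < \<infinity>"
      unfolding decay_mass_def using sigma by (intro nn_integral_decay) simp
    then show ?thesis using energy_total_finite t by (simp add: ennreal_mult_less_top)
  qed
  finally show "(\<integral>\<^sup>+s. ennreal (norm (avg t k \<eta> s)) \<partial>lborel) < \<infinity>" .
qed

text \<open>The identity for the inner integrals is available where the energy is finite, which is
  almost every s. Measurability of the real integrands is proved separately from an explicit
  double-integral form.\<close>

lemma averaged_distr:
  assumes t: "t \<in> {0<..<T}" and \<eta>: "continuous_on UNIV \<eta>"
  defines "K \<equiv> \<lambda>\<psi>. LINT s:{0<..<t}|lborel. LINT v|lborel. shift (- (\<eta> s *\<^sub>R v)) (grad (H s)) (\<lambda>x. \<psi> x *\<^sub>R G t s x v)"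
  shows "K (\<lambda>x. cos (char_phase k x)) = - Re (LINT s|lborel. avg t k \<eta> s)"
    and "K (\<lambda>x. sin (char_phase k x)) = Im (LINT s|lborel. avg t k \<eta> s)"
proof -
  let ?c = "\<lambda>x. cos (char_phase k x)" and ?s = "\<lambda>x. sin (char_phase k x)"
  let ?S = "\<lambda>\<psi> s. LINT v|lborel. shift (- (\<eta> s *\<^sub>R v)) (grad (H s)) (\<lambda>x. \<psi> x *\<^sub>R G t s x v)"
  have p1: "p \<ge> 1" using p by simp
  note int = integrable_avg[OF t \<eta>, of k]
  have inner: "?S ?c s = - Re (avg t k \<eta> s)"
    "?S ?s s = Im (avg t k \<eta> s)"
    if s: "s \<in> {0<..<t}" and E: "energy s < \<infinity>" for s
  proof -
    have fb: "field_bound (G t s) p \<sigma> b" using s t by (intro field_bound_G) auto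
    interpret field_bound "G t s" p \<sigma> b by (rule fb)
    have Hs: "H s = H' s" using s t by (auto simp: H'_def)
    have avg: "avg t k \<eta> s = pairing k (H' s) (\<eta> s)" using s by (simp add: avg_def)
    note pp = pairing_parts[OF p1 measurable_H'_slice E[unfolded energy_def], of k "\<eta> s"]
    show "?S ?c s = - Re (avg t k \<eta> s)"
      unfolding shift_grad_eq divergence_char(1)[OF fb] avg Hs by (rule pp(1))
    show "?S ?s s = Im (avg t k \<eta> s)"
      unfolding shift_grad_eq divergence_char(2)[OF fb] avg Hs by (rule pp(2))
  qed
  have t': "t \<in> {0..T}" using t by auto
  have avg0: "avg t k \<eta> s = 0" if "s \<notin> {0<..<t}" for s
    using that by (simp add: avg_def)
  have mavg [measurable]: "avg t k \<eta> \<in> borel_measurable lborel" using int by (rule borel_measurable_integrable)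
  let ?m = "\<lambda>s v y. indicator {0<..<t} s *\<^sub>R mode_G t k s (y + \<eta> s *\<^sub>R v, v)"
  \<comment> \<open>Needed since \<^const>\<open>lborel\<close> is not complete: equality almost everywhere alone does not transfer the integral.\<close>
  have meas: "(\<lambda>s. - (LINT v|lborel. LINT y|torus. H' s y * L (?m s v y))) \<in> borel_measurable lborel"
    if "continuous_on UNIV L" for L :: "complex \<Rightarrow> real"
    by (intro borel_measurable_uminus measurable_double_integral borel_measurable_times measurable_H'_joint
        borel_measurable_continuous_on[OF that measurable_mode_G_shift[OF t' \<eta>]])
  have eq: "indicator {0<..<t} s *\<^sub>R ?S ?c s
       = - (LINT v|lborel. LINT y|torus. H' s y * Re (?m s v y))"
     "indicator {0<..<t} s *\<^sub>R ?S ?s s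
       = - (LINT v|lborel. LINT y|torus. H' s y * - Im (?m s v y))" for s
  proof -
    have "field_bound (G t s) p \<sigma> b" "H s = H' s" if "s \<in> {0<..<t}"
      using that t by (auto intro!: field_bound_G simp: H'_def)
    then show "indicator {0<..<t} s *\<^sub>R ?S ?c s
       = - (LINT v|lborel. LINT y|torus. H' s y * Re (?m s v y))"
      "indicator {0<..<t} s *\<^sub>R ?S ?s s
       = - (LINT v|lborel. LINT y|torus. H' s y * - Im (?m s v y))"
      by (cases "s \<in> {0<..<t}"; simp add: shift_grad_eq divergence_char)+
  qed
  have "K ?c = (LINT s|lborel. - Re (avg t k \<eta> s))"
    unfolding K_def set_lebesgue_integral_def
  proof (rule Bochner_Integration.integral_cong_AE)
    show "AE s in lborel. indicator {0<..<t} s *\<^sub>R ?S ?c s = - Re (avg t k \<eta> s)"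
      using AE_energy_finite by eventually_elim (auto simp: indicator_def inner avg0)
    show "(\<lambda>s. indicator {0<..<t} s *\<^sub>R ?S ?c s) \<in> borel_measurable lborel"
      unfolding eq by (rule meas) (intro continuous_intros)
  qed measurable
  then show "K ?c = - Re (LINT s|lborel. avg t k \<eta> s)"
    using integral_Re[OF int] by simp
  have "K ?s = (LINT s|lborel. Im (avg t k \<eta> s))"
    unfolding K_def set_lebesgue_integral_def
  proof (rule Bochner_Integration.integral_cong_AE)
    show "AE s in lborel. indicator {0<..<t} s *\<^sub>R ?S ?s s = Im (avg t k \<eta> s)"
      using AE_energy_finite by eventually_elim (auto simp: indicator_def inner avg0)
    show "(\<lambda>s. indicator {0<..<t} s *\<^sub>R ?S ?s s) \<in> borel_measurable lborel"
      unfolding eq by (rule meas) (intro continuous_intros)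
  qed measurable
  then show "K ?s = Im (LINT s|lborel. avg t k \<eta> s)"
    using integral_Im[OF int] by simp
qed

end

lemma measurable_time_kernel_slice [measurable]: "time_kernel L t \<in> borel_measurable borel"
  unfolding time_kernel_def[abs_def] by measurable

lemma Bessel_nn_integral:
  assumes [measurable]: "u \<in> borel_measurable borel"
  shows "(\<integral>\<^sup>+l. (ennreal (cmod (fcoeff (\<lambda>y. complex_of_real (u y)) l)))\<^sup>2 \<partial>count_space UNIV) \<le> (\<integral>\<^sup>+y. ennreal ((u y)\<^sup>2) \<partial>torus)"
proof (cases "(\<integral>\<^sup>+y. ennreal ((u y)\<^sup>2) \<partial>torus) = \<infinity>")
  case False
  let ?u = "\<lambda>y. complex_of_real (u y)"
  have sq: "sq_integrable ?u"
    unfolding sq_integrable_def using False by (auto simp: integrable_iff_bounded less_top)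
  then have int: "integrable torus (\<lambda>y. (u y)\<^sup>2)" by (simp add: sq_integrable_def)
  have "(\<Sum>l\<in>freq_box n. (ennreal (cmod (fcoeff ?u l)))\<^sup>2) \<le> (\<integral>\<^sup>+y. ennreal ((u y)\<^sup>2) \<partial>torus)" for n
  proof -
    have "(\<Sum>l\<in>freq_box n. (ennreal (cmod (fcoeff ?u l)))\<^sup>2) = ennreal (\<Sum>l\<in>freq_box n. (cmod (fcoeff ?u l))\<^sup>2)"
      by (simp add: ennreal_power sum_ennreal)
    also have "\<dots> \<le> ennreal (LINT y|torus. (cmod (?u y))\<^sup>2)"
      by (intro ennreal_leI Bessel sq) simp
    also have "\<dots> = (\<integral>\<^sup>+y. ennreal ((u y)\<^sup>2) \<partial>torus)"
      using nn_integral_eq_integral[OF int] by simp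
    finally show ?thesis .
  qed
  then show ?thesis unfolding nn_integral_count_space_freq_box by (intro SUP_least)
qed simp

context averaging
begin

abbreviation K_diff :: "real \<Rightarrow> 'n distr" where
  "K_diff t \<equiv> \<lambda>\<psi>. K_free G H t \<psi> - K_fric G H t \<psi>"

text \<open>The minus sign is that of the distributional gradient. The friction displacement is
  rewritten as minus (exp (t - s) - 1) v, so that both operators are instances of
  \<open>averaged_distr\<close>.\<close>

lemma fourier_coeff_diff:
  assumes t: "t \<in> {0<..<T}"
  shows "fourier_coeff (K_diff t) k
    = - (LINT s|lborel. avg t k (\<lambda>s. t - s) s - avg t k (\<lambda>s. exp (t - s) - 1) s)"
proof -
  have c: "continuous_on UNIV (\<lambda>s. t - s)" "continuous_on UNIV (\<lambda>s. exp (t - s) - 1)"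
    by (intro continuous_intros)+
  have free: "K_free G H t \<psi> = (LINT s:{0<..<t}|lborel. LINT v|lborel. shift (- ((t - s) *\<^sub>R v)) (grad (H s)) (\<lambda>x. \<psi> x *\<^sub>R G t s x v))" for \<psi>
    by (simp add: K_free_def)
  have "(1 - exp (t - s)) *\<^sub>R v = - ((exp (t - s) - 1) *\<^sub>R v)" for s and v :: "real ^ 'n"
    by (simp flip: scaleR_minus_left)
  then have fric: "K_fric G H t \<psi> = (LINT s:{0<..<t}|lborel. LINT v|lborel. shift (- ((exp (t - s) - 1) *\<^sub>R v)) (grad (H s)) (\<lambda>x. \<psi> x *\<^sub>R G t s x v))" for \<psi>
    by (simp only: K_fric_def)
  have "(LINT s|lborel. avg t k (\<lambda>s. t - s) s - avg t k (\<lambda>s. exp (t - s) - 1) s)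
      = (LINT s|lborel. avg t k (\<lambda>s. t - s) s) - (LINT s|lborel. avg t k (\<lambda>s. exp (t - s) - 1) s)"
    by (intro Bochner_Integration.integral_diff integrable_avg t c)
  then show ?thesis
    unfolding fourier_coeff_def char_phase_def[symmetric] free fric
      averaged_distr[OF t c(1)] averaged_distr[OF t c(2)]
    by (simp add: complex_eq_iff)
qed

definition coeff_H :: "int ^ 'n \<Rightarrow> real \<Rightarrow> ennreal" where
  "coeff_H l s = ennreal (cmod (fcoeff (\<lambda>y. complex_of_real (H' s y)) l))"

lemma measurable_coeff_H [measurable]: "coeff_H l \<in> borel_measurable borel"
proof -
  have "(\<lambda>z. complex_of_real (H' (fst z) (snd z)) * cnj (fchar l (snd z))) \<in> borel_measurable (borel \<Otimes>\<^sub>M torus)"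
  proof (intro borel_measurable_times)
    show "(\<lambda>z. complex_of_real (H' (fst z) (snd z))) \<in> borel_measurable (borel \<Otimes>\<^sub>M torus)"
      using measurable_H' by (intro borel_measurable_continuous_on[of complex_of_real] continuous_intros) (simp cong: measurable_cong_sets)
    show "(\<lambda>z. cnj (fchar l (snd z))) \<in> borel_measurable (borel \<Otimes>\<^sub>M torus)"
      unfolding cnj_fchar by measurable
  qed
  then have "(\<lambda>s. fcoeff (\<lambda>y. complex_of_real (H' s y)) l) \<in> borel_measurable borel"
    using torus.borel_measurable_lebesgue_integral[of "\<lambda>s y. complex_of_real (H' s y) * cnj (fchar l y)" borel]
    by (simp add: fcoeff_def case_prod_beta')
  then show ?thesis unfolding coeff_H_def[abs_def] by measurable
qed

text \<open>What is left of the l-th frequency of H at time t once the factor depending on k - l has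
  been split off; the frequency and time Schur tests can then be applied one after the
  other.\<close>

definition amplitude :: "int ^ 'n \<Rightarrow> real \<Rightarrow> ennreal" where
  "amplitude l t = (\<integral>\<^sup>+s. ennreal (time_kernel (supn l) t s) * coeff_H l s \<partial>lborel)"

lemma measurable_amplitude [measurable]: "amplitude l \<in> borel_measurable borel"
proof -
  have "(\<lambda>z. ennreal (time_kernel (supn l) (fst z) (snd z)) * coeff_H l (snd z)) \<in> borel_measurable (borel \<Otimes>\<^sub>M borel)"
    by measurable
  then show ?thesis
    using lborel.borel_measurable_nn_integral[of "\<lambda>t s. ennreal (time_kernel (supn l) t s) * coeff_H l s" borel]
    by (simp add: amplitude_def[abs_def] case_prod_beta' cong: measurable_cong_sets)
qed

lemma fourier_coeff_bound:
  assumes t: "t \<in> {0<..<T}"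
  shows "ennreal (sqrt (1 + (\<Sum>i\<in>UNIV. (of_int (k $ i))\<^sup>2)) * cmod (fourier_coeff (K_diff t) k))
    \<le> ennreal (kernel_const TYPE('n) \<sigma> * exp T * b)
       * (\<integral>\<^sup>+l. ennreal (1 / (1 + supn (k - l)) ^ (CARD('n) + 1)) * amplitude l t \<partial>count_space UNIV)"
proof -
  define r where "r = sqrt (1 + (\<Sum>i\<in>UNIV. (real_of_int (k $ i))\<^sup>2))"
  have r: "r \<ge> 0" by (simp add: r_def sum_nonneg)
  define c where "c = kernel_const TYPE('n) \<sigma> * exp T * b"
  have c: "c \<ge> 0" unfolding c_def by (intro mult_nonneg_nonneg kernel_const_nonneg b_nonneg) simp
  define w where "w l = 1 / (1 + supn (k - l)) ^ (CARD('n) + 1)" for l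
  have w: "w l \<ge> 0" for l using supn_nonneg[of "k - l"] by (simp add: w_def)
  let ?a = "\<lambda>s. avg t k (\<lambda>s. t - s) s - avg t k (\<lambda>s. exp (t - s) - 1) s"
  have inta: "integrable lborel ?a"
    by (intro Bochner_Integration.integrable_diff integrable_avg t continuous_intros)
  then have [measurable]: "?a \<in> borel_measurable lborel" by (rule borel_measurable_integrable)
  let ?b = "\<lambda>s l. ennreal c * ennreal (w l) * (ennreal (time_kernel (supn l) t s) * coeff_H l s)"
  have "ennreal (r * cmod (fourier_coeff (K_diff t) k)) = ennreal r * ennreal (cmod (LINT s|lborel. ?a s))"
    unfolding fourier_coeff_diff[OF t] using r by (simp add: ennreal_mult)
  also have "\<dots> \<le> ennreal r * (\<integral>\<^sup>+s. ennreal (cmod (?a s)) \<partial>lborel)"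
    by (intro mult_left_mono norm_integral_le_nn_integral) simp
  also have "\<dots> = (\<integral>\<^sup>+s. ennreal r * ennreal (cmod (?a s)) \<partial>lborel)"
    by (rule nn_integral_cmult[symmetric]) measurable
  also have "\<dots> \<le> (\<integral>\<^sup>+s. (\<integral>\<^sup>+l. ?b s l \<partial>count_space UNIV) \<partial>lborel)"
  proof (rule nn_integral_mono_AE)
    show "AE s in lborel. ennreal r * ennreal (cmod (?a s)) \<le> (\<integral>\<^sup>+l. ?b s l \<partial>count_space UNIV)"
      using AE_energy_finite
    proof eventually_elim
      case (elim s)
      show ?case
      proof (cases "s \<in> {0<..<t}")
        case True
        then interpret field_bound "G t s" p \<sigma> b using t by (intro field_bound_G) auto
        let ?h = "\<lambda>l. cmod (fcoeff (\<lambda>y. of_real (H' s y)) l)"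
        let ?P = "\<lambda>l. kernel_const TYPE('n) \<sigma> * exp (t - s) * b * (1 / (1 + supn (k - l)) ^ (CARD('n) + 1)) * (supn l / (1 + (t - s) * supn l)\<^sup>2) * ?h l"
        \<comment> \<open>The growth of the frequency gap is frozen at its largest value here; this
          is the origin of \<open>exp T\<close> in the estimate.\<close>
        have \<tau>: "t - s > 0" "exp (t - s) \<le> exp T" using True t by auto
        have "ennreal r * ennreal (cmod (?a s)) = ennreal (r * cmod (pairing k (H' s) (t - s) - pairing k (H' s) (exp (t - s) - 1)))"
          using True r by (simp add: avg_def ennreal_mult)
        also have "\<dots> \<le> (\<integral>\<^sup>+l. ennreal (?P l) \<partial>count_space UNIV)"
          unfolding r_def using elim by (intro pairing_diff_le p \<tau>) (auto simp: energy_def)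
        also have "\<dots> \<le> (\<integral>\<^sup>+l. ?b s l \<partial>count_space UNIV)"
        proof (rule nn_integral_mono)
          fix l :: "int ^ 'n"
          have tk: "time_kernel (supn l) t s = supn l / (1 + (t - s) * supn l)\<^sup>2" "time_kernel (supn l) t s \<ge> 0"
            using True supn_nonneg[of l] by (auto simp: time_kernel_def)
          have "kernel_const TYPE('n) \<sigma> * exp (t - s) * b * w l * time_kernel (supn l) t s * ?h l
             \<le> c * w l * time_kernel (supn l) t s * ?h l"
            unfolding c_def using \<tau>(2) w[of l] tk(2) kernel_const_nonneg[of "TYPE('n)" \<sigma>] b_nonneg
            by (intro mult_right_mono mult_left_mono) auto
          then have "ennreal (kernel_const TYPE('n) \<sigma> * exp (t - s) * b * w l * time_kernel (supn l) t s * ?h l)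
             \<le> ennreal (c * w l * time_kernel (supn l) t s * ?h l)"
            by (rule ennreal_leI)
          also have "\<dots> = ?b s l"
            by (simp only: coeff_H_def ennreal_mult''[OF norm_ge_zero] ennreal_mult''[OF tk(2)] ennreal_mult''[OF w]) (simp only: mult.assoc)
          finally show "ennreal (?P l) \<le> ?b s l"
            unfolding w_def tk(1) .
        qed
        finally show ?thesis .
      qed (simp add: avg_def)
    qed
  qed
  also have "\<dots> = (\<integral>\<^sup>+l. (\<integral>\<^sup>+s. ?b s l \<partial>lborel) \<partial>count_space UNIV)"
    by (rule nn_integral_count_space_nn_integral) (auto intro: countableI_type)
  also have "\<dots> = (\<integral>\<^sup>+l. ennreal c * (ennreal (w l) * amplitude l t) \<partial>count_space UNIV)"
  proof (rule nn_integral_cong)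
    fix l
    show "(\<integral>\<^sup>+s. ?b s l \<partial>lborel) = ennreal c * (ennreal (w l) * amplitude l t)"
      unfolding amplitude_def mult.assoc[symmetric, of "ennreal c"]
      by (rule nn_integral_cmult) measurable
  qed
  also have "\<dots> = ennreal c * (\<integral>\<^sup>+l. ennreal (w l) * amplitude l t \<partial>count_space UNIV)"
    by (rule nn_integral_cmult) simp
  finally show ?thesis unfolding r_def c_def w_def .
qed

lemma H1_norm_bound:
  assumes t: "t \<in> {0<..<T}"
  shows "(H1_norm (K_diff t))\<^sup>2
    \<le> (ennreal (kernel_const TYPE('n) \<sigma> * exp T * b) * weight_sum TYPE('n))\<^sup>2 * (\<integral>\<^sup>+l. (amplitude l t)\<^sup>2 \<partial>count_space UNIV)"
proof -
  let ?u = "fourier_coeff (K_diff t)"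
  let ?c = "ennreal (kernel_const TYPE('n) \<sigma> * exp T * b)"
  let ?W = "\<lambda>k. \<integral>\<^sup>+l. ennreal (1 / (1 + supn (k - l)) ^ (CARD('n) + 1)) * amplitude l t \<partial>count_space UNIV"
  have "(H1_norm (K_diff t))\<^sup>2
      \<le> (\<integral>\<^sup>+k. ennreal ((1 + (\<Sum>i\<in>UNIV. (of_int (k $ i))\<^sup>2)) * (cmod (?u k))\<^sup>2) \<partial>count_space UNIV)"
    unfolding H1_norm_def esqrt_power2 by (rule infsum_le_nn_integral_count_space)
  also have "\<dots> \<le> (\<integral>\<^sup>+k. ?c\<^sup>2 * (?W k)\<^sup>2 \<partial>count_space UNIV)"
  proof (rule nn_integral_mono)
    fix k :: "int ^ 'n"
    let ?r = "sqrt (1 + (\<Sum>i\<in>UNIV. (real_of_int (k $ i))\<^sup>2))"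
    have r: "?r \<ge> 0" "?r\<^sup>2 = 1 + (\<Sum>i\<in>UNIV. (of_int (k $ i))\<^sup>2)"
      by (simp_all add: sum_nonneg add_nonneg_nonneg)
    have "(1 + (\<Sum>i\<in>UNIV. (of_int (k $ i))\<^sup>2)) * (cmod (?u k))\<^sup>2 = (?r * cmod (?u k))\<^sup>2"
      by (simp only: power_mult_distrib r(2))
    then have "ennreal ((1 + (\<Sum>i\<in>UNIV. (of_int (k $ i))\<^sup>2)) * (cmod (?u k))\<^sup>2) = (ennreal (?r * cmod (?u k)))\<^sup>2"
      by (simp only: ennreal_power[OF mult_nonneg_nonneg[OF r(1) norm_ge_zero]])
    also have "\<dots> \<le> (?c * ?W k)\<^sup>2"
      by (intro power_mono fourier_coeff_bound t) simp
    finally show "ennreal ((1 + (\<Sum>i\<in>UNIV. (of_int (k $ i))\<^sup>2)) * (cmod (?u k))\<^sup>2) \<le> ?c\<^sup>2 * (?W k)\<^sup>2"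
      by (simp only: power_mult_distrib)
  qed
  also have "\<dots> = ?c\<^sup>2 * (\<integral>\<^sup>+k. (?W k)\<^sup>2 \<partial>count_space UNIV)"
    by (rule nn_integral_cmult) simp
  also have "\<dots> \<le> ?c\<^sup>2 * (weight_sum TYPE('n) * weight_sum TYPE('n) * (\<integral>\<^sup>+l. (amplitude l t)\<^sup>2 \<partial>count_space UNIV))"
    by (intro mult_left_mono weight_Schur) simp
  finally show ?thesis by (simp only: power2_eq_square mult_ac)
qed

text \<open>Tonelli puts the sum over l outside, where the time Schur test holds for every l with
  constant 1; a second exchange puts it back inside for Bessel's inequality.\<close>

lemma total_amplitude:
  "(\<integral>\<^sup>+t. (\<integral>\<^sup>+l. (amplitude l t)\<^sup>2 \<partial>count_space UNIV) \<partial>lborel) \<le> (L2_L2_norm T H)\<^sup>2"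
proof -
  have "(\<integral>\<^sup>+t. (\<integral>\<^sup>+l. (amplitude l t)\<^sup>2 \<partial>count_space UNIV) \<partial>lborel) = (\<integral>\<^sup>+l. (\<integral>\<^sup>+t. (amplitude l t)\<^sup>2 \<partial>lborel) \<partial>count_space UNIV)"
    by (rule nn_integral_count_space_nn_integral) (auto intro: countableI_type)
  also have "\<dots> \<le> (\<integral>\<^sup>+l. (\<integral>\<^sup>+s. (coeff_H l s)\<^sup>2 \<partial>lborel) \<partial>count_space UNIV)"
    unfolding amplitude_def by (rule nn_integral_mono, rule time_kernel_Schur[OF supn_nonneg measurable_coeff_H])
  also have "\<dots> = (\<integral>\<^sup>+s. (\<integral>\<^sup>+l. (coeff_H l s)\<^sup>2 \<partial>count_space UNIV) \<partial>lborel)"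
    by (rule nn_integral_count_space_nn_integral[symmetric]) (auto intro: countableI_type)
  also have "\<dots> \<le> (\<integral>\<^sup>+s. energy s \<partial>lborel)"
    unfolding coeff_H_def energy_def by (rule nn_integral_mono, rule Bessel_nn_integral[OF measurable_H'_slice])
  finally show ?thesis unfolding energy_total .
qed

lemma averaging_bound:
  "L2_H1_norm T K_diff
    \<le> ennreal (kernel_const TYPE('n) \<sigma> * enn2real (weight_sum TYPE('n)) * exp T) * ennreal b * L2_L2_norm T H"
proof -
  let ?c = "kernel_const TYPE('n) \<sigma> * exp T * b"
  define S where "S = enn2real (weight_sum TYPE('n))"
  have S: "weight_sum TYPE('n) = ennreal S" "S \<ge> 0"
    using weight_sum_finite[where 'n = 'n] by (simp_all add: S_def)
  have c: "?c \<ge> 0" by (intro mult_nonneg_nonneg kernel_const_nonneg b_nonneg) simp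
  obtain h where h: "L2_L2_norm T H = ennreal h" "h \<ge> 0"
    using H by (cases "L2_L2_norm T H") (auto simp: in_L2_L2_def)
  have "(\<integral>\<^sup>+t\<in>{0<..<T}. (H1_norm (K_diff t))\<^sup>2 \<partial>lborel)
     \<le> (\<integral>\<^sup>+t. (ennreal ?c * weight_sum TYPE('n))\<^sup>2 * (\<integral>\<^sup>+l. (amplitude l t)\<^sup>2 \<partial>count_space UNIV) \<partial>lborel)"
  proof (rule nn_integral_mono)
    fix t
    show "(H1_norm (K_diff t))\<^sup>2 * indicator {0<..<T} t
        \<le> (ennreal ?c * weight_sum TYPE('n))\<^sup>2 * (\<integral>\<^sup>+l. (amplitude l t)\<^sup>2 \<partial>count_space UNIV)"
    proof (cases "t \<in> {0<..<T}")
      case True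
      then show ?thesis using H1_norm_bound[OF True] by simp
    qed simp
  qed
  also have "\<dots> = (ennreal ?c * weight_sum TYPE('n))\<^sup>2 * (\<integral>\<^sup>+t. (\<integral>\<^sup>+l. (amplitude l t)\<^sup>2 \<partial>count_space UNIV) \<partial>lborel)"
  proof (rule nn_integral_cmult)
    show "(\<lambda>t. \<integral>\<^sup>+l. (amplitude l t)\<^sup>2 \<partial>count_space UNIV) \<in> borel_measurable lborel"
      \<comment> \<open>A supremum of countably many finite sums is measurable in t.\<close>
      unfolding nn_integral_count_space_freq_box by measurable
  qed
  also have "\<dots> \<le> (ennreal ?c * weight_sum TYPE('n))\<^sup>2 * (L2_L2_norm T H)\<^sup>2"
    by (intro mult_left_mono total_amplitude) simp
  also have "\<dots> = (ennreal ?c * weight_sum TYPE('n) * L2_L2_norm T H)\<^sup>2"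
    by (simp only: power_mult_distrib)
  also have "ennreal ?c * weight_sum TYPE('n) * L2_L2_norm T H = ennreal (?c * S * h)"
    unfolding S(1) h(1) by (simp only: ennreal_mult''[OF h(2)] ennreal_mult''[OF S(2)])
  also have "(ennreal (?c * S * h))\<^sup>2 = ennreal ((?c * S * h)\<^sup>2)"
    by (intro ennreal_power mult_nonneg_nonneg[OF mult_nonneg_nonneg[OF c S(2)] h(2)])
  finally have "L2_H1_norm T K_diff \<le> ennreal (?c * S * h)"
    unfolding L2_H1_norm_def
    by (subst esqrt_le_iff) (rule mult_nonneg_nonneg[OF mult_nonneg_nonneg[OF c S(2)] h(2)])
  also have "?c * S * h = kernel_const TYPE('n) \<sigma> * S * exp T * b * h" by (simp only: mult_ac)
  also have "ennreal \<dots> = ennreal (kernel_const TYPE('n) \<sigma> * S * exp T) * ennreal b * ennreal h"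
    by (simp only: ennreal_mult''[OF h(2)] ennreal_mult''[OF b_nonneg])
  finally show ?thesis unfolding h(1) S_def .
qed

end

lemma H1_norm_zero: "H1_norm ((\<lambda>\<psi>. 0) :: 'n::finite distr) = 0"
proof -
  have "fourier_coeff ((\<lambda>\<psi>. 0) :: 'n distr) k = 0" for k
    by (simp add: fourier_coeff_def complex_eq_iff)
  then show ?thesis by (simp add: H1_norm_def esqrt_def)
qed

theorem proposition4p7:
  fixes p :: nat and \<sigma> :: real
  assumes "p > 8 + CARD('n::finite)"
    and "\<sigma> > 1 + real CARD('n) / 2"
  shows "\<exists>(C::real) (\<phi>::real \<Rightarrow> real).
    C > 0 \<and> continuous_on {0..} \<phi> \<and> mono_on {0..} \<phi> \<and> (\<forall>r\<ge>0. \<phi> r \<ge> 0) \<and>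
    (\<forall>T>0. \<forall>(G :: real \<Rightarrow> real \<Rightarrow> real ^ 'n \<Rightarrow> real ^ 'n \<Rightarrow> real ^ 'n) (H :: real \<Rightarrow> real ^ 'n \<Rightarrow> real).
       smooth_on (\<lambda>(t, s, x, v). G t s x v) ({0..T} \<times> {0..T} \<times> UNIV \<times> UNIV) \<longrightarrow>
       (\<forall>t\<in>{0..T}. \<forall>s\<in>{0..T}. \<forall>v. periodic (\<lambda>x. G t s x v)) \<longrightarrow>
       in_L2_L2 T H \<longrightarrow>
       L2_H1_norm T (\<lambda>t \<psi>. K_free G H t \<psi> - K_fric G H t \<psi>)
         \<le> ennreal (C * \<phi> T) * (SUP (t, s)\<in>{0..T} \<times> {0..T}. weighted_Sobolev_norm p \<sigma> (G t s))
             * L2_L2_norm T H)"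
proof -
  \<comment> \<open>The other constants are known only to be nonnegative; adding 1 makes C positive,
    as demanded, and makes the right-hand side infinite when the norm of G is infinite and H is
    nonzero.\<close>
  define C where "C = kernel_const TYPE('n) \<sigma> * enn2real (weight_sum TYPE('n)) + 1"
  have C: "C > 0" "kernel_const TYPE('n) \<sigma> * enn2real (weight_sum TYPE('n)) \<le> C"
    using kernel_const_nonneg[of "TYPE('n)" \<sigma>] by (auto simp: C_def add_nonneg_pos)
  show ?thesis
  proof (intro exI[of _ C] exI[of _ exp] conjI allI impI)
    show "C > 0" by fact
    show "continuous_on {0..} (exp :: real \<Rightarrow> real)" by (intro continuous_intros)
    show "mono_on {0..} (exp :: real \<Rightarrow> real)" by (auto simp: mono_on_def)
    fix T :: real and G :: "real \<Rightarrow> real \<Rightarrow> real ^ 'n \<Rightarrow> real ^ 'n \<Rightarrow> real ^ 'n" and H :: "real \<Rightarrow> real ^ 'n \<Rightarrow> real"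
    assume T: "T > 0"
      and sm: "smooth_on (\<lambda>(t, s, x, v). G t s x v) ({0..T} \<times> {0..T} \<times> UNIV \<times> UNIV)"
      and per: "\<forall>t\<in>{0..T}. \<forall>s\<in>{0..T}. \<forall>v. periodic (\<lambda>x. G t s x v)" and H: "in_L2_L2 T H"
    define N where "N = (SUP (t, s)\<in>{0..T} \<times> {0..T}. weighted_Sobolev_norm p \<sigma> (G t s))"
    interpret source H T by standard (rule H)
    let ?L = "L2_H1_norm T (\<lambda>t \<psi>. K_free G H t \<psi> - K_fric G H t \<psi>)"
    have "N = \<infinity> \<or> N < \<infinity>" using top.not_eq_extremum[of N] by auto
    \<comment> \<open>A finite supremum is what provides the real bound b of the locale
      \<open>averaging\<close>; the degenerate cases are treated directly.\<close>
    then consider "L2_L2_norm T H = 0" | "L2_L2_norm T H \<noteq> 0" "N = \<infinity>" | "N < \<infinity>"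
      by blast
    then have "?L \<le> ennreal (C * exp T) * N * L2_L2_norm T H"
    proof cases
      case 1
      \<comment> \<open>\<open>\<infinity> * 0 = 0\<close> in \<^typ>\<open>ennreal\<close>, so an infinite norm of \<open>G\<close> does not make this case trivial.\<close>
      have "(\<integral>\<^sup>+t\<in>{0<..<T}. (H1_norm (\<lambda>\<psi>. K_free G H t \<psi> - K_fric G H t \<psi>))\<^sup>2 \<partial>lborel) = (\<integral>\<^sup>+(t :: real). 0 \<partial>lborel)"
      proof (rule nn_integral_cong)
        show "(H1_norm (\<lambda>\<psi>. K_free G H t \<psi> - K_fric G H t \<psi>))\<^sup>2 * indicator {0<..<T} t = 0" for t
          by (cases "t \<in> {0<..<T}") (simp_all add: K_eq_0[OF 1] H1_norm_zero)
      qed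
      then have "?L = 0" by (simp add: L2_H1_norm_def esqrt_def)
      then show ?thesis by simp
    next
      case 2
      have "C * exp T > 0" using C(1) by simp
      then have "ennreal (C * exp T) * N * L2_L2_norm T H = top"
        using 2 by (simp add: ennreal_mult_eq_top_iff ennreal_eq_0_iff)
      then show ?thesis by (simp only: top_greatest)
    next
      case 3
      then obtain b where b: "N = ennreal b" "b \<ge> 0" by (cases N) auto
      interpret averaging H T G p \<sigma> b
      proof
        show "weighted_Sobolev_norm p \<sigma> (G t s) \<le> ennreal b" if "t \<in> {0..T}" "s \<in> {0..T}" for t s
          unfolding b(1)[symmetric] N_def using that by (intro SUP_upper2[of "(t, s)"]) auto
      qed (use assms sm per b in auto)
      have "?L \<le> ennreal (kernel_const TYPE('n) \<sigma> * enn2real (weight_sum TYPE('n)) * exp T) * ennreal b * L2_L2_norm T H"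
        by (rule averaging_bound)
      also have "\<dots> \<le> ennreal (C * exp T) * ennreal b * L2_L2_norm T H"
        using C by (intro mult_right_mono ennreal_leI) auto
      finally show ?thesis unfolding b(1) .
    qed
    then show "?L \<le> ennreal (C * exp T) * (SUP (t, s)\<in>{0..T} \<times> {0..T}. weighted_Sobolev_norm p \<sigma> (G t s)) * L2_L2_norm T H"
      unfolding N_def .
  qed simp
qed

end
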